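(* Let $m$ be a positive integer. Let $\sigma=\{\sigma_t\}_{t\ge 0}$ be a regenerative process with values in a set $\mathcal S$, with cycle lengths $\{R_k\}_{k\ge 1}$ and embedded renewal process $\{Z_k\}_{k\ge 0}$, let $\{A_s\}_{s\in\mathcal S}$ be a family of real $n\times n$ matrices, and let $\Sigma$ be the regenerative switched linear system $$\Sigma:\quad \frac{dx}{dt}=A_{\sigma_t}x(t),\qquad x(0)=x_0\in\mathbb R^n .$$ Assume that (A1) either $m$ is even or $\Sigma$ is positive; (A2) $R_1$ is essentially bounded; (A3) the set $\{A_s\}_{s\in\mathcal S}$ is bounded. Let $M_0=\Phi(\,\cdot\,;Z_0,Z_1)$ be the transition matrix of $\Sigma$ over the first cycle $[0,R_1]$. Then the following statements are equivalent. 1. $\Sigma$ is exponentially $m$th mean stable. 2. $\Sigma$ is stochastically $m$th mean stable. 3. The matrix $E[M_0^{[m]}]$ is Schur stable.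
   Context: All random objects live on a fixed probability space $(\Omega,\mathcal M,P)$; $E$ denotes expectation (entrywise for vectors and matrices). All random variables that appear are assumed to be integrable. $\|\cdot\|$ is the Euclidean norm. $x\ge 0$ for $x\in\mathbb R^n$ means entrywise nonnegativity. Regenerative process: a stochastic process $\sigma=\{\sigma_t\}_{t\ge0}$ for which there is a random variable $R_1>0$ (a regeneration epoch) such that $\{\sigma_{t+R_1}\}_{t\ge0}$ is independent of $\{\{\sigma_t\}_{t<R_1},R_1\}$ and $\{\sigma_{t+R_1}\}_{t\ge0}$ is stochastically equivalent to (has the same law as) $\{\sigma_t\}_{t\ge0}$. Applying the definition repeatedly yields i.i.d. random variables $\{R_k\}_{k\ge1}$ (cycle lengths) which break $\sigma$ into independent and identically distributed cycles $\{\sigma_t\}_{0\le t<R_1}$, $\{\sigma_t\}_{R_1\le t<R_1+R_2},\dots$ (each cycle taken together with its length, and re-timed to start at $0$). Put $Z_0=0$ and $Z_k=R_1+\cdots+R_k$; $\{Z_k\}_{k\ge0}$ is the embedded renewal process of $\sigma$. It is understood that $(t,\omega)\mapsto A_{\sigma_t(\omega)}$ is measurable, so that the differential equations make sense pathwise (with absolutely continuous solutions). Transition matrices: for $\omega\in\Omega$ and $t\ge t_0\ge0$, $\Phi(\omega;t_0,t)\in\mathbb R^{n\times n}$ is defined by $\partial\Phi/\partial t=A_{\sigma_t(\omega)}\Phi(\omega;t_0,t)$, $\Phi(\omega;t_0,t_0)=I_n$. For $k\ge0$, $M_k(\omega)=\Phi(\omega;Z_k(\omega),Z_{k+1}(\omega))$.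 The initial state $x_0$ is always a constant (deterministic) vector. $\Sigma$ is exponentially $m$th mean stable if there exist $\alpha>0$, $\beta>0$ such that $E[\|x(t)\|^m]\le\alpha e^{-\beta t}\|x_0\|^m$ for all $x_0\in\mathbb R^n$ and $t\ge0$. $\Sigma$ is stochastically $m$th mean stable if $\int_0^\infty E[\|x(t)\|^m]\,dt<\infty$ for every $x_0\in\mathbb R^n$. $\Sigma$ is positive if $x_0\ge0$ implies $x(t)\ge0$ with probability one for every $t\ge0$. $m$-lift: for $x\in\mathbb R^n$, $x^{[m]}$ is the real vector of length $n_m=\binom{n+m-1}{m}$ whose entries are the lexicographically ordered monomials $\sqrt{\alpha!}\,x^\alpha$, indexed by all $\alpha=(\alpha_1,\dots,\alpha_n)\in\{0,1,\dots,m\}^n$ with $\alpha_1+\cdots+\alpha_n=m$, where here $\alpha!:=m!/(\alpha_1!\cdots\alpha_n!)$. For $A\in\mathbb R^{n\times n}$, $A^{[m]}\in\mathbb R^{n_m\times n_m}$ is the unique matrix with $(Ax)^{[m]}=A^{[m]}x^{[m]}$ for all $x\in\mathbb R^n$. A square matrix is Schur stable if its spectral radius is less than one. *)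

theory Defs
  imports
    "HOL-Probability.Probability"
    "Jordan_Normal_Form.Spectral_Radius"
begin

hide_const (open) Matrix.vec Matrix.mat
hide_type (open) Matrix.vec
no_notation vec_index (infixl "$" 100)

text \<open>
  The state set is the space of a measurable space \<open>N\<close>, and the law of a process indexed by
  \<open>t \<ge> 0\<close> is the law of its path in the product sigma-algebra.
\<close>

definition path :: "(real \<Rightarrow> 'w \<Rightarrow> 's) \<Rightarrow> 'w \<Rightarrow> real \<Rightarrow> 's" where
  "path X \<omega> = (\<lambda>t\<in>{0..}. X t \<omega>)"

definition path_space :: "'s measure \<Rightarrow> (real \<Rightarrow> 's) measure" where
  "path_space N = (\<Pi>\<^sub>M t\<in>{0..}. N)"

definition stochastic_process ::
    "'w measure \<Rightarrow> 's measure \<Rightarrow> (real \<Rightarrow> 'w \<Rightarrow> 's) \<Rightarrow> bool" where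
  "stochastic_process M N X \<longleftrightarrow> (\<forall>t\<ge>0. X t \<in> measurable M N)"

definition shift_process ::
    "('w \<Rightarrow> real) \<Rightarrow> (real \<Rightarrow> 'w \<Rightarrow> 's) \<Rightarrow> real \<Rightarrow> 'w \<Rightarrow> 's" where
  "shift_process T X t \<omega> = X (t + T \<omega>) \<omega>"

text \<open>
  A path \<open>(X t)\<close> on the random interval \<open>0 \<le> t < T\<close> is encoded on all of
  \<open>{0..}\<close> with the cemetery state \<^const>\<open>None\<close> from time \<open>T\<close> on.
\<close>

definition killed_space :: "'s measure \<Rightarrow> 's option measure" where
  "killed_space N =
     sigma (insert None (Some ` space N)) (insert {None} ((\<lambda>B. Some ` B) ` sets N))"

definition cycle :: "(real \<Rightarrow> 'w \<Rightarrow> 's) \<Rightarrow> ('w \<Rightarrow> real) \<Rightarrow> 'w \<Rightarrow> (real \<Rightarrow> 's option) \<times> real" where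
  "cycle X T \<omega> = (path (\<lambda>t \<omega>. if t < T \<omega> then Some (X t \<omega>) else None) \<omega>, T \<omega>)"

definition cycle_space :: "'s measure \<Rightarrow> ((real \<Rightarrow> 's option) \<times> real) measure" where
  "cycle_space N = path_space (killed_space N) \<Otimes>\<^sub>M borel"

definition generated_events :: "'w measure \<Rightarrow> 'b measure \<Rightarrow> ('w \<Rightarrow> 'b) \<Rightarrow> 'w set set" where
  "generated_events M K f = {f -` B \<inter> space M |B. B \<in> sets K}"

definition regeneration_epoch ::
    "'w measure \<Rightarrow> 's measure \<Rightarrow> (real \<Rightarrow> 'w \<Rightarrow> 's) \<Rightarrow> ('w \<Rightarrow> real) \<Rightarrow> bool" where
  "regeneration_epoch M N X T \<longleftrightarrow>
     T \<in> borel_measurable M \<and> (\<forall>\<omega>\<in>space M. 0 < T \<omega>) \<and>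
     stochastic_process M N (shift_process T X) \<and>
     prob_space.indep_set M
       (generated_events M (path_space N) (path (shift_process T X)))
       (generated_events M (cycle_space N) (cycle X T)) \<and>
     distr M (path_space N) (path (shift_process T X)) = distr M (path_space N) (path X)"

text \<open>Cycle lengths are indexed from 1; the value \<open>R 0\<close> is never used.\<close>

definition renewal :: "(nat \<Rightarrow> 'w \<Rightarrow> real) \<Rightarrow> nat \<Rightarrow> 'w \<Rightarrow> real" where
  "renewal R k \<omega> = (\<Sum>i=1..k. R i \<omega>)"

definition nth_cycle ::
    "(real \<Rightarrow> 'w \<Rightarrow> 's) \<Rightarrow> (nat \<Rightarrow> 'w \<Rightarrow> real) \<Rightarrow> nat \<Rightarrow> 'w \<Rightarrow> (real \<Rightarrow> 's option) \<times> real" where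
  "nth_cycle \<sigma> R k = cycle (shift_process (renewal R k) \<sigma>) (R (Suc k))"

definition regenerative_process ::
    "'w measure \<Rightarrow> 's measure \<Rightarrow> (real \<Rightarrow> 'w \<Rightarrow> 's) \<Rightarrow> (nat \<Rightarrow> 'w \<Rightarrow> real) \<Rightarrow> bool" where
  "regenerative_process M N \<sigma> R \<longleftrightarrow>
     stochastic_process M N \<sigma> \<and>
     regeneration_epoch M N \<sigma> (R 1) \<and>
     (\<forall>k\<ge>1. R k \<in> borel_measurable M \<and> (\<forall>\<omega>\<in>space M. 0 < R k \<omega>)) \<and>
     prob_space.indep_vars M (\<lambda>k. cycle_space N) (nth_cycle \<sigma> R) UNIV \<and>
     (\<forall>k. distr M (cycle_space N) (nth_cycle \<sigma> R k) =
          distr M (cycle_space N) (nth_cycle \<sigma> R 0))"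

text \<open>
  Solutions of \<open>y' = F t y\<close>, \<open>y t0 = y0\<close> on \<open>{t0..}\<close> in the sense of Caratheodory. The
  integral equation says exactly that \<open>y\<close> is locally absolutely continuous, satisfies the
  differential equation almost everywhere and has the prescribed initial value.
\<close>

definition ode_solution ::
    "(real \<Rightarrow> 'a \<Rightarrow> 'a) \<Rightarrow> real \<Rightarrow> 'a \<Rightarrow> (real \<Rightarrow> 'a::euclidean_space) \<Rightarrow> bool" where
  "ode_solution F t0 y0 y \<longleftrightarrow>
     (\<forall>t\<ge>t0. set_integrable lborel {t0..t} (\<lambda>s. F s (y s)) \<and>
             y t = y0 + (LINT s:{t0..t}|lborel. F s (y s)))"

definition trajectories ::
    "'w measure \<Rightarrow> (real \<Rightarrow> 'w \<Rightarrow> 's) \<Rightarrow> ('s \<Rightarrow> real^'n^'n) \<Rightarrow>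
     (real^'n \<Rightarrow> real \<Rightarrow> 'w \<Rightarrow> real^'n) \<Rightarrow> bool" where
  "trajectories M \<sigma> A x \<longleftrightarrow>
     (\<forall>x0. \<forall>\<omega>\<in>space M. ode_solution (\<lambda>t y. A (\<sigma> t \<omega>) *v y) 0 x0 (\<lambda>t. x x0 t \<omega>))"

definition transition_matrices ::
    "'w measure \<Rightarrow> (real \<Rightarrow> 'w \<Rightarrow> 's) \<Rightarrow> ('s \<Rightarrow> real^'n^'n) \<Rightarrow>
     ('w \<Rightarrow> real \<Rightarrow> real \<Rightarrow> real^'n^'n) \<Rightarrow> bool" where
  "transition_matrices M \<sigma> A \<Phi> \<longleftrightarrow>
     (\<forall>\<omega>\<in>space M. \<forall>t0\<ge>0.
        ode_solution (\<lambda>t Y. A (\<sigma> t \<omega>) ** Y) t0 (Finite_Cartesian_Product.mat 1) (\<Phi> \<omega> t0))"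

definition cycle_matrix ::
    "('w \<Rightarrow> real \<Rightarrow> real \<Rightarrow> real^'n^'n) \<Rightarrow> (nat \<Rightarrow> 'w \<Rightarrow> real) \<Rightarrow> nat \<Rightarrow> 'w \<Rightarrow> real^'n^'n" where
  "cycle_matrix \<Phi> R k \<omega> = \<Phi> \<omega> (renewal R k \<omega>) (renewal R (Suc k) \<omega>)"

definition positive_system ::
    "'w measure \<Rightarrow> (real^'n \<Rightarrow> real \<Rightarrow> 'w \<Rightarrow> real^'n) \<Rightarrow> bool" where
  "positive_system M x \<longleftrightarrow>
     (\<forall>x0. (\<forall>i. 0 \<le> x0 $ i) \<longrightarrow> (\<forall>t\<ge>0. AE \<omega> in M. \<forall>i. 0 \<le> x x0 t \<omega> $ i))"

text \<open>
  The moments \<open>E \<parallel>x(t)\<parallel>^m\<close> are required to be finite, since the Bochner integral of a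
  non-integrable function is 0.
\<close>

definition exponentially_mean_stable ::
    "'w measure \<Rightarrow> nat \<Rightarrow> (real^'n \<Rightarrow> real \<Rightarrow> 'w \<Rightarrow> real^'n) \<Rightarrow> bool" where
  "exponentially_mean_stable M m x \<longleftrightarrow>
     (\<exists>\<alpha>>0. \<exists>\<beta>>0. \<forall>x0. \<forall>t\<ge>0.
        integrable M (\<lambda>\<omega>. norm (x x0 t \<omega>) ^ m) \<and>
        prob_space.expectation M (\<lambda>\<omega>. norm (x x0 t \<omega>) ^ m)
          \<le> \<alpha> * exp (- \<beta> * t) * norm x0 ^ m)"

definition stochastically_mean_stable ::
    "'w measure \<Rightarrow> nat \<Rightarrow> (real^'n \<Rightarrow> real \<Rightarrow> 'w \<Rightarrow> real^'n) \<Rightarrow> bool" where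
  "stochastically_mean_stable M m x \<longleftrightarrow>
     (\<forall>x0. (\<forall>t\<ge>0. integrable M (\<lambda>\<omega>. norm (x x0 t \<omega>) ^ m)) \<and>
       (\<integral>\<^sup>+t\<in>{0..}. ennreal (prob_space.expectation M (\<lambda>\<omega>. norm (x x0 t \<omega>) ^ m)) \<partial>lborel)
         < \<infinity>)"

text \<open>
  The exponents \<open>\<alpha>\<close> with \<open>n\<close> entries and sum \<open>m\<close>, in lexicographic order with the largest
  first entry first.
\<close>

fun exponents :: "nat \<Rightarrow> nat \<Rightarrow> nat list list" where
  "exponents 0 m = (if m = 0 then [[]] else [])"
| "exponents (Suc n) m =
     concat (map (\<lambda>k. map ((#) k) (exponents n (m - k))) (rev [0..<Suc m]))"

lemma set_exponents: "set (exponents n m) = {\<alpha>. length \<alpha> = n \<and> sum_list \<alpha> = m}"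
proof (induction n arbitrary: m)
  case (Suc n)
  show ?case
  proof (intro Set.set_eqI iffI)
    fix \<alpha> assume "\<alpha> \<in> {\<alpha>. length \<alpha> = Suc n \<and> sum_list \<alpha> = m}"
    then show "\<alpha> \<in> set (exponents (Suc n) m)"
      by (cases \<alpha>) (auto simp: Suc.IH image_iff less_Suc_eq_le)
  qed (auto simp: Suc.IH)
qed auto

lemma exponents_descending:
  "sorted_wrt (\<lambda>\<alpha> \<beta>. (\<beta>, \<alpha>) \<in> lexord {(i, j). i < j}) (exponents n m)"
proof (induction n arbitrary: m)
  case (Suc n)
  have "sorted_wrt (\<lambda>\<alpha> \<beta>. (\<beta>, \<alpha>) \<in> lexord {(i, j). i < j})
          (concat (map (\<lambda>k. map ((#) k) (exponents n (m - k))) (rev [0..<l])))" for l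
    by (induction l) (auto simp: sorted_wrt_append sorted_wrt_map Suc.IH)
  then show ?case by (simp only: exponents.simps)
qed auto

definition lift_dim :: "nat \<Rightarrow> nat \<Rightarrow> nat" where
  "lift_dim n m = (n + m - 1) choose m"

lemma length_exponents: "length (exponents n m) = lift_dim n m"
proof (induction n arbitrary: m)
  case 0
  show ?case by (cases m) (auto simp: lift_dim_def)
next
  case (Suc n)
  have "length (exponents (Suc n) m) = (\<Sum>k\<leftarrow>rev [0..<Suc m]. lift_dim n (m - k))"
    by (simp add: length_concat comp_def Suc.IH del: upt_Suc)
  also have "\<dots> = (\<Sum>k\<le>m. lift_dim n (m - k))"
    by (simp add: rev_map[symmetric] interv_sum_list_conv_sum_set_nat
        atLeast0LessThan lessThan_Suc_atMost del: upt_Suc)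
  also have "\<dots> = (\<Sum>k\<le>m. lift_dim n k)"
    by (rule sum.nat_diff_reindex[of _ "Suc m", unfolded lessThan_Suc_atMost, simplified])
  also have "\<dots> = lift_dim (Suc n) m"
  proof (cases n)
    case 0
    have "(\<Sum>k\<le>m. lift_dim 0 k) = (\<Sum>k\<le>m. if k = 0 then 1 else 0)"
      by (rule sum.cong) (auto simp: lift_dim_def)
    then show ?thesis using 0 by (simp add: lift_dim_def)
  next
    case (Suc n')
    then show ?thesis
      using sum_choose_lower[of n' m] by (simp add: lift_dim_def)
  qed
  finally show ?case .
qed

definition coordinate :: "real^'n::{finite,linorder} \<Rightarrow> nat \<Rightarrow> real" where
  "coordinate x i = x $ (sorted_list_of_set UNIV ! i)"

definition multinomial :: "nat list \<Rightarrow> real" where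
  "multinomial \<alpha> = fact (sum_list \<alpha>) / (\<Prod>a\<leftarrow>\<alpha>. fact a)"

definition lift_vec :: "nat \<Rightarrow> real^'n::{finite,linorder} \<Rightarrow> real Matrix.vec" where
  "lift_vec m x = vec_of_list (map
     (\<lambda>\<alpha>. sqrt (multinomial \<alpha>) * (\<Prod>i<CARD('n). coordinate x i ^ (\<alpha> ! i)))
     (exponents CARD('n) m))"

definition lift_mat :: "nat \<Rightarrow> real^'n::{finite,linorder}^'n::{finite,linorder} \<Rightarrow> real Matrix.mat" where
  "lift_mat m A = (THE B. B \<in> carrier_mat (lift_dim CARD('n) m) (lift_dim CARD('n) m) \<and>
     (\<forall>x. lift_vec m (A *v x) = B *\<^sub>v lift_vec m x))"

definition expectation_mat ::
    "'w measure \<Rightarrow> nat \<Rightarrow> nat \<Rightarrow> ('w \<Rightarrow> real Matrix.mat) \<Rightarrow> real Matrix.mat" where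
  "expectation_mat M r c X =
     Matrix.mat r c (\<lambda>(i, j). prob_space.expectation M (\<lambda>\<omega>. X \<omega> $$ (i, j)))"

definition schur_stable :: "real Matrix.mat \<Rightarrow> bool" where
  "schur_stable B \<longleftrightarrow> spectral_radius (map_mat complex_of_real B) < 1"

end

theory Submission
  imports Defs "Jordan_Normal_Form.Jordan_Normal_Form_Existence"
begin

text \<open>
  Let \<open>V\<^sub>k = x(Z\<^sub>k)\<close>, so that \<open>V\<^sub>k\<^sub>+\<^sub>1 = M\<^sub>k V\<^sub>k\<close>. The matrix \<open>M\<^sub>k\<close> agrees almost surely with one and
  the same measurable function of the \<open>k\<close>-th cycle, and \<open>V\<^sub>k\<close> depends on the earlier cycles only;
  hence \<open>E[V\<^sub>k^[m]] = E[M\<^sub>0^[m]]^k x\<^sub>0^[m]\<close>. If \<open>\<parallel>A v\<parallel> \<le> a \<parallel>v\<parallel>\<close> and cycles last at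
  most \<open>C\<close>, then norms change within one cycle by a factor of at most \<open>exp(a C)\<close>.

  If \<open>\<integral> E\<parallel>x(t)\<parallel>^m dt < \<infinity>\<close>, splitting the integral into cycles bounds
  \<open>\<Sum>\<^sub>k E[R\<^sub>k\<^sub>+\<^sub>1 \<parallel>V\<^sub>k\<parallel>^m] = E[R\<^sub>1] \<Sum>\<^sub>k E\<parallel>V\<^sub>k\<parallel>^m\<close>, so \<open>E[M\<^sub>0^[m]]^k x^[m]\<close> tends to 0 for every \<open>x\<close>;
  lifted vectors span, so the powers of \<open>E[M\<^sub>0^[m]]\<close> tend to 0.

  Conversely \<open>\<parallel>x\<parallel>^m\<close> is, for even \<open>m\<close>, a linear functional of \<open>x^[m]\<close>, and for \<open>x \<ge> 0\<close> it is
  dominated by the functional \<open>(\<Sum>\<^sub>i x\<^sub>i)^m\<close>, so Schur stability makes \<open>E\<parallel>V\<^sub>k\<parallel>^m\<close> decay geometrically.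
  The cycle containing \<open>t\<close> has an index at least \<open>\<lfloor>t / C\<rfloor>\<close>, whence
  \<open>\<parallel>x(t)\<parallel>^m \<le> exp(a C m) \<Sum>{\<parallel>V\<^sub>k\<parallel>^m | k \<ge> \<lfloor>t / C\<rfloor>}\<close>.
\<close>

section \<open>Linear differential equations with measurable coefficients\<close>

text \<open>The delicate point is that \<open>M_k\<close> is almost surely one measurable function
  of the k-th cycle. The law of a cycle lives on the product sigma-algebra, whose events depend on
  countably many times, whereas solving the equation means integrating along the path, and
  \<open>A (\<sigma> t \<omega>)\<close> is only known to be jointly measurable in time and sample
  point. The predicate \<open>factors\<close> therefore asks for an almost sure representation with
  the same function for every k. It is preserved by composition, by pointwise limits and, through
  conditional densities, by time integrals; hence it survives Picard iteration. The second obstacle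
  explains (A1): the recursion for the mean of the lift controls linear functionals of the lift and
  nothing else, so the m-th power of the norm has to be dominated by such a functional. In the
  positive case this works directly for nonnegative initial states only, and a general initial state
  is written as a difference of two of them.\<close>

lemma gronwall:
  fixes u :: "real \<Rightarrow> real"
  assumes cont: "continuous_on {0..T} u" and a: "0 \<le> a"
    and le: "\<And>t. t \<in> {0..T} \<Longrightarrow> u t \<le> c + a * integral {0..t} u"
    and t: "t \<in> {0..T}"
  shows "u t \<le> c * exp (a * t)"
proof -
  \<comment> \<open>The right-hand side of the hypothesis times the integrating factor; the
    hypothesis makes its derivative nonpositive.\<close>
  define W where "W s = exp (- a * s) * (c + a * integral {0..s} u)" for s
  have int: "((\<lambda>s. integral {0..s} u) has_real_derivative u s) (at s within {0..T})"
    if "s \<in> {0..T}" for s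
    using integral_has_real_derivative[OF cont that] .
  have der: "(W has_real_derivative
      exp (- a * s) * a * (u s - (c + a * integral {0..s} u))) (at s within {0..T})"
    if "s \<in> {0..T}" for s
    unfolding W_def
    by (rule derivative_eq_intros int that refl)+ (simp add: algebra_simps)
  have "W t \<le> W 0"
  proof (rule DERIV_nonpos_imp_decreasing_open[where f=W])
    show "0 \<le> t" using t by simp
    show "\<exists>y. (W has_real_derivative y) (at s) \<and> y \<le> 0" if "0 < s" "s < t" for s
    proof -
      have s: "s \<in> {0..T}" "at s within {0..T} = at s"
        using that t by (auto intro: at_within_Icc_at)
      have "exp (- a * s) * a * (u s - (c + a * integral {0..s} u)) \<le> 0"
        using le[OF s(1)] a by (intro mult_nonneg_nonpos) auto
      then show ?thesis using der[OF s(1)] unfolding s(2) by blast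
    qed
    show "continuous_on {0..t} W"
      by (rule continuous_on_subset[OF DERIV_continuous_on[OF der]]) (use t in auto)
  qed
  also have "W 0 = c" by (simp add: W_def)
  finally have "exp (a * t) * (exp (- a * t) * (c + a * integral {0..t} u)) \<le> exp (a * t) * c"
    unfolding W_def by (intro mult_left_mono) auto
  then have "c + a * integral {0..t} u \<le> c * exp (a * t)"
    by (simp add: mult.assoc[symmetric] exp_add[symmetric] mult.commute)
  with le[OF t] show ?thesis by simp
qed

section \<open>Caratheodory solutions of linear equations: restarting, growth and uniqueness\<close>

lemma ode_solution_henstock:
  assumes "ode_solution F t0 y0 y" "t0 \<le> t"
  shows "(\<lambda>s. F s (y s)) integrable_on {t0..t}"
    "y t = y0 + integral {t0..t} (\<lambda>s. F s (y s))"
proof -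
  have i: "set_integrable lborel {t0..t} (\<lambda>s. F s (y s))"
    and y: "y t = y0 + (LINT s:{t0..t}|lborel. F s (y s))"
    using assms unfolding ode_solution_def by blast+
  show "(\<lambda>s. F s (y s)) integrable_on {t0..t}"
    by (rule set_borel_integral_eq_integral(1)[OF i])
  show "y t = y0 + integral {t0..t} (\<lambda>s. F s (y s))"
    unfolding y set_borel_integral_eq_integral(2)[OF i] ..
qed

lemma ode_solution_initial: "ode_solution F t0 y0 y \<Longrightarrow> y t0 = y0"
  using ode_solution_henstock(2)[of F t0 y0 y t0] by simp

lemma ode_solution_continuous:
  assumes "ode_solution F t0 y0 y"
  shows "continuous_on {t0..T} y"
proof (cases "t0 \<le> T")
  case True
  have "continuous_on {t0..T} (\<lambda>t. y0 + integral {t0..t} (\<lambda>s. F s (y s)))"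
    by (intro continuous_intros indefinite_integral_continuous_1
        ode_solution_henstock(1)[OF assms True])
  then show ?thesis
    by (rule continuous_on_eq) (use ode_solution_henstock(2)[OF assms] in auto)
qed auto

lemma ode_solution_increment:
  assumes sol: "ode_solution F t0 y0 y" and "t0 \<le> r" "r \<le> t"
  shows "set_integrable lborel {r..t} (\<lambda>s. F s (y s))"
    and "y t - y r = (LINT s:{r..t}|lborel. F s (y s))"
proof -
  have int: "set_integrable lborel {t0..t} (\<lambda>s. F s (y s))"
    using assms by (auto simp: ode_solution_def)
  then show i: "set_integrable lborel {r..t} (\<lambda>s. F s (y s))"
    by (rule set_integrable_subset) (use assms in auto)
  have e: "y s = y0 + (LINT s:{t0..s}|lborel. F s (y s))" if "t0 \<le> s" for s
    using that sol by (auto simp: ode_solution_def)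
  have "integral {t0..t} (\<lambda>s. F s (y s)) =
      integral {t0..r} (\<lambda>s. F s (y s)) + integral {r..t} (\<lambda>s. F s (y s))"
    using Henstock_Kurzweil_Integration.integral_combine[of t0 r t "\<lambda>s. F s (y s)"]
      assms(2,3) set_borel_integral_eq_integral(1)[OF int] by simp
  then show "y t - y r = (LINT s:{r..t}|lborel. F s (y s))"
    using assms ode_solution_henstock(2)[OF sol] set_borel_integral_eq_integral(2)[OF i] by simp
qed

lemma ode_solution_restart:
  assumes "ode_solution F t0 y0 y" and "t0 \<le> r"
  shows "ode_solution F r (y r) y"
  unfolding ode_solution_def
proof (intro allI impI conjI)
  fix t assume "r \<le> t"
  note inc = ode_solution_increment[OF assms this]
  show "set_integrable lborel {r..t} (\<lambda>s. F s (y s))" by (rule inc(1))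
  show "y t = y r + (LINT s:{r..t}|lborel. F s (y s))"
    unfolding inc(2)[symmetric] by simp
qed

lemma ode_solution_diff:
  assumes "ode_solution (\<lambda>t v. B t *v v) t0 y0 y" "ode_solution (\<lambda>t v. B t *v v) t0 z0 z"
  shows "ode_solution (\<lambda>t v. (B t :: real^'n^'n) *v v) t0 (y0 - z0) (\<lambda>t. y t - z t)"
  unfolding ode_solution_def
proof (intro allI impI conjI)
  fix t assume "t0 \<le> t"
  then have y: "set_integrable lborel {t0..t} (\<lambda>s. B s *v y s)"
      "y t = y0 + (LINT s:{t0..t}|lborel. B s *v y s)"
    and z: "set_integrable lborel {t0..t} (\<lambda>s. B s *v z s)"
      "z t = z0 + (LINT s:{t0..t}|lborel. B s *v z s)"
    using assms unfolding ode_solution_def by blast+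
  show "set_integrable lborel {t0..t} (\<lambda>s. B s *v (y s - z s))"
    using set_integral_diff(1)[OF y(1) z(1)] by (simp add: matrix_vector_mult_diff_distrib)
  show "y t - z t = y0 - z0 + (LINT s:{t0..t}|lborel. B s *v (y s - z s))"
    using set_integral_diff(2)[OF y(1) z(1)] y(2) z(2)
    by (simp add: matrix_vector_mult_diff_distrib)
qed

lemma ode_solution_increment_norm_le:
  fixes B :: "real \<Rightarrow> real^'n^'n"
  assumes sol: "ode_solution (\<lambda>t v. B t *v v) t0 y0 y" and "t0 \<le> r" "r \<le> t"
    and bound: "\<And>s v. t0 \<le> s \<Longrightarrow> norm (B s *v v) \<le> a * norm v"
  shows "norm (y t - y r) \<le> a * integral {r..t} (\<lambda>s. norm (y s))"
proof -
  note inc = ode_solution_increment[OF sol assms(2,3)]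
  have cont: "continuous_on {r..t} (\<lambda>s. norm (y s))"
    using ode_solution_continuous[OF sol, of t]
    by (intro continuous_intros) (rule continuous_on_subset, use assms in auto)
  have "norm (integral {r..t} (\<lambda>s. B s *v y s)) \<le> integral {r..t} (\<lambda>s. a * norm (y s))"
    using set_borel_integral_eq_integral(1)[OF inc(1)] bound assms(2) cont
    by (intro integral_norm_bound_integral) (auto intro!: integrable_continuous_interval continuous_intros)
  then show ?thesis
    using set_borel_integral_eq_integral(2)[OF inc(1)] inc(2) by simp
qed

text \<open>Both bounds are Gronwall's inequality: forward from \<open>r\<close>, and backward from
  \<open>t\<close> along the reversed solution. The backward one says that a solution cannot decay
  faster than at rate \<open>a\<close>, so moments inside a cycle control those at its
  beginning.\<close>

lemma ode_solution_norm_le: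
  fixes B :: "real \<Rightarrow> real^'n^'n"
  assumes sol: "ode_solution (\<lambda>t v. B t *v v) t0 y0 y" and "t0 \<le> r" "r \<le> t" and a: "0 \<le> a"
    and bound: "\<And>s v. t0 \<le> s \<Longrightarrow> norm (B s *v v) \<le> a * norm v"
  shows "norm (y t) \<le> norm (y r) * exp (a * (t - r))"
    and "norm (y r) \<le> norm (y t) * exp (a * (t - r))"
proof -
  have cont: "continuous_on {r..t} y"
    using ode_solution_continuous[OF sol, of t] by (rule continuous_on_subset) (auto simp: assms)
  have le: "norm (y s') \<le> norm (y s) + a * integral {s..s'} (\<lambda>s. norm (y s)) \<and>
      norm (y s) \<le> norm (y s') + a * integral {s..s'} (\<lambda>s. norm (y s))"
    if "r \<le> s" "s \<le> s'" for s s'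
    using ode_solution_increment_norm_le[OF sol _ that(2) bound] that(1) assms(2)
      norm_triangle_ineq2[of "y s'" "y s"] norm_triangle_ineq2[of "y s" "y s'"]
    by (auto simp: norm_minus_commute)
  have "norm (y (r + (t - r))) \<le> norm (y r) * exp (a * (t - r))"
  proof (rule gronwall[where u="\<lambda>s. norm (y (r + s))" and T="t - r"])
    show "continuous_on {0..t - r} (\<lambda>s. norm (y (r + s)))"
      by (intro continuous_intros continuous_on_compose2[OF cont]) auto
    show "norm (y (r + s)) \<le> norm (y r) + a * integral {0..s} (\<lambda>s. norm (y (r + s)))"
      if "s \<in> {0..t - r}" for s
    proof -
      have "continuous_on {0 + r..s + r} (\<lambda>s. norm (y s))"
        by (intro continuous_on_norm continuous_on_subset[OF cont]) (use that in auto)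
      from integral_shift[OF this] show ?thesis
        using le[of r "r + s"] that by (simp add: add.commute comp_def)
    qed
  qed (use assms in auto)
  then show "norm (y t) \<le> norm (y r) * exp (a * (t - r))" by simp
  have "norm (y (t - (t - r))) \<le> norm (y t) * exp (a * (t - r))"
  proof (rule gronwall[where u="\<lambda>s. norm (y (t - s))" and T="t - r"])
    show "continuous_on {0..t - r} (\<lambda>s. norm (y (t - s)))"
      by (intro continuous_intros continuous_on_compose2[OF cont]) auto
    show "norm (y (t - s)) \<le> norm (y t) + a * integral {0..s} (\<lambda>s. norm (y (t - s)))"
      if "s \<in> {0..t - r}" for s
    proof -
      have "integral {t - s..t} (\<lambda>s. norm (y s)) = integral {0..s} (\<lambda>s. norm (y (t - s)))"
      proof -
        have "continuous_on {0 + - t..s + - t} (\<lambda>v. norm (y (- v)))"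
          by (intro continuous_intros continuous_on_compose2[OF cont]) (use that in auto)
        from integral_shift[OF this] show ?thesis
          using Henstock_Kurzweil_Integration.integral_reflect_real[where a="t - s" and b=t and f="\<lambda>s. norm (y s)"]
          by (simp add: comp_def)
      qed
      then show ?thesis using le[of "t - s" t] that by simp
    qed
  qed (use assms in auto)
  then show "norm (y r) \<le> norm (y t) * exp (a * (t - r))" by simp
qed

lemma ode_solution_unique:
  fixes B :: "real \<Rightarrow> real^'n^'n"
  assumes "ode_solution (\<lambda>t v. B t *v v) t0 y0 y" "ode_solution (\<lambda>t v. B t *v v) t0 y0 z"
    and "0 \<le> a" "\<And>s v. t0 \<le> s \<Longrightarrow> norm (B s *v v) \<le> a * norm v" and "t0 \<le> t"
  shows "y t = z t"
proof -
  have "norm (y t - z t) \<le> norm (y t0 - z t0) * exp (a * (t - t0))"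
    by (rule ode_solution_norm_le(1)[OF ode_solution_diff[OF assms(1,2)] order.refl assms(5,3,4)])
  then show ?thesis
    by (simp add: ode_solution_initial[OF assms(1)] ode_solution_initial[OF assms(2)])
qed

section \<open>Measurability of vector- and matrix-valued functions\<close>

lemma measurable_joint:
  assumes "(\<lambda>(s, \<omega>). F s \<omega>) \<in> measurable (borel \<Otimes>\<^sub>M M) K"
    and "g \<in> measurable L borel" "h \<in> measurable L M"
  shows "(\<lambda>x. F (g x) (h x)) \<in> measurable L K"
  using measurable_compose[OF measurable_Pair[OF assms(2,3)] assms(1)] by simp

lemma borel_measurable_vec_nth [measurable (raw)]:
  fixes f :: "'a \<Rightarrow> ('b::{second_countable_topology, real_normed_vector})^'n"
  assumes "f \<in> borel_measurable M"
  shows "(\<lambda>x. f x $ i) \<in> borel_measurable M"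
  by (rule borel_measurable_continuous_on[OF _ assms]) (intro continuous_intros)

lemma borel_measurable_vecI:
  fixes f :: "'a \<Rightarrow> ('b::euclidean_space)^'n"
  assumes "\<And>i. (\<lambda>x. f x $ i) \<in> borel_measurable M"
  shows "f \<in> borel_measurable M"
  unfolding borel_measurable_euclidean_space[of f]
proof
  fix b :: "'b^'n" assume "b \<in> Basis"
  then obtain i u where "b = axis i u" by (auto simp: Basis_vec_def)
  then show "(\<lambda>x. f x \<bullet> b) \<in> borel_measurable M"
    using assms[of i] by (simp add: inner_axis)
qed

lemma borel_measurable_matrix_vector_mult [measurable (raw)]:
  fixes f :: "'a \<Rightarrow> real^'n^'k" and g :: "'a \<Rightarrow> real^'n"
  assumes [measurable]: "f \<in> borel_measurable M" "g \<in> borel_measurable M"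
  shows "(\<lambda>x. f x *v g x) \<in> borel_measurable M"
  by (rule borel_measurable_vecI) (simp add: matrix_vector_mult_def)

lemma norm_matrix_vector_mult_le:
  fixes A :: "real^'n^'k"
  shows "norm (A *v v) \<le> real CARD('k) * norm A * norm v"
proof -
  have "norm (A *v v) \<le> (\<Sum>i\<in>UNIV. \<bar>(A *v v) $ i\<bar>)"
    by (rule norm_le_l1_cart)
  also have "\<dots> \<le> (\<Sum>i\<in>(UNIV :: 'k set). norm A * norm v)"
  proof (rule sum_mono)
    fix i
    have "\<bar>(A *v v) $ i\<bar> \<le> norm (A $ i) * norm v"
      unfolding matrix_mult_dot vec_lambda_beta by (rule Cauchy_Schwarz_ineq2)
    also have "\<dots> \<le> norm A * norm v"
      by (intro mult_right_mono Finite_Cartesian_Product.norm_nth_le) auto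
    finally show "\<bar>(A *v v) $ i\<bar> \<le> norm A * norm v" .
  qed
  finally show ?thesis by simp
qed

text \<open>Zero coefficients from time \<open>R\<close> on freeze the solution. When
  \<open>Z\<close> and \<open>R\<close> depend on the sample point, this turns the state at the
  random time \<open>Z + R\<close> into the state after any fixed elapsed time \<open>s\<close> with
  \<open>R \<le> s\<close>.\<close>

lemma ode_solution_shift_kill:
  fixes A :: "real \<Rightarrow> real^'n^'n"
  assumes sol: "ode_solution (\<lambda>t v. A t *v v) Z y0 y" and R: "0 \<le> R"
  shows "ode_solution (\<lambda>s v. (if 0 \<le> s \<and> s < R then A (s + Z) else 0) *v v) 0 y0
           (\<lambda>s. y (Z + min s R))"
  unfolding ode_solution_def
proof (intro allI impI)
  fix s :: real assume s: "0 \<le> s"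
  define g where "g v = indicator {Z..Z + min s R} v *\<^sub>R (A v *v y v)" for v
  have g: "integrable lborel g" and y: "y (Z + min s R) = y0 + integral\<^sup>L lborel g"
    using sol s R unfolding ode_solution_def g_def set_lebesgue_integral_def set_integrable_def
    by simp_all
  have g': "integrable lborel (\<lambda>u. g (Z + 1 * u))"
    by (rule lborel_integrable_real_affine[OF g]) simp
  define f where "f u = indicator {0..s} u *\<^sub>R
    ((if 0 \<le> u \<and> u < R then A (u + Z) else 0) *v y (Z + min u R))" for u
  \<comment> \<open>The two integrands can differ only at \<open>u = R\<close>: the shifted one
    includes the right end point of its interval, while the killed coefficient already vanishes
    there. One point is a null set.\<close>
  have f_eq: "f = (\<lambda>u. if u = R then f R else g (Z + 1 * u))"
    unfolding f_def g_def using s R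
    by (auto simp: fun_eq_iff indicator_def min_def add.commute split: if_split)
  have ae: "AE u in lborel. g (Z + 1 * u) = f u"
    using AE_lborel_singleton[of R] by eventually_elim (subst f_eq, simp)
  have [measurable]: "(\<lambda>u. g (Z + 1 * u)) \<in> borel_measurable lborel"
    using g' by (rule borel_measurable_integrable)
  have [measurable]: "f \<in> borel_measurable lborel"
    by (subst f_eq) measurable
  have "integrable lborel f"
    using integrable_cong_AE_imp[OF g' _ ae] by simp
  moreover have "integral\<^sup>L lborel f = integral\<^sup>L lborel g"
    using integral_cong_AE[OF _ _ ae] lborel_integral_real_affine[of 1 g Z]
      borel_measurable_integrable[OF g'] by simp
  ultimately show "set_integrable lborel {0..s}
        (\<lambda>s. (if 0 \<le> s \<and> s < R then A (s + Z) else 0) *v y (Z + min s R)) \<and>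
      y (Z + min s R) = y0 + (LINT s:{0..s}|lborel.
        (if 0 \<le> s \<and> s < R then A (s + Z) else 0) *v y (Z + min s R))"
    unfolding set_integrable_def set_lebesgue_integral_def f_def[symmetric] y by simp
qed

subsection \<open>Picard iteration\<close>

text \<open>Each iterate is an explicit integral of the previous one, so joint measurability and the
  representation by cycles pass through the iteration and then to its limit.\<close>

primrec picard :: "(real \<Rightarrow> real^'n^'n) \<Rightarrow> real^'n \<Rightarrow> nat \<Rightarrow> real \<Rightarrow> real^'n" where
  "picard B y0 0 = (\<lambda>t. y0)"
| "picard B y0 (Suc j) = (\<lambda>t. y0 + (LINT s:{0..t}|lborel. B s *v picard B y0 j s))"

lemma picard_joint_measurable:
  fixes B :: "real \<Rightarrow> 'w \<Rightarrow> real^'n^'n"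
  assumes B: "(\<lambda>(s, \<omega>). B s \<omega>) \<in> borel_measurable (borel \<Otimes>\<^sub>M M)"
  shows "(\<lambda>(s, \<omega>). picard (\<lambda>s. B s \<omega>) y0 j s) \<in> borel_measurable (borel \<Otimes>\<^sub>M M)"
proof (induction j)
  case (Suc j)
  have [measurable]:
    "(\<lambda>x. B (snd x) (snd (fst x))) \<in> borel_measurable ((borel \<Otimes>\<^sub>M M) \<Otimes>\<^sub>M lborel)"
    "(\<lambda>x. picard (\<lambda>s. B s (snd (fst x))) y0 j (snd x))
      \<in> borel_measurable ((borel \<Otimes>\<^sub>M M) \<Otimes>\<^sub>M lborel)"
    by (rule measurable_joint[OF B] measurable_joint[OF Suc.IH]; simp)+
  show ?case
    unfolding set_lebesgue_integral_def picard.simps indicator_def atLeastAtMost_iff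
    by measurable
qed simp

text \<open>The exponential weight reproduces itself under integration. Rate \<open>k = a\<close>
  gives the a priori bound of the iterates; rate \<open>k = 2 * a\<close> gains a factor
  \<open>1/2\<close> per iteration.\<close>

lemma norm_set_integral_exp_le:
  fixes f :: "real \<Rightarrow> 'a::euclidean_space"
  assumes f: "set_integrable lborel {0..t} f" and t: "0 \<le> t"
    and le: "\<And>s. s \<in> {0..t} \<Longrightarrow> norm (f s) \<le> c * k * exp (k * s)"
  shows "norm (LINT s:{0..t}|lborel. f s) \<le> c * exp (k * t) - c"
proof -
  have e: "((\<lambda>s. c * k * exp (k * s)) has_integral (c * exp (k * t) - c * exp (k * 0))) {0..t}"
    by (rule fundamental_theorem_of_calculus[OF t])
      (auto intro!: derivative_eq_intros simp: has_real_derivative_iff_has_vector_derivative[symmetric])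
  have "norm (integral {0..t} f) \<le> integral {0..t} (\<lambda>s. c * k * exp (k * s))"
    using set_borel_integral_eq_integral(1)[OF f] has_integral_integrable[OF e] le
    by (rule integral_norm_bound_integral)
  then show ?thesis
    using integral_unique[OF e] set_borel_integral_eq_integral(2)[OF f] by simp
qed

context
  fixes B :: "real \<Rightarrow> real^'n^'n" and a :: real
  assumes B [measurable]: "B \<in> borel_measurable borel"
    and a: "0 \<le> a" and bound: "\<And>s v. norm (B s *v v) \<le> a * norm v"
begin

lemma picard_measurable [measurable]: "picard B y0 j \<in> borel_measurable borel"
proof -
  have "(\<lambda>(s, \<omega>::unit). picard (\<lambda>s. B s) y0 j s) \<in> borel_measurable (borel \<Otimes>\<^sub>M count_space UNIV)"
    by (rule picard_joint_measurable) measurable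
  from measurable_joint[OF this measurable_ident_sets[OF refl], of "\<lambda>_. ()"] show ?thesis
    by simp
qed

lemma picard_norm_le:
  assumes "0 \<le> t"
  shows "norm (picard B y0 j t) \<le> norm y0 * exp (a * t)"
    and "set_integrable lborel {0..t} (\<lambda>s. B s *v picard B y0 j s)"
proof -
  \<comment> \<open>The growth bound is an assumption here, because the induction that proves it
    needs this integrability for the previous iterate.\<close>
  have int: "set_integrable lborel {0..t} (\<lambda>s. B s *v picard B y0 j s)"
    if "\<And>t. 0 \<le> t \<Longrightarrow> norm (picard B y0 j t) \<le> norm y0 * exp (a * t)" for j t
    unfolding set_integrable_def
  proof (rule integrableI_bounded_set_indicator[where B="a * (norm y0 * exp (a * t))"])
    show "AE s in lborel. s \<in> {0..t} \<longrightarrow>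
        norm (B s *v picard B y0 j s) \<le> a * (norm y0 * exp (a * t))"
    proof (intro AE_I2 impI)
      fix s assume s: "s \<in> {0..t}"
      have "norm (B s *v picard B y0 j s) \<le> a * norm (picard B y0 j s)" by (rule bound)
      also have "\<dots> \<le> a * (norm y0 * exp (a * s))"
        using s a by (intro mult_left_mono that) auto
      also have "\<dots> \<le> a * (norm y0 * exp (a * t))"
        using s a by (intro mult_left_mono) (auto intro: mult_left_mono)
      finally show "norm (B s *v picard B y0 j s) \<le> a * (norm y0 * exp (a * t))" .
    qed
  qed (auto simp: emeasure_lborel_Icc_eq)
  have le: "norm (picard B y0 j t) \<le> norm y0 * exp (a * t)" if "0 \<le> t" for t j
    using that
  proof (induction j arbitrary: t)
    case (Suc j)
    have "norm (LINT s:{0..t}|lborel. B s *v picard B y0 j s) \<le> norm y0 * exp (a * t) - norm y0"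
    proof (rule norm_set_integral_exp_le[OF int Suc.prems])
      fix s assume "s \<in> {0..t}"
      then show "norm (B s *v picard B y0 j s) \<le> norm y0 * a * exp (a * s)"
        using order_trans[OF bound[of s "picard B y0 j s"] mult_left_mono[OF Suc.IH[of s] a]]
        by (simp add: algebra_simps)
    qed (rule Suc.IH)
    then show ?case
      using norm_triangle_ineq[of y0 "LINT s:{0..t}|lborel. B s *v picard B y0 j s"] by simp
  qed (use a in \<open>auto intro!: mult_le_cancel_left1[THEN iffD2]\<close>)
  show "norm (picard B y0 j t) \<le> norm y0 * exp (a * t)" by (rule le[OF assms])
  show "set_integrable lborel {0..t} (\<lambda>s. B s *v picard B y0 j s)" by (rule int[OF le])
qed

text \<open>In the supremum norm weighted by \<open>exp (- 2 * a * t)\<close> the Picard map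
  contracts by \<open>1/2\<close> on intervals of any length, so there is no need to work with short
  time steps.\<close>

lemma picard_error:
  assumes sol: "ode_solution (\<lambda>t v. B t *v v) 0 y0 y"
    and D: "\<And>s. s \<in> {0..T} \<Longrightarrow> norm (y s - y0) \<le> D" and t: "t \<in> {0..T}"
  shows "norm (y t - picard B y0 j t) \<le> D * (1/2) ^ j * exp (2 * a * t)"
  using t
proof (induction j arbitrary: t)
  case 0
  have "0 \<le> D" using norm_ge_zero D[OF 0] by (rule order_trans)
  then have "D * 1 \<le> D * exp (2 * a * t)" using 0 a by (intro mult_left_mono) auto
  then show ?case using D[OF 0] by simp
next
  case (Suc j)
  have t: "0 \<le> t" using Suc.prems by simp
  have "0 \<le> D" using norm_ge_zero D[OF Suc.prems] by (rule order_trans)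
  have y: "set_integrable lborel {0..t} (\<lambda>s. B s *v y s)"
      "y t = y0 + (LINT s:{0..t}|lborel. B s *v y s)"
    using sol t unfolding ode_solution_def by blast+
  note p = picard_norm_le(2)[OF t, of y0 j]
  have int: "set_integrable lborel {0..t} (\<lambda>s. B s *v (y s - picard B y0 j s))"
    using set_integral_diff(1)[OF y(1) p] by (simp add: matrix_vector_mult_diff_distrib)
  have "y t - picard B y0 (Suc j) t =
      (LINT s:{0..t}|lborel. B s *v (y s - picard B y0 j s))"
    using set_integral_diff(2)[OF y(1) p] y(2) by (simp add: matrix_vector_mult_diff_distrib)
  also have "norm \<dots> \<le> D * (1/2) ^ Suc j * exp (2 * a * t) - D * (1/2) ^ Suc j"
  proof (rule norm_set_integral_exp_le[OF int t])
    fix s assume "s \<in> {0..t}"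
    with Suc.prems have "s \<in> {0..T}" by simp
    from order_trans[OF bound mult_left_mono[OF Suc.IH[OF this] a]]
    show "norm (B s *v (y s - picard B y0 j s)) \<le> D * (1/2) ^ Suc j * (2 * a) * exp (2 * a * s)"
      by (simp add: algebra_simps)
  qed
  also have "\<dots> \<le> D * (1/2) ^ Suc j * exp (2 * a * t)" using \<open>0 \<le> D\<close> by simp
  finally show ?case .
qed

lemma picard_tendsto:
  assumes sol: "ode_solution (\<lambda>t v. B t *v v) 0 y0 y" and "0 \<le> t"
  shows "(\<lambda>j. picard B y0 j t) \<longlonglongrightarrow> y t"
proof -
  have "bounded ((\<lambda>s. y s - y0) ` {0..t})"
    by (intro compact_imp_bounded compact_continuous_image continuous_intros
        ode_solution_continuous[OF sol]) simp
  then obtain D where D: "\<And>s. s \<in> {0..t} \<Longrightarrow> norm (y s - y0) \<le> D"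
    unfolding bounded_iff by blast
  have "(\<lambda>j. y t - picard B y0 j t) \<longlonglongrightarrow> 0"
  proof (rule Lim_null_comparison)
    show "\<forall>\<^sub>F j in sequentially. norm (y t - picard B y0 j t) \<le> D * (1/2) ^ j * exp (2 * a * t)"
      using picard_error[OF sol D, of t t] \<open>0 \<le> t\<close> by (intro always_eventually allI) simp
    show "(\<lambda>j. D * (1/2) ^ j * exp (2 * a * t)) \<longlonglongrightarrow> 0"
      by (intro tendsto_mult_left_zero tendsto_mult_right_zero LIMSEQ_power_zero) simp
  qed
  from tendsto_diff[OF tendsto_const this, of "y t"] show ?thesis by simp
qed

end

section \<open>Functionals of identically distributed random elements\<close>

locale identically_distributed = prob_space M for M :: "'w measure" +
  fixes K :: "'b measure" and c :: "nat \<Rightarrow> 'w \<Rightarrow> 'b"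
  assumes c_measurable [measurable]: "\<And>k. c k \<in> measurable M K"
    and c_distr: "\<And>k. distr M K (c k) = distr M K (c 0)"
begin

text \<open>One \<open>g\<close> serves all indices, so the equality of the laws of the
  \<open>c k\<close> passes on to the \<open>X k\<close>. The representation is almost sure, hence
  measurability of \<open>X k\<close> is demanded separately: a function that agrees almost surely
  with a measurable one need not be measurable.\<close>

definition factors :: "(nat \<Rightarrow> 'w \<Rightarrow> 'a::topological_space) \<Rightarrow> bool" where
  "factors X \<longleftrightarrow> (\<forall>k. X k \<in> borel_measurable M) \<and>
     (\<exists>g\<in>borel_measurable K. \<forall>k. AE \<omega> in M. X k \<omega> = g (c k \<omega>))"

lemma factorsI:
  assumes "\<And>k. X k \<in> borel_measurable M" "g \<in> borel_measurable K"
    and "\<And>k. AE \<omega> in M. X k \<omega> = g (c k \<omega>)"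
  shows "factors X"
  using assms unfolding factors_def by blast

lemma factors_measurable: "factors X \<Longrightarrow> X k \<in> borel_measurable M"
  unfolding factors_def by blast

lemma factorsE:
  assumes "factors X"
  obtains g where "g \<in> borel_measurable K" "\<And>k. AE \<omega> in M. X k \<omega> = g (c k \<omega>)"
  using assms unfolding factors_def by blast

lemma factors_const: "factors (\<lambda>k \<omega>. v)"
  by (rule factorsI[where g="\<lambda>_. v"]) auto

lemma factors_cong:
  assumes "factors X" and "\<And>k \<omega>. \<omega> \<in> space M \<Longrightarrow> X k \<omega> = Y k \<omega>"
  shows "factors Y"
proof -
  from assms(1) obtain g where g: "g \<in> borel_measurable K" "\<And>k. AE \<omega> in M. X k \<omega> = g (c k \<omega>)"
    by (rule factorsE) blast
  show ?thesis
  proof (rule factorsI[OF _ g(1)])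
    show "Y k \<in> borel_measurable M" for k
      using factors_measurable[OF assms(1), of k] by (simp add: assms(2) cong: measurable_cong)
    show "AE \<omega> in M. Y k \<omega> = g (c k \<omega>)" for k
      using g(2)[of k] by (rule AE_mp) (auto simp: assms(2)[symmetric])
  qed
qed

lemma factors_compose:
  assumes "factors X" and f [measurable]: "f \<in> borel_measurable borel"
  shows "factors (\<lambda>k \<omega>. f (X k \<omega>))"
proof -
  from assms(1) obtain g where [measurable]: "g \<in> borel_measurable K"
    and g: "\<And>k. AE \<omega> in M. X k \<omega> = g (c k \<omega>)" by (rule factorsE) blast
  note [measurable] = factors_measurable[OF assms(1)]
  show ?thesis
  proof (rule factorsI)
    show "AE \<omega> in M. f (X k \<omega>) = (\<lambda>y. f (g y)) (c k \<omega>)" for k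
      using g[of k] by eventually_elim simp
  qed measurable
qed

lemma factors_Pair:
  fixes X :: "nat \<Rightarrow> 'w \<Rightarrow> 'u::second_countable_topology"
    and Y :: "nat \<Rightarrow> 'w \<Rightarrow> 'v::second_countable_topology"
  assumes "factors X" "factors Y"
  shows "factors (\<lambda>k \<omega>. (X k \<omega>, Y k \<omega>))"
proof -
  from assms(1) obtain g where [measurable]: "g \<in> borel_measurable K"
    and g: "\<And>k. AE \<omega> in M. X k \<omega> = g (c k \<omega>)" by (rule factorsE) blast
  from assms(2) obtain h where [measurable]: "h \<in> borel_measurable K"
    and h: "\<And>k. AE \<omega> in M. Y k \<omega> = h (c k \<omega>)" by (rule factorsE) blast
  note [measurable] = factors_measurable[OF assms(1)] factors_measurable[OF assms(2)]
  show ?thesis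
  proof (rule factorsI)
    show "AE \<omega> in M. (X k \<omega>, Y k \<omega>) = (\<lambda>y. (g y, h y)) (c k \<omega>)" for k
      using g[of k] h[of k] by eventually_elim simp
  qed measurable
qed

lemma factors_vecI:
  fixes X :: "nat \<Rightarrow> 'w \<Rightarrow> ('u::euclidean_space)^'n"
  assumes "\<And>i. factors (\<lambda>k \<omega>. X k \<omega> $ i)"
  shows "factors X"
proof -
  have "\<forall>i. \<exists>g. g \<in> borel_measurable K \<and> (\<forall>k. AE \<omega> in M. X k \<omega> $ i = g (c k \<omega>))"
    using assms unfolding factors_def by blast
  then obtain g where g: "\<And>i. g i \<in> borel_measurable K"
      "\<And>i k. AE \<omega> in M. X k \<omega> $ i = g i (c k \<omega>)" by metis
  show ?thesis
  proof (rule factorsI)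
    show "X k \<in> borel_measurable M" for k
      by (rule borel_measurable_vecI) (rule factors_measurable[OF assms])
    show "(\<lambda>y. \<chi> i. g i y) \<in> borel_measurable K"
      by (rule borel_measurable_vecI) (simp add: g)
    have *: "AE \<omega> in M. \<forall>i. X k \<omega> $ i = g i (c k \<omega>)" for k
      using g(2) by (simp add: AE_all_countable)
    show "AE \<omega> in M. X k \<omega> = (\<lambda>y. \<chi> i. g i y) (c k \<omega>)" for k
      using *[of k] by eventually_elim (simp add: Finite_Cartesian_Product.vec_eq_iff)
  qed
qed

lemma factors_lim:
  fixes X :: "nat \<Rightarrow> 'w \<Rightarrow> 'u::{banach, second_countable_topology}"
  assumes "\<And>j. factors (Y j)"
    and lim: "\<And>k \<omega>. \<omega> \<in> space M \<Longrightarrow> (\<lambda>j. Y j k \<omega>) \<longlonglongrightarrow> X k \<omega>"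
  shows "factors X"
proof -
  have "\<forall>j. \<exists>g. g \<in> borel_measurable K \<and> (\<forall>k. AE \<omega> in M. Y j k \<omega> = g (c k \<omega>))"
    using assms(1) unfolding factors_def by blast
  then obtain g where g [measurable]: "\<And>j. g j \<in> borel_measurable K"
      and eq: "\<And>j k. AE \<omega> in M. Y j k \<omega> = g j (c k \<omega>)" by metis
  show ?thesis
  proof (rule factorsI)
    show "X k \<in> borel_measurable M" for k
      using lim factors_measurable[OF assms(1)] by (rule borel_measurable_LIMSEQ_metric[rotated])
    \<comment> \<open>\<open>lim\<close> is measurable even if the sequence diverges somewhere, and
      almost surely \<open>c k\<close> avoids the points of divergence.\<close>
    show "(\<lambda>y. lim (\<lambda>j. g j y)) \<in> borel_measurable K" by measurable
    have "AE \<omega> in M. \<forall>j. Y j k \<omega> = g j (c k \<omega>)" for k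
      using eq by (simp add: AE_all_countable)
    then show "AE \<omega> in M. X k \<omega> = (\<lambda>y. lim (\<lambda>j. g j y)) (c k \<omega>)" for k
    proof (rule AE_mp, intro AE_I2 impI)
      fix \<omega> assume "\<omega> \<in> space M" "\<forall>j. Y j k \<omega> = g j (c k \<omega>)"
      then show "X k \<omega> = lim (\<lambda>j. g j (c k \<omega>))"
        using limI[OF lim[of \<omega> k]] by simp
    qed
  qed
qed

text \<open>\<open>g\<close> is the conditional expectation of \<open>U\<close> given
  \<open>c k\<close>, as a function of the value of \<open>c k\<close>: the density, with respect to
  the law of \<open>c k\<close>, of the image under \<open>c k\<close> of the measure with density
  \<open>U\<close>.\<close>

lemma ex_conditional_density:
  fixes U :: "'w \<Rightarrow> ennreal"
  assumes U [measurable]: "U \<in> borel_measurable M"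
  obtains g where "g \<in> borel_measurable K"
    "\<And>h. h \<in> borel_measurable K \<Longrightarrow>
       (\<integral>\<^sup>+\<omega>. U \<omega> * h (c k \<omega>) \<partial>M) = (\<integral>\<^sup>+\<omega>. g (c k \<omega>) * h (c k \<omega>) \<partial>M)"
proof -
  let ?Q = "distr M K (c k)" and ?N = "distr (density M U) K (c k)"
  interpret Q: prob_space ?Q by (rule prob_space_distr) simp
  have [measurable]: "c k \<in> measurable (density M U) K" by simp
  have "absolutely_continuous ?Q ?N"
    unfolding absolutely_continuous_def
  proof
    fix S assume S: "S \<in> null_sets ?Q"
    then have [measurable]: "S \<in> sets K" by auto
    have "AE \<omega> in M. c k \<omega> \<notin> S"
      using S AE_distr_iff[of "c k" M K "\<lambda>y. y \<notin> S"] AE_not_in[OF S] by simp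
    then have "(\<integral>\<^sup>+\<omega>. U \<omega> * indicator (c k -` S \<inter> space M) \<omega> \<partial>M) = (\<integral>\<^sup>+\<omega>. 0 \<partial>M)"
      by (intro nn_integral_cong_AE) (auto elim!: AE_mp)
    then show "S \<in> null_sets ?N"
      by (simp add: null_sets_def emeasure_distr emeasure_density)
  qed
  from Q.Radon_Nikodym[OF this] obtain g where g [measurable]: "g \<in> borel_measurable K"
    and eq: "density ?Q g = ?N" by auto
  show ?thesis
  proof (rule that[OF g])
    fix h :: "'b \<Rightarrow> ennreal" assume [measurable]: "h \<in> borel_measurable K"
    have "(\<integral>\<^sup>+\<omega>. U \<omega> * h (c k \<omega>) \<partial>M) = (\<integral>\<^sup>+y. h y \<partial>?N)"
      by (simp add: nn_integral_distr nn_integral_density)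
    also have "\<dots> = (\<integral>\<^sup>+\<omega>. g (c k \<omega>) * h (c k \<omega>) \<partial>M)"
      by (simp add: eq[symmetric] nn_integral_distr nn_integral_density)
    finally show "(\<integral>\<^sup>+\<omega>. U \<omega> * h (c k \<omega>) \<partial>M) = (\<integral>\<^sup>+\<omega>. g (c k \<omega>) * h (c k \<omega>) \<partial>M)" .
  qed
qed

text \<open>
  The integral of a measurable process need not be a measurable functional of the path. The
  function \<open>g\<close> is a Radon--Nikodym density instead, and \<open>E[1_F Y] = E[1_F g(c)]\<close> is checked
  for every event \<open>F\<close> by Fubini, after replacing \<open>1_F\<close> by its own density.
\<close>

lemma factors_nn_integral:
  fixes X :: "nat \<Rightarrow> real \<Rightarrow> 'w \<Rightarrow> ennreal"
  assumes X: "\<And>k. (\<lambda>(s, \<omega>). X k s \<omega>) \<in> borel_measurable (borel \<Otimes>\<^sub>M M)"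
    and fac: "\<And>s. factors (\<lambda>k. X k s)"
  shows "factors (\<lambda>k \<omega>. \<integral>\<^sup>+s. X k s \<omega> \<partial>lborel)"
proof -
  define Y where "Y k \<omega> = (\<integral>\<^sup>+s. X k s \<omega> \<partial>lborel)" for k \<omega>
  have [measurable]: "(\<lambda>(s, \<omega>). X k s \<omega>) \<in> borel_measurable (lborel \<Otimes>\<^sub>M M)" for k
    using X[of k] by (simp cong: measurable_cong_sets sets_pair_measure_cong)
  have [measurable]: "(\<lambda>(\<omega>, s). X k s \<omega>) \<in> borel_measurable (M \<Otimes>\<^sub>M lborel)" for k
    by measurable
  interpret P: pair_sigma_finite M lborel
    by (intro pair_sigma_finite.intro sigma_finite_measure_axioms sigma_finite_lborel)
  have Y [measurable]: "Y k \<in> borel_measurable M" for k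
    unfolding Y_def by measurable
  have "\<forall>s. \<exists>g. g \<in> borel_measurable K \<and> (\<forall>k. AE \<omega> in M. X k s \<omega> = g (c k \<omega>))"
    using fac unfolding factors_def by blast
  then obtain g where [measurable]: "\<And>s. g s \<in> borel_measurable K"
    and g: "\<And>k s. AE \<omega> in M. X k s \<omega> = g s (c k \<omega>)" by metis
  \<comment> \<open>The exceptional null set of the representation depends on the time
    \<open>s\<close>. With the time integral outermost, \<open>s\<close> is fixed when the integrand
    is exchanged for a function of the cycle.\<close>
  have fubini: "(\<integral>\<^sup>+\<omega>. Y k \<omega> * U \<omega> \<partial>M) = (\<integral>\<^sup>+s. \<integral>\<^sup>+\<omega>. g s (c k \<omega>) * U \<omega> \<partial>M \<partial>lborel)"
    if [measurable]: "U \<in> borel_measurable M" for k U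
  proof -
    have "(\<integral>\<^sup>+\<omega>. Y k \<omega> * U \<omega> \<partial>M) = (\<integral>\<^sup>+\<omega>. \<integral>\<^sup>+s. X k s \<omega> * U \<omega> \<partial>lborel \<partial>M)"
      unfolding Y_def by (intro nn_integral_cong nn_integral_multc[symmetric]) measurable
    also have "\<dots> = (\<integral>\<^sup>+s. \<integral>\<^sup>+\<omega>. X k s \<omega> * U \<omega> \<partial>M \<partial>lborel)"
      by (rule P.Fubini'[symmetric]) measurable
    also have "\<dots> = (\<integral>\<^sup>+s. \<integral>\<^sup>+\<omega>. g s (c k \<omega>) * U \<omega> \<partial>M \<partial>lborel)"
    proof (rule nn_integral_cong)
      fix s
      show "(\<integral>\<^sup>+\<omega>. X k s \<omega> * U \<omega> \<partial>M) = (\<integral>\<^sup>+\<omega>. g s (c k \<omega>) * U \<omega> \<partial>M)"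
        using g[of k s] by (intro nn_integral_cong_AE) (auto elim!: AE_mp)
    qed
    finally show ?thesis .
  qed
  have law: "(\<integral>\<^sup>+\<omega>. h (c k \<omega>) \<partial>M) = (\<integral>\<^sup>+\<omega>. h (c 0 \<omega>) \<partial>M)"
    if [measurable]: "h \<in> borel_measurable K" for k and h :: "'b \<Rightarrow> ennreal"
    using arg_cong[OF c_distr[of k], of "\<lambda>N. \<integral>\<^sup>+y. h y \<partial>N"] by (simp add: nn_integral_distr)
  obtain G where [measurable]: "G \<in> borel_measurable K"
    and G0: "\<And>h. h \<in> borel_measurable K \<Longrightarrow>
      (\<integral>\<^sup>+\<omega>. Y 0 \<omega> * h (c 0 \<omega>) \<partial>M) = (\<integral>\<^sup>+\<omega>. G (c 0 \<omega>) * h (c 0 \<omega>) \<partial>M)"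
    by (rule ex_conditional_density[OF Y[of 0], of 0]) blast
  \<comment> \<open>Tested against functions of the cycle, both sides are determined by the law of
    \<open>c k\<close>; so the density found at index 0 serves every index.\<close>
  have G: "(\<integral>\<^sup>+\<omega>. Y k \<omega> * h (c k \<omega>) \<partial>M) = (\<integral>\<^sup>+\<omega>. G (c k \<omega>) * h (c k \<omega>) \<partial>M)"
    if [measurable]: "h \<in> borel_measurable K" for k h
  proof -
    have "(\<integral>\<^sup>+\<omega>. Y k \<omega> * h (c k \<omega>) \<partial>M) = (\<integral>\<^sup>+s. \<integral>\<^sup>+\<omega>. g s (c k \<omega>) * h (c k \<omega>) \<partial>M \<partial>lborel)"
      by (rule fubini) simp
    also have "\<dots> = (\<integral>\<^sup>+s. \<integral>\<^sup>+\<omega>. g s (c 0 \<omega>) * h (c 0 \<omega>) \<partial>M \<partial>lborel)"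
      by (intro nn_integral_cong law[of "\<lambda>y. g _ y * h y"]) simp
    also have "\<dots> = (\<integral>\<^sup>+\<omega>. Y 0 \<omega> * h (c 0 \<omega>) \<partial>M)"
      by (rule fubini[symmetric]) simp
    also have "\<dots> = (\<integral>\<^sup>+\<omega>. G (c k \<omega>) * h (c k \<omega>) \<partial>M)"
      using G0[OF that] law[of "\<lambda>y. G y * h y" k] by simp
    finally show ?thesis .
  qed
  have "density M (Y k) = density M (\<lambda>\<omega>. G (c k \<omega>))" for k
  proof (rule measure_eqI)
    fix F assume "F \<in> sets (density M (Y k))"
    then have [measurable]: "F \<in> sets M" by simp
    obtain f where [measurable]: "f \<in> borel_measurable K"
      and f: "\<And>h. h \<in> borel_measurable K \<Longrightarrow>
        (\<integral>\<^sup>+\<omega>. indicator F \<omega> * h (c k \<omega>) \<partial>M) = (\<integral>\<^sup>+\<omega>. f (c k \<omega>) * h (c k \<omega>) \<partial>M)"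
      by (rule ex_conditional_density[of "indicator F" k]) (simp, blast)
    have "(\<integral>\<^sup>+\<omega>. Y k \<omega> * indicator F \<omega> \<partial>M)
        = (\<integral>\<^sup>+s. \<integral>\<^sup>+\<omega>. g s (c k \<omega>) * indicator F \<omega> \<partial>M \<partial>lborel)"
      by (rule fubini) simp
    also have "\<dots> = (\<integral>\<^sup>+s. \<integral>\<^sup>+\<omega>. g s (c k \<omega>) * f (c k \<omega>) \<partial>M \<partial>lborel)"
    proof (rule nn_integral_cong)
      fix s
      show "(\<integral>\<^sup>+\<omega>. g s (c k \<omega>) * indicator F \<omega> \<partial>M) = (\<integral>\<^sup>+\<omega>. g s (c k \<omega>) * f (c k \<omega>) \<partial>M)"
        using f[of "g s"] by (simp add: mult.commute)
    qed
    also have "\<dots> = (\<integral>\<^sup>+\<omega>. Y k \<omega> * f (c k \<omega>) \<partial>M)"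
      by (rule fubini[symmetric]) simp
    also have "\<dots> = (\<integral>\<^sup>+\<omega>. G (c k \<omega>) * indicator F \<omega> \<partial>M)"
      using G f by (simp add: mult.commute)
    finally show "emeasure (density M (Y k)) F = emeasure (density M (\<lambda>\<omega>. G (c k \<omega>))) F"
      by (simp add: emeasure_density)
  qed simp
  then have "AE \<omega> in M. Y k \<omega> = G (c k \<omega>)" for k
    by (intro density_unique) auto
  then show ?thesis
    unfolding Y_def[symmetric] by (intro factorsI[where g=G]) auto
qed

lemma factors_integral:
  fixes X :: "nat \<Rightarrow> real \<Rightarrow> 'w \<Rightarrow> real"
  assumes X: "\<And>k. (\<lambda>(s, \<omega>). X k s \<omega>) \<in> borel_measurable (borel \<Otimes>\<^sub>M M)"
    and fac: "\<And>s. factors (\<lambda>k. X k s)"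
    and int: "\<And>k \<omega>. \<omega> \<in> space M \<Longrightarrow> integrable lborel (\<lambda>s. X k s \<omega>)"
  shows "factors (\<lambda>k \<omega>. \<integral>s. X k s \<omega> \<partial>lborel)"
proof -
  \<comment> \<open>\<open>ennreal\<close> maps negative reals to 0, so \<open>e = 1\<close> and
    \<open>e = -1\<close> produce the integrals of the positive and of the negative part.\<close>
  have F: "factors (\<lambda>k \<omega>. enn2real (\<integral>\<^sup>+s. ennreal (e * X k s \<omega>) \<partial>lborel))" for e
  proof (intro factors_compose[OF factors_nn_integral])
    show "(\<lambda>(s, \<omega>). ennreal (e * X k s \<omega>)) \<in> borel_measurable (borel \<Otimes>\<^sub>M M)" for k
      using X[of k] by measurable
    show "factors (\<lambda>k \<omega>. ennreal (e * X k s \<omega>))" for s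
      by (rule factors_compose[OF fac]) simp
  qed simp
  have "factors (\<lambda>k \<omega>. (\<lambda>p. fst p - snd p) (enn2real (\<integral>\<^sup>+s. ennreal (1 * X k s \<omega>) \<partial>lborel),
      enn2real (\<integral>\<^sup>+s. ennreal (-1 * X k s \<omega>) \<partial>lborel)))"
    by (rule factors_compose[OF factors_Pair[OF F F]]) (simp add: borel_prod[symmetric])
  then show ?thesis
    by (rule factors_cong) (simp add: real_lebesgue_integral_def int)
qed

lemma factors_set_integral_vec:
  fixes X :: "nat \<Rightarrow> real \<Rightarrow> 'w \<Rightarrow> real^'n"
  assumes X: "\<And>k. (\<lambda>(s, \<omega>). X k s \<omega>) \<in> borel_measurable (borel \<Otimes>\<^sub>M M)"
    and fac: "\<And>s. s \<in> {0..t} \<Longrightarrow> factors (\<lambda>k. X k s)"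
    and int: "\<And>k \<omega>. \<omega> \<in> space M \<Longrightarrow> set_integrable lborel {0..t} (\<lambda>s. X k s \<omega>)"
  shows "factors (\<lambda>k \<omega>. LINT s:{0..t}|lborel. X k s \<omega>)"
proof (rule factors_vecI)
  fix i
  have nth: "integrable lborel (\<lambda>s. indicator {0..t} s * X k s \<omega> $ i)"
      "(LINT s:{0..t}|lborel. X k s \<omega>) $ i = (LINT s|lborel. indicator {0..t} s * X k s \<omega> $ i)"
    if "\<omega> \<in> space M" for k \<omega>
    using integrable_bounded_linear[OF bounded_linear_vec_nth[of i] int[OF that, unfolded set_integrable_def]]
      integral_bounded_linear[OF bounded_linear_vec_nth[of i] int[OF that, unfolded set_integrable_def]]
    by (simp_all add: set_lebesgue_integral_def)
  have "factors (\<lambda>k \<omega>. LINT s|lborel. indicator {0..t} s * X k s \<omega> $ i)"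
  proof (rule factors_integral)
    show "(\<lambda>(s, \<omega>). indicator {0..t} s * X k s \<omega> $ i) \<in> borel_measurable (borel \<Otimes>\<^sub>M M)" for k
      using X[of k] by measurable
    show "factors (\<lambda>k \<omega>. indicator {0..t} s * X k s \<omega> $ i)" for s
    proof (cases "s \<in> {0..t}")
      case True
      then show ?thesis using factors_compose[OF fac, where f="\<lambda>v. v $ i"] by simp
    qed (use factors_const[of "0::real"] in simp)
  qed (rule nth)
  then show "factors (\<lambda>k \<omega>. (LINT s:{0..t}|lborel. X k s \<omega>) $ i)"
    by (rule factors_cong) (simp add: nth)
qed

end

section \<open>The lift and homogeneous polynomials\<close>

text \<open>Lagrange interpolation: a polynomial of degree at most \<open>m\<close> depends linearly
  on its values at \<open>0, ..., m\<close>, and so does its k-th coefficient. The weight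
  \<open>d t\<close> is the k-th coefficient of the Lagrange basis polynomial
  \<open>L t\<close>.\<close>

lemma ex_coefficient_functional:
  fixes m k :: nat
  shows "\<exists>d :: nat \<Rightarrow> real. \<forall>i\<le>m. (\<Sum>t\<le>m. d t * real t ^ i) = (if i = k then 1 else 0)"
proof -
  define L where "L t = (\<Prod>s\<in>{..m} - {t}. Polynomial.smult (1 / (real t - real s)) [:- real s, 1:])" for t
  have deg: "degree (L t) \<le> m" if "t \<le> m" for t
  proof -
    have "degree (L t) \<le> (\<Sum>s\<in>{..m} - {t}. degree (Polynomial.smult (1 / (real t - real s)) [:- real s, 1:]))"
      unfolding L_def by (rule degree_prod_sum_le[unfolded comp_def]) simp
    also have "\<dots> \<le> (\<Sum>s\<in>{..m} - {t}. 1)"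
      by (intro sum_mono order_trans[OF degree_smult_le]) simp
    finally show ?thesis using that by simp
  qed
  have L: "poly (L t) (real s) = (if s = t then 1 else 0)" if "t \<le> m" "s \<le> m" for s t
  proof (cases "s = t")
    case True
    then show ?thesis
      by (auto simp: L_def poly_prod diff_divide_distrib[symmetric] intro!: prod.neutral)
  next
    case False
    then show ?thesis using that unfolding L_def poly_prod
      by (auto intro!: prod_zero bexI[of _ s])
  qed
  have "(\<Sum>t\<le>m. coeff (L t) k * real t ^ i) = (if i = k then 1 else 0)" if i: "i \<le> m" for i
  proof -
    have "(\<Sum>t\<le>m. Polynomial.smult (real t ^ i) (L t)) = Polynomial.monom 1 i"
    proof (rule poly_eqI_degree[where A="real ` {..m}"])
      fix z assume "z \<in> real ` {..m}"
      then obtain s where s: "s \<le> m" "z = real s" by auto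
      have "poly (\<Sum>t\<le>m. Polynomial.smult (real t ^ i) (L t)) z = (\<Sum>t\<le>m. if t = s then real t ^ i else 0)"
        unfolding poly_sum s(2) using L s(1) by (intro sum.cong) auto
      then show "poly (\<Sum>t\<le>m. Polynomial.smult (real t ^ i) (L t)) z = poly (Polynomial.monom 1 i) z"
        using s by (simp add: poly_monom)
    next
      have "degree (\<Sum>t\<le>m. Polynomial.smult (real t ^ i) (L t)) \<le> m"
        using deg by (intro degree_sum_le) (auto intro: order_trans[OF degree_smult_le])
      then show "degree (\<Sum>t\<le>m. Polynomial.smult (real t ^ i) (L t)) < card (real ` {..m})"
        by (simp add: card_image inj_on_def)
      show "degree (Polynomial.monom (1::real) i) < card (real ` {..m})"
        using degree_monom_le[of "1::real" i] i by (simp add: card_image inj_on_def)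
    qed
    from arg_cong[OF this, of "\<lambda>p. coeff p k"] show ?thesis
      by (simp add: coeff_sum mult.commute)
  qed
  then show ?thesis by (intro exI[of _ "\<lambda>t. coeff (L t) k"]) simp
qed

section \<open>Entries of the lift and the functionals dual to them\<close>

lemma lift_dim_pos: "0 < n \<Longrightarrow> 0 < lift_dim n m"
  unfolding lift_dim_def by (rule zero_less_binomial) linarith

abbreviation lift_entry :: "nat \<Rightarrow> nat \<Rightarrow> real^'n::{finite,linorder} \<Rightarrow> real" where
  "lift_entry m i x \<equiv> vec_index (lift_vec m x) i"

definition monomial :: "nat list \<Rightarrow> real^'n::{finite,linorder} \<Rightarrow> real" where
  "monomial \<alpha> x = (\<Prod>i<CARD('n). coordinate x i ^ (\<alpha> ! i))"

lemma dim_lift_vec [simp]: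
  "dim_vec (lift_vec m (x :: real^'n::{finite,linorder})) = lift_dim CARD('n) m"
  by (simp add: lift_vec_def length_exponents)

lemma multinomial_pos: "0 < multinomial \<alpha>"
proof -
  have "(0::real) < (\<Prod>a\<leftarrow>\<alpha>. fact a)" by (induction \<alpha>) auto
  then show ?thesis by (simp add: multinomial_def)
qed

lemma lift_entry_eq:
  fixes x :: "real^'n::{finite,linorder}"
  assumes "i < lift_dim CARD('n) m"
  shows "lift_entry m i x =
    sqrt (multinomial (exponents CARD('n) m ! i)) * monomial (exponents CARD('n) m ! i) x"
  using assms by (simp add: lift_vec_def vec_of_list_index length_exponents monomial_def)

lemma exponents_nth:
  assumes "i < lift_dim n m"
  shows "length (exponents n m ! i) = n" "sum_list (exponents n m ! i) = m"
  using nth_mem[of i "exponents n m"] assms by (auto simp: length_exponents set_exponents)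

lemma exponents_inj:
  assumes "i < lift_dim n m" "j < lift_dim n m" "exponents n m ! i = exponents n m ! j"
  shows "i = j"
proof -
  have irr: "(\<alpha>, \<alpha>) \<notin> lexord {(i, j). i < j}" for \<alpha> :: "nat list"
    by (rule lexord_irreflexive) auto
  have "False" if "i < j" "j < lift_dim n m" "exponents n m ! i = exponents n m ! j" for i j
    using sorted_wrt_nth_less[OF exponents_descending[of n m] that(1)] that irr
    by (simp add: length_exponents)
  then show ?thesis using assms by (metis nat_neq_iff)
qed

lemma bij_coordinates:
  "bij_betw (\<lambda>i. sorted_list_of_set (UNIV :: 'n::{finite,linorder} set) ! i) {..<CARD('n)} UNIV"
  by (rule bij_betw_nth) auto

lemma ex_coordinates:
  fixes f :: "nat \<Rightarrow> real"
  obtains x :: "real^'n::{finite,linorder}" where "\<And>i. i < CARD('n) \<Longrightarrow> coordinate x i = f i"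
proof
  fix i assume "i < CARD('n)"
  then show "coordinate (\<chi> j. f (inv_into {..<CARD('n)}
      (\<lambda>i. sorted_list_of_set (UNIV :: 'n set) ! i) j)) i = f i"
    using bij_betw_inv_into_left[OF bij_coordinates[where 'n='n]] by (simp add: coordinate_def)
qed

text \<open>
  The dual functionals of the lift entries are products of one-variable coefficient functionals,
  evaluated on the grid \<open>{0..m}\<close> in every coordinate.
\<close>

lemma lift_dual:
  obtains I :: "(nat \<Rightarrow> nat) set" and p :: "(nat \<Rightarrow> nat) \<Rightarrow> real^'n::{finite,linorder}"
    and d :: "nat \<Rightarrow> (nat \<Rightarrow> nat) \<Rightarrow> real"
  where "finite I"
    and "\<And>i j. i < lift_dim CARD('n) m \<Longrightarrow> j < lift_dim CARD('n) m \<Longrightarrow>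
      (\<Sum>q\<in>I. d j q * lift_entry m i (p q)) = (if i = j then 1 else 0)"
proof -
  let ?n = "CARD('n)"
  let ?e = "\<lambda>i. exponents ?n m ! i"
  let ?I = "PiE {..<?n} (\<lambda>_. {..m})"
  obtain d where d: "\<And>k i. i \<le> m \<Longrightarrow> (\<Sum>t\<le>m. d k t * real t ^ i) = (if i = k then 1 else (0::real))"
    using ex_coefficient_functional[of m] by metis
  have "\<exists>x::real^'n::{finite,linorder}. \<forall>i<?n. coordinate x i = real (q i)" for q :: "nat \<Rightarrow> nat"
    by (rule ex_coordinates[of "\<lambda>i. real (q i)"]) auto
  then obtain p :: "(nat \<Rightarrow> nat) \<Rightarrow> real^'n::{finite,linorder}" where p: "\<And>q i. i < ?n \<Longrightarrow> coordinate (p q) i = real (q i)"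
    by metis
  have "(\<Sum>q\<in>?I. ((\<Prod>l<?n. d (?e j ! l) (q l)) / sqrt (multinomial (?e j))) * lift_entry m i (p q))
      = (if i = j then 1 else 0)"
    if i: "i < lift_dim ?n m" and j: "j < lift_dim ?n m" for i j
  proof -
    have le: "?e i ! l \<le> m" if "l < ?n" for l
      using exponents_nth[OF i] member_le_sum_list[of "?e i ! l" "?e i"] that by simp
    have "(\<Sum>q\<in>?I. ((\<Prod>l<?n. d (?e j ! l) (q l)) / sqrt (multinomial (?e j))) * lift_entry m i (p q))
      = sqrt (multinomial (?e i)) / sqrt (multinomial (?e j)) *
          (\<Sum>q\<in>?I. \<Prod>l<?n. d (?e j ! l) (q l) * real (q l) ^ (?e i ! l))"
      unfolding sum_distrib_left
      by (intro sum.cong refl) (simp add: lift_entry_eq[OF i] monomial_def p prod.distrib)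
    also have "(\<Sum>q\<in>?I. \<Prod>l<?n. d (?e j ! l) (q l) * real (q l) ^ (?e i ! l))
      = (\<Prod>l<?n. \<Sum>t\<le>m. d (?e j ! l) t * real t ^ (?e i ! l))"
      by (rule prod_sum_PiE[symmetric]) auto
    also have "\<dots> = (\<Prod>l<?n. if ?e i ! l = ?e j ! l then 1 else 0)"
      using d le by (intro prod.cong) auto
    also have "\<dots> = (if i = j then 1 else 0)"
    proof (cases "i = j")
      case False
      then have "?e i \<noteq> ?e j" using exponents_inj[OF i j] by blast
      then obtain l where "l < ?n" "?e i ! l \<noteq> ?e j ! l"
        using exponents_nth[OF i] exponents_nth[OF j] by (metis nth_equalityI)
      then show ?thesis using False by (auto intro!: prod_zero)
    qed simp
    finally show ?thesis using multinomial_pos[of "?e j"] by auto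
  qed
  from that[OF _ this] show ?thesis by (simp add: finite_PiE)
qed

text \<open>These are the homogeneous polynomial functions of degree \<open>m\<close>, represented
  as linear functionals of the lift because in this form expectations pass through them.\<close>

definition homogeneous :: "nat \<Rightarrow> (real^'n::{finite,linorder} \<Rightarrow> real) \<Rightarrow> bool" where
  "homogeneous m f \<longleftrightarrow> (\<exists>c. \<forall>x. f x = (\<Sum>i<lift_dim CARD('n) m. c i * lift_entry m i x))"

lemma homogeneous_scale: "homogeneous m f \<Longrightarrow> homogeneous m (\<lambda>x. k * f x)"
  unfolding homogeneous_def
proof (elim exE)
  fix c assume "\<forall>x. f x = (\<Sum>i<lift_dim CARD('a) m. c i * lift_entry m i x)"
  then show "\<exists>c. \<forall>x. k * f x = (\<Sum>i<lift_dim CARD('a) m. c i * lift_entry m i x)"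
    by (intro exI[of _ "\<lambda>i. k * c i"]) (simp add: sum_distrib_left mult.assoc)
qed

lemma homogeneous_sum:
  fixes f :: "'j \<Rightarrow> real^'n::{finite,linorder} \<Rightarrow> real"
  assumes "\<And>j. j \<in> J \<Longrightarrow> homogeneous m (f j)"
  shows "homogeneous m (\<lambda>x. \<Sum>j\<in>J. f j x)"
proof -
  have "\<forall>j\<in>J. \<exists>c. \<forall>x. f j x = (\<Sum>i<lift_dim CARD('n) m. c i * lift_entry m i x)"
    using assms unfolding homogeneous_def by blast
  then obtain c where c: "\<And>j x. j \<in> J \<Longrightarrow> f j x = (\<Sum>i<lift_dim CARD('n) m. c j i * lift_entry m i x)"
    by metis
  have "(\<Sum>j\<in>J. f j x) = (\<Sum>i<lift_dim CARD('n) m. (\<Sum>j\<in>J. c j i) * lift_entry m i x)" for x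
    using c by (simp add: sum_distrib_right sum.swap[of _ J])
  then show ?thesis unfolding homogeneous_def by (intro exI[of _ "\<lambda>i. \<Sum>j\<in>J. c j i"]) simp
qed

lemma homogeneous_monomial:
  fixes \<alpha> :: "nat list"
  assumes "length \<alpha> = CARD('n::{finite,linorder})" "sum_list \<alpha> = m"
  shows "homogeneous m (monomial \<alpha> :: real^'n::{finite,linorder} \<Rightarrow> real)"
proof -
  have "\<alpha> \<in> set (exponents CARD('n) m)" using assms by (simp add: set_exponents)
  then obtain j where j: "j < lift_dim CARD('n) m" "exponents CARD('n) m ! j = \<alpha>"
    by (auto simp: in_set_conv_nth length_exponents)
  have "monomial \<alpha> x = (\<Sum>i<lift_dim CARD('n) m.
      (if i = j then 1 / sqrt (multinomial \<alpha>) else 0) * lift_entry m i x)" for x :: "real^'n::{finite,linorder}"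
  proof -
    have "(\<Sum>i<lift_dim CARD('n) m. (if i = j then 1 / sqrt (multinomial \<alpha>) else 0) * lift_entry m i x)
      = (\<Sum>i<lift_dim CARD('n) m. if i = j then 1 / sqrt (multinomial \<alpha>) * lift_entry m i x else 0)"
      by (intro sum.cong) auto
    also have "\<dots> = monomial \<alpha> x"
      using j multinomial_pos[of \<alpha>] by (simp add: lift_entry_eq)
    finally show ?thesis by simp
  qed
  then show ?thesis
    unfolding homogeneous_def
    by (intro exI[of _ "\<lambda>i. if i = j then 1 / sqrt (multinomial \<alpha>) else 0"] allI)
qed

text \<open>Multiplication by a coordinate raises one exponent by one. Products of linear forms
  follow from this by linearity and induction.\<close>

lemma homogeneous_mult_component:
  fixes f :: "real^'n::{finite,linorder} \<Rightarrow> real"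
  assumes "homogeneous m f"
  shows "homogeneous (Suc m) (\<lambda>x. x $ a * f x)"
proof -
  let ?e = "exponents CARD('n) m"
  from assms obtain c where c: "\<And>x. f x = (\<Sum>i<lift_dim CARD('n) m. c i * lift_entry m i x)"
    unfolding homogeneous_def by blast
  \<comment> \<open>The position of the index \<open>a\<close> in the increasing enumeration of the
    coordinates.\<close>
  obtain b where b: "b < CARD('n)" "sorted_list_of_set (UNIV :: 'n set) ! b = a"
    using bij_coordinates[where 'n='n] by (metis UNIV_I bij_betwE bij_betw_imp_surj_on imageE lessThan_iff)
  have "homogeneous (Suc m) (\<lambda>x :: real^'n::{finite,linorder}. \<Sum>i<lift_dim CARD('n) m. (c i * sqrt (multinomial (?e ! i))) *
      monomial ((?e ! i)[b := Suc (?e ! i ! b)]) x)"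
  proof (intro homogeneous_sum homogeneous_scale homogeneous_monomial)
    fix i assume "i \<in> {..<lift_dim CARD('n) m}"
    then have i: "i < lift_dim CARD('n) m" by simp
    show "length ((?e ! i)[b := Suc (?e ! i ! b)]) = CARD('n)"
      using exponents_nth[OF i] by simp
    show "sum_list ((?e ! i)[b := Suc (?e ! i ! b)]) = Suc m"
      using exponents_nth[OF i] b member_le_sum_list[of "?e ! i ! b" "?e ! i"]
      by (simp add: sum_list_update)
  qed
  moreover have "x $ a * f x = (\<Sum>i<lift_dim CARD('n) m. (c i * sqrt (multinomial (?e ! i))) *
      monomial ((?e ! i)[b := Suc (?e ! i ! b)]) x)" for x
    unfolding c sum_distrib_left
  proof (intro sum.cong refl)
    fix i assume "i \<in> {..<lift_dim CARD('n) m}"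
    then have i: "i < lift_dim CARD('n) m" by simp
    have "monomial ((?e ! i)[b := Suc (?e ! i ! b)]) x = x $ a * monomial (?e ! i) x"
      unfolding monomial_def using b exponents_nth[OF i]
      by (simp add: prod.remove[of "{..<CARD('n)}" b] coordinate_def)
    then show "x $ a * (c i * lift_entry m i x) = (c i * sqrt (multinomial (?e ! i))) *
        monomial ((?e ! i)[b := Suc (?e ! i ! b)]) x"
      by (simp add: lift_entry_eq[OF i])
  qed
  ultimately show ?thesis by simp
qed

lemma homogeneous_mult_linear:
  fixes f :: "real^'n::{finite,linorder} \<Rightarrow> real"
  assumes "homogeneous m f"
  shows "homogeneous (Suc m) (\<lambda>x. inner v x * f x)"
proof -
  have "homogeneous (Suc m) (\<lambda>x. \<Sum>a\<in>UNIV. v $ a * (x $ a * f x))"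
    by (intro homogeneous_sum homogeneous_scale homogeneous_mult_component assms)
  then show ?thesis by (simp add: inner_vec_def sum_distrib_right mult.assoc)
qed

lemma homogeneous_one: "homogeneous 0 (\<lambda>x :: real^'n::{finite,linorder}. 1)"
  using homogeneous_monomial[of "replicate CARD('n) 0" 0, where 'n='n]
  by (simp add: monomial_def[abs_def] sum_list_replicate)

lemma homogeneous_mult_linear_power:
  fixes f :: "real^'n::{finite,linorder} \<Rightarrow> real"
  assumes "homogeneous m f"
  shows "homogeneous (k + m) (\<lambda>x. inner v x ^ k * f x)"
proof (induction k)
  case (Suc k)
  from homogeneous_mult_linear[OF this, of v] show ?case by (simp add: mult.assoc)
qed (use assms in simp)

lemma homogeneous_prod_linear_power:
  fixes v :: "'i \<Rightarrow> real^'n::{finite,linorder}"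
  assumes "finite I"
  shows "homogeneous (\<Sum>i\<in>I. k i) (\<lambda>x. \<Prod>i\<in>I. inner (v i) x ^ k i)"
  using assms
proof induction
  case empty then show ?case by (simp add: homogeneous_one)
next
  case (insert i I)
  from homogeneous_mult_linear_power[OF insert.IH, of "k i" "v i"] insert.hyps
  show ?case by simp
qed

lemma homogeneous_norm_power: "homogeneous (2 * q) (\<lambda>x :: real^'n::{finite,linorder}. norm x ^ (2 * q))"
proof (induction q)
  case (Suc q)
  have "homogeneous (Suc (Suc (2 * q)))
      (\<lambda>x :: real^'n::{finite,linorder}. \<Sum>a\<in>UNIV. x $ a * (x $ a * norm x ^ (2 * q)))"
    by (intro homogeneous_sum homogeneous_mult_component Suc)
  moreover have "(\<Sum>a\<in>UNIV. x $ a * (x $ a * norm x ^ (2 * q))) = norm x ^ (2 * Suc q)" for x :: "real^'n::{finite,linorder}"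
  proof -
    have "(\<Sum>a\<in>UNIV. x $ a * (x $ a * norm x ^ (2 * q))) = inner x x * norm x ^ (2 * q)"
      by (simp add: inner_vec_def sum_distrib_right mult.assoc)
    then show ?thesis by (simp add: power2_norm_eq_inner[symmetric] power_add[symmetric])
  qed
  ultimately show ?case by simp
qed (simp add: homogeneous_one)

section \<open>The lifted matrix: existence, uniqueness and an explicit formula\<close>

lemma homogeneous_lift_entry_matrix:
  fixes A :: "real^'n::{finite,linorder}^'n::{finite,linorder}"
  assumes i: "i < lift_dim CARD('n) m"
  shows "homogeneous m (\<lambda>x. lift_entry m i (A *v x))"
proof -
  let ?e = "exponents CARD('n) m ! i"
  have "sum_list ?e = (\<Sum>l<CARD('n). ?e ! l)"
    using exponents_nth(1)[OF i] by (simp add: sum_list_sum_nth atLeast0LessThan)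
  then have deg: "(\<Sum>l<CARD('n). ?e ! l) = m" using exponents_nth(2)[OF i] by simp
  \<comment> \<open>Every coordinate of \<open>A *v x\<close> is a linear form in \<open>x\<close>,
    so a monomial in \<open>A *v x\<close> is a product of powers of linear forms.\<close>
  have "homogeneous (\<Sum>l<CARD('n). ?e ! l)
      (\<lambda>x. \<Prod>l<CARD('n). inner (A $ (sorted_list_of_set UNIV ! l)) x ^ (?e ! l))"
    by (rule homogeneous_prod_linear_power) simp
  from homogeneous_scale[OF this, of "sqrt (multinomial ?e)"] show ?thesis
    unfolding deg lift_entry_eq[OF i] monomial_def
    by (simp add: coordinate_def matrix_mult_dot)
qed

text \<open>\<open>lift_mat\<close> is a definite description, so existence and uniqueness are both
  owed: existence because the entries of the lift of \<open>A *v x\<close> are homogeneous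
  polynomials in \<open>x\<close>, uniqueness because the dual functionals read off every entry of
  the matrix from its action on lifted vectors.\<close>

lemma lift_mat_props:
  fixes A :: "real^'n::{finite,linorder}^'n::{finite,linorder}"
  shows "lift_mat m A \<in> carrier_mat (lift_dim CARD('n) m) (lift_dim CARD('n) m)"
    and "lift_vec m (A *v x) = lift_mat m A *\<^sub>v lift_vec m x"
proof -
  let ?N = "lift_dim CARD('n) m"
  let ?P = "\<lambda>B. B \<in> carrier_mat ?N ?N \<and> (\<forall>x. lift_vec m (A *v x) = B *\<^sub>v lift_vec m x)"
  have entry: "vec_index (B *\<^sub>v lift_vec m x) i = (\<Sum>j<?N. B $$ (i, j) * lift_entry m j x)"
    if "B \<in> carrier_mat ?N ?N" "i < ?N" for B i and x :: "real^'n::{finite,linorder}"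
    using that by (simp add: scalar_prod_def atLeast0LessThan)
  have "\<forall>i<?N. \<exists>c. \<forall>x. lift_entry m i (A *v x) = (\<Sum>j<?N. c j * lift_entry m j x)"
    using homogeneous_lift_entry_matrix[of _ m A] unfolding homogeneous_def by blast
  then obtain c where c: "\<And>i x. i < ?N \<Longrightarrow>
      lift_entry m i (A *v x) = (\<Sum>j<?N. c i j * lift_entry m j x)" by metis
  have ex: "?P (Matrix.mat ?N ?N (\<lambda>(i, j). c i j))"
  proof (intro conjI allI eq_vecI)
    fix x :: "real^'n::{finite,linorder}" and i
    assume "i < dim_vec (Matrix.mat ?N ?N (\<lambda>(i, j). c i j) *\<^sub>v lift_vec m x)"
    then have i: "i < ?N" by simp
    show "lift_entry m i (A *v x) = vec_index (Matrix.mat ?N ?N (\<lambda>(i, j). c i j) *\<^sub>v lift_vec m x) i"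
      unfolding c[OF i] entry[OF mat_carrier i] using i by simp
  qed simp_all
  obtain I :: "(nat \<Rightarrow> nat) set" and p :: "(nat \<Rightarrow> nat) \<Rightarrow> real^'n::{finite,linorder}" and d where
    dual: "\<And>i j. i < ?N \<Longrightarrow> j < ?N \<Longrightarrow>
      (\<Sum>q\<in>I. d j q * lift_entry m i (p q)) = (if i = j then 1 else 0)"
    by (rule lift_dual[where 'n='n and m=m]) blast
  have uniq: "B $$ (i, j) = (\<Sum>q\<in>I. d j q * lift_entry m i (A *v p q))"
    if B: "?P B" and i: "i < ?N" and j: "j < ?N" for B i j
  proof -
    have "(\<Sum>q\<in>I. d j q * lift_entry m i (A *v p q))
        = (\<Sum>q\<in>I. d j q * (\<Sum>l<?N. B $$ (i, l) * lift_entry m l (p q)))"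
      using B entry[of B i] i by simp
    also have "\<dots> = (\<Sum>l<?N. B $$ (i, l) * (\<Sum>q\<in>I. d j q * lift_entry m l (p q)))"
      by (simp add: sum_distrib_left sum.swap[of _ I] algebra_simps)
    also have "\<dots> = (\<Sum>l<?N. B $$ (i, l) * (if l = j then 1 else 0))"
      using dual j by (intro sum.cong) auto
    also have "\<dots> = (\<Sum>l<?N. if l = j then B $$ (i, l) else 0)"
      by (intro sum.cong) auto
    also have "\<dots> = B $$ (i, j)" using j by simp
    finally show ?thesis by simp
  qed
  have "\<exists>!B. ?P B"
  proof (rule ex_ex1I)
    show "\<exists>B. ?P B" using ex by blast
    fix B C assume "?P B" "?P C"
    then show "B = C" using uniq[of B] uniq[of C] by (intro eq_matI) auto
  qed
  from theI'[OF this] have P: "?P (lift_mat m A)" unfolding lift_mat_def .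
  then show "lift_mat m A \<in> carrier_mat ?N ?N"
    and "lift_vec m (A *v x) = lift_mat m A *\<^sub>v lift_vec m x" by auto
qed

text \<open>The points \<open>p q\<close> and the weights \<open>d j q\<close> do not depend on
  \<open>A\<close>. This exhibits the entries as explicit functions of \<open>A\<close>, from which
  measurability and size can be read off.\<close>

lemma lift_mat_entry:
  obtains I :: "(nat \<Rightarrow> nat) set" and p :: "(nat \<Rightarrow> nat) \<Rightarrow> real^'n::{finite,linorder}"
    and d :: "nat \<Rightarrow> (nat \<Rightarrow> nat) \<Rightarrow> real"
  where "\<And>(A :: real^'n::{finite,linorder}^'n::{finite,linorder}) i j.
      i < lift_dim CARD('n) m \<Longrightarrow> j < lift_dim CARD('n) m \<Longrightarrow>
      lift_mat m A $$ (i, j) = (\<Sum>q\<in>I. d j q * lift_entry m i (A *v p q))"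
proof -
  obtain I :: "(nat \<Rightarrow> nat) set" and p :: "(nat \<Rightarrow> nat) \<Rightarrow> real^'n::{finite,linorder}" and d where
    dual: "\<And>i j. i < lift_dim CARD('n) m \<Longrightarrow> j < lift_dim CARD('n) m \<Longrightarrow>
      (\<Sum>q\<in>I. d j q * lift_entry m i (p q)) = (if i = j then 1 else 0)"
    by (rule lift_dual[where 'n='n and m=m]) blast
  show ?thesis
  proof (rule that)
    fix A :: "real^'n::{finite,linorder}^'n::{finite,linorder}" and i j
    assume i: "i < lift_dim CARD('n) m" and j: "j < lift_dim CARD('n) m"
    note L = lift_mat_props[where m=m and A=A]
    have "(\<Sum>q\<in>I. d j q * lift_entry m i (A *v p q))
        = (\<Sum>q\<in>I. d j q * (\<Sum>l<lift_dim CARD('n) m. lift_mat m A $$ (i, l) * lift_entry m l (p q)))"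
      using L(1) i unfolding L(2) by (simp add: scalar_prod_def atLeast0LessThan)
    also have "\<dots> = (\<Sum>l<lift_dim CARD('n) m. lift_mat m A $$ (i, l) *
        (\<Sum>q\<in>I. d j q * lift_entry m l (p q)))"
      by (simp add: sum_distrib_left sum.swap[of _ I] algebra_simps)
    also have "\<dots> = (\<Sum>l<lift_dim CARD('n) m. if l = j then lift_mat m A $$ (i, l) else 0)"
      using dual j by (intro sum.cong) auto
    also have "\<dots> = lift_mat m A $$ (i, j)" using j by simp
    finally show "lift_mat m A $$ (i, j) = (\<Sum>q\<in>I. d j q * lift_entry m i (A *v p q))" by simp
  qed
qed

lemma lift_entry_mult:
  fixes A :: "real^'n::{finite,linorder}^'n::{finite,linorder}"
  assumes "i < lift_dim CARD('n) m"
  shows "lift_entry m i (A *v x) =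
    (\<Sum>j<lift_dim CARD('n) m. lift_mat m A $$ (i, j) * lift_entry m j x)"
  using lift_mat_props(1)[where m=m and A=A] assms unfolding lift_mat_props(2)
  by (simp add: scalar_prod_def atLeast0LessThan)

lemma borel_measurable_lift_entry:
  assumes "i < lift_dim CARD('n) m"
  shows "lift_entry m i \<in> borel_measurable (borel :: (real^'n::{finite,linorder}) measure)"
  unfolding lift_entry_eq[OF assms] monomial_def coordinate_def by measurable

lemma borel_measurable_lift_mat_entry:
  assumes "i < lift_dim CARD('n) m" "j < lift_dim CARD('n) m"
  shows "(\<lambda>A :: real^'n::{finite,linorder}^'n::{finite,linorder}. lift_mat m A $$ (i, j))
    \<in> borel_measurable borel"
proof -
  obtain I :: "(nat \<Rightarrow> nat) set" and p :: "(nat \<Rightarrow> nat) \<Rightarrow> real^'n::{finite,linorder}" and d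
    where *: "\<And>(A :: real^'n::{finite,linorder}^'n::{finite,linorder}) i j.
      i < lift_dim CARD('n) m \<Longrightarrow> j < lift_dim CARD('n) m \<Longrightarrow>
      lift_mat m A $$ (i, j) = (\<Sum>q\<in>I. d j q * lift_entry m i (A *v p q))"
    by (rule lift_mat_entry[where 'n='n and m=m]) blast
  have [measurable]: "(\<lambda>A :: real^'n::{finite,linorder}^'n::{finite,linorder}. lift_entry m i (A *v p q))
      \<in> borel_measurable borel" for q
    using measurable_compose[OF _ borel_measurable_lift_entry[OF assms(1)],
        where f="\<lambda>A :: real^'n::{finite,linorder}^'n::{finite,linorder}. A *v p q" and M=borel]
    by simp
  show ?thesis unfolding *[OF assms] by measurable
qed

lemma lift_entry_bound:
  obtains L where "0 < L" "\<And>i (x :: real^'n::{finite,linorder}).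
    i < lift_dim CARD('n) m \<Longrightarrow> \<bar>lift_entry m i x\<bar> \<le> L * norm x ^ m"
proof
  let ?s = "\<lambda>i. sqrt (multinomial (exponents CARD('n) m ! i))"
  have nonneg: "0 \<le> ?s i" for i using multinomial_pos[of "exponents CARD('n) m ! i"] by simp
  show "0 < 1 + (\<Sum>i<lift_dim CARD('n) m. ?s i)"
    using nonneg by (intro add_pos_nonneg sum_nonneg) auto
  fix i and x :: "real^'n::{finite,linorder}" assume i: "i < lift_dim CARD('n) m"
  let ?e = "exponents CARD('n) m ! i"
  have "\<bar>monomial ?e x\<bar> \<le> (\<Prod>l<CARD('n). norm x ^ (?e ! l))"
    unfolding monomial_def abs_prod coordinate_def power_abs
    by (intro prod_mono conjI power_mono component_le_norm_cart) auto
  also have "\<dots> = norm x ^ m"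
    using exponents_nth[OF i] by (simp add: power_sum[symmetric] sum_list_sum_nth atLeast0LessThan)
  finally have "\<bar>lift_entry m i x\<bar> \<le> ?s i * norm x ^ m"
    unfolding lift_entry_eq[OF i] abs_mult using nonneg[of i] by (auto intro: mult_left_mono)
  also have "\<dots> \<le> (1 + (\<Sum>i<lift_dim CARD('n) m. ?s i)) * norm x ^ m"
    using i nonneg member_le_sum[of i "{..<lift_dim CARD('n) m}" ?s]
    by (intro mult_right_mono) auto
  finally show "\<bar>lift_entry m i x\<bar> \<le> (1 + (\<Sum>i<lift_dim CARD('n) m. ?s i)) * norm x ^ m" .
qed

lemma lift_mat_entry_bound:
  obtains L where "0 \<le> L" "\<And>i j (A :: real^'n::{finite,linorder}^'n::{finite,linorder}) b.
    i < lift_dim CARD('n) m \<Longrightarrow> j < lift_dim CARD('n) m \<Longrightarrow> (\<And>v. norm (A *v v) \<le> b * norm v) \<Longrightarrow>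
    \<bar>lift_mat m A $$ (i, j)\<bar> \<le> L * b ^ m"
proof -
  obtain I :: "(nat \<Rightarrow> nat) set" and p :: "(nat \<Rightarrow> nat) \<Rightarrow> real^'n::{finite,linorder}" and d
    where *: "\<And>(A :: real^'n::{finite,linorder}^'n::{finite,linorder}) i j.
      i < lift_dim CARD('n) m \<Longrightarrow> j < lift_dim CARD('n) m \<Longrightarrow>
      lift_mat m A $$ (i, j) = (\<Sum>q\<in>I. d j q * lift_entry m i (A *v p q))"
    by (rule lift_mat_entry[where 'n='n and m=m]) blast
  obtain L where L: "0 < L" "\<And>i (x :: real^'n::{finite,linorder}).
      i < lift_dim CARD('n) m \<Longrightarrow> \<bar>lift_entry m i x\<bar> \<le> L * norm x ^ m"
    by (rule lift_entry_bound[where 'n='n and m=m]) blast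
  define S where "S j = (\<Sum>q\<in>I. \<bar>d j q\<bar> * (L * norm (p q) ^ m))" for j
  have S: "0 \<le> S j" for j unfolding S_def using L(1) by (intro sum_nonneg mult_nonneg_nonneg) auto
  show ?thesis
  proof
    show "0 \<le> (\<Sum>j<lift_dim CARD('n) m. S j)" using S by (intro sum_nonneg)
    fix i j b and A :: "real^'n::{finite,linorder}^'n::{finite,linorder}"
    assume i: "i < lift_dim CARD('n) m" and j: "j < lift_dim CARD('n) m"
      and b: "\<And>v. norm (A *v v) \<le> b * norm v"
    have "0 \<le> b"
    proof -
      have "0 \<le> b * norm (axis undefined 1 :: real^'n::{finite,linorder})"
        using norm_ge_zero b by (rule order_trans)
      then show ?thesis by simp
    qed
    have "\<bar>lift_mat m A $$ (i, j)\<bar> \<le> (\<Sum>q\<in>I. \<bar>d j q\<bar> * (L * norm (p q) ^ m) * b ^ m)"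
      unfolding *[OF i j]
    proof (rule order_trans[OF sum_abs sum_mono])
      fix q
      have "\<bar>lift_entry m i (A *v p q)\<bar> \<le> L * norm (A *v p q) ^ m" by (rule L(2)[OF i])
      also have "\<dots> \<le> L * (b * norm (p q)) ^ m"
        using L(1) b by (intro mult_left_mono power_mono) auto
      finally show "\<bar>d j q * lift_entry m i (A *v p q)\<bar> \<le> \<bar>d j q\<bar> * (L * norm (p q) ^ m) * b ^ m"
        unfolding abs_mult mult.assoc by (intro mult_left_mono) (auto simp: power_mult_distrib mult_ac)
    qed
    also have "\<dots> = S j * b ^ m" unfolding S_def sum_distrib_right ..
    also have "\<dots> \<le> (\<Sum>j<lift_dim CARD('n) m. S j) * b ^ m"
      using j S \<open>0 \<le> b\<close> by (intro mult_right_mono member_le_sum) auto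
    finally show "\<bar>lift_mat m A $$ (i, j)\<bar> \<le> (\<Sum>j<lift_dim CARD('n) m. S j) * b ^ m" .
  qed
qed

section \<open>Schur stability and powers of a matrix\<close>

lemma pow_smult_mat:
  assumes C: "(C :: 'a::comm_ring_1 mat) \<in> carrier_mat n n"
  shows "(k \<cdot>\<^sub>m C) ^\<^sub>m j = k ^ j \<cdot>\<^sub>m (C ^\<^sub>m j)"
proof (induction j)
  case 0
  show ?case by (rule eq_matI) auto
next
  case (Suc j)
  note P = pow_carrier_mat[OF C, of j]
  have "(k ^ j \<cdot>\<^sub>m (C ^\<^sub>m j)) * (k \<cdot>\<^sub>m C) = k ^ j \<cdot>\<^sub>m (k \<cdot>\<^sub>m (C ^\<^sub>m j * C))"
    using mult_smult_assoc_mat[OF P, of "k \<cdot>\<^sub>m C" n] mult_smult_distrib[OF P C] C by simp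
  also have "\<dots> = k ^ Suc j \<cdot>\<^sub>m (C ^\<^sub>m j * C)"
    by (rule eq_matI) (auto simp: mult_ac)
  finally show ?case using Suc by simp
qed

lemma pow_mat_Suc_left:
  assumes "(B :: 'a::semiring_1 mat) \<in> carrier_mat n n"
  shows "B ^\<^sub>m Suc k = B * B ^\<^sub>m k"
proof (induction k)
  case 0
  show ?case using assms by simp
next
  case (Suc k)
  have "B ^\<^sub>m Suc (Suc k) = (B * B ^\<^sub>m k) * B"
    using Suc by simp
  also have "\<dots> = B * (B ^\<^sub>m k * B)"
    by (rule assoc_mult_mat[OF assms pow_carrier_mat[OF assms] assms])
  finally show ?case by simp
qed

lemma pow_mat_iterate:
  fixes B :: "real mat"
  assumes B: "B \<in> carrier_mat n n"
    and step: "\<And>k i. i < n \<Longrightarrow> w (Suc k) i = (\<Sum>j<n. B $$ (i, j) * w k j)" and i: "i < n"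
  shows "w k i = (\<Sum>j<n. (B ^\<^sub>m k) $$ (i, j) * w 0 j)"
  using i
proof (induction k arbitrary: i)
  case 0
  have "(\<Sum>j<n. (B ^\<^sub>m 0) $$ (i, j) * w 0 j) = (\<Sum>j<n. if j = i then w 0 j else 0)"
    using B 0 by (intro sum.cong) auto
  then show ?case using 0 by simp
next
  case (Suc k)
  have "w (Suc k) i = (\<Sum>j<n. B $$ (i, j) * (\<Sum>l<n. (B ^\<^sub>m k) $$ (j, l) * w 0 l))"
    using step[OF Suc.prems] Suc.IH by simp
  also have "\<dots> = (\<Sum>l<n. (\<Sum>j<n. B $$ (i, j) * (B ^\<^sub>m k) $$ (j, l)) * w 0 l)"
    unfolding sum_distrib_left sum_distrib_right mult.assoc by (rule sum.swap)
  also have "\<dots> = (\<Sum>l<n. (B ^\<^sub>m Suc k) $$ (i, l) * w 0 l)"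
  proof (rule sum.cong[OF refl])
    fix l assume "l \<in> {..<n}"
    then have "(B * B ^\<^sub>m k) $$ (i, l) = (\<Sum>j<n. B $$ (i, j) * (B ^\<^sub>m k) $$ (j, l))"
      using B Suc.prems pow_carrier_mat[OF B, of k]
      by (simp add: scalar_prod_def atLeast0LessThan del: pow_mat_dim)
    then show "(\<Sum>j<n. B $$ (i, j) * (B ^\<^sub>m k) $$ (j, l)) * w 0 l = (B ^\<^sub>m Suc k) $$ (i, l) * w 0 l"
      unfolding pow_mat_Suc_left[OF B] by simp
  qed
  finally show ?case .
qed

text \<open>A spectral radius below 1 bounds the powers of a complex matrix through its Jordan
  normal form. Applied to \<open>B\<close> divided by a number \<open>\<rho>\<close> between the
  spectral radius and 1, boundedness becomes geometric decay of the powers of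
  \<open>B\<close>.\<close>

lemma schur_stable_pow_bound:
  assumes B: "B \<in> carrier_mat n n" and n: "0 < n" and "schur_stable B"
  obtains \<rho> K where "0 < \<rho>" "\<rho> < 1" "0 \<le> K"
    "\<And>k i j. i < n \<Longrightarrow> j < n \<Longrightarrow> \<bar>(B ^\<^sub>m k) $$ (i, j)\<bar> \<le> K * \<rho> ^ k"
proof -
  let ?C = "map_mat complex_of_real B"
  have C: "?C \<in> carrier_mat n n" using B by simp
  \<comment> \<open>The midpoint between the spectral radius and 1; the maximum with 0 makes
    positivity immediate.\<close>
  define \<rho> where "\<rho> = (1 + max 0 (spectral_radius ?C)) / 2"
  have \<rho>: "0 < \<rho>" "\<rho> < 1" "spectral_radius ?C < \<rho>"
    using assms(3) unfolding schur_stable_def \<rho>_def by auto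
  let ?D = "complex_of_real (1 / \<rho>) \<cdot>\<^sub>m ?C"
  have D: "?D \<in> carrier_mat n n" using C by simp
  have "spectral_radius ?D < 1"
  proof -
    obtain \<mu> v where \<mu>: "spectral_radius ?D = norm \<mu>" and ev: "eigenvector ?D v \<mu>"
      using spectral_radius_mem_max(1)[OF D n] by (auto simp: spectrum_def eigenvalue_def)
    have v: "v \<in> carrier_vec n" "v \<noteq> 0\<^sub>v n" "?D *\<^sub>v v = \<mu> \<cdot>\<^sub>v v"
      using ev D C by (auto simp: eigenvector_def)
    have "?C *\<^sub>v v = (complex_of_real \<rho> * \<mu>) \<cdot>\<^sub>v v"
    proof (rule eq_vecI)
      fix i assume "i < dim_vec ((complex_of_real \<rho> * \<mu>) \<cdot>\<^sub>v v)"
      then have i: "i < n" using v(1) by simp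
      have "complex_of_real (1 / \<rho>) * vec_index (?C *\<^sub>v v) i = vec_index (?D *\<^sub>v v) i"
        using i B v(1) by (simp add: row_smult)
      also have "\<dots> = \<mu> * vec_index v i" unfolding v(3) using v(1) i by simp
      finally show "vec_index (?C *\<^sub>v v) i = vec_index ((complex_of_real \<rho> * \<mu>) \<cdot>\<^sub>v v) i"
        using \<rho>(1) v(1) i by (simp add: field_simps del: index_mult_mat_vec)
    qed (use v(1) B in auto)
    then have "eigenvalue ?C (complex_of_real \<rho> * \<mu>)"
      using v(1,2) C unfolding eigenvalue_def eigenvector_def by auto
    then have "complex_of_real \<rho> * \<mu> \<in> spectrum ?C" by (simp add: spectrum_def)
    then have "norm (complex_of_real \<rho> * \<mu>) \<le> spectral_radius ?C"
      by (intro spectral_radius_mem_max(2)[OF C n] imageI)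
    then have "\<rho> * norm \<mu> \<le> spectral_radius ?C"
      using \<rho>(1) by (simp add: norm_mult)
    also have "\<dots> < \<rho> * 1" using \<rho>(3) by simp
    finally show ?thesis using \<rho>(1) unfolding \<mu> by (simp only: mult_less_cancel_left_pos)
  qed
  moreover obtain as where "char_poly ?D = (\<Prod>a\<leftarrow>as. [:- a, 1:])"
    using char_poly_factorized[OF D] by blast
  then have "\<exists>n_as. jordan_nf ?D n_as"
    using jordan_nf_exists[OF D] by blast
  ultimately obtain c where c: "\<And>k. norm_bound (?D ^\<^sub>m k) c"
    using spectral_radius_jnf_norm_bound_less_1[OF D] by blast
  have le: "\<bar>(B ^\<^sub>m k) $$ (i, j)\<bar> \<le> c * \<rho> ^ k" if ij: "i < n" "j < n" for k i j
  proof -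
    have car: "?C ^\<^sub>m k \<in> carrier_mat n n" "B ^\<^sub>m k \<in> carrier_mat n n"
      by (rule pow_carrier_mat[OF C], rule pow_carrier_mat[OF B])
    have "norm ((?D ^\<^sub>m k) $$ (i, j)) \<le> c"
      using c[of k, unfolded norm_bound_def] ij carrier_matD[OF pow_carrier_mat[OF D, of k]] by metis
    moreover have "(?D ^\<^sub>m k) $$ (i, j) = complex_of_real ((1 / \<rho>) ^ k * (B ^\<^sub>m k) $$ (i, j))"
    proof -
      let ?P = "B ^\<^sub>m k"
      have "?D ^\<^sub>m k = complex_of_real (1 / \<rho>) ^ k \<cdot>\<^sub>m map_mat complex_of_real ?P"
        by (simp only: pow_smult_mat[OF C] of_real_hom.mat_hom_pow[OF B])
      then have "(?D ^\<^sub>m k) $$ (i, j) = complex_of_real (1 / \<rho>) ^ k * complex_of_real (?P $$ (i, j))"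
        using ij carrier_matD[OF car(2)]
        by (simp only: index_smult_mat index_map_mat simp_thms)
      then show ?thesis by (simp only: of_real_mult of_real_power)
    qed
    ultimately have "\<bar>(1 / \<rho>) ^ k * (B ^\<^sub>m k) $$ (i, j)\<bar> \<le> c"
      by (simp only: norm_of_real)
    from mult_right_mono[OF this, of "\<rho> ^ k"] show ?thesis
      using \<rho>(1) by (simp add: abs_mult power_one_over)
  qed
  show ?thesis
  proof (rule that[OF \<rho>(1,2)])
    show "0 \<le> max 0 c" by simp
    show "\<bar>(B ^\<^sub>m k) $$ (i, j)\<bar> \<le> max 0 c * \<rho> ^ k" if "i < n" "j < n" for k i j
      by (rule order_trans[OF le[OF that] mult_right_mono]) (use \<rho>(1) in simp_all)
  qed
qed

text \<open>Take an eigenvector for an eigenvalue \<open>\<mu>\<close> of maximal modulus. The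
  powers multiply it by \<open>\<mu> ^ k\<close>, and this product tends to 0 in a nonzero entry,
  which excludes \<open>1 \<le> norm \<mu>\<close>.\<close>

lemma schur_stable_if_pow_tendsto_0:
  assumes B: "B \<in> carrier_mat n n" and n: "0 < n"
    and lim: "\<And>i j. i < n \<Longrightarrow> j < n \<Longrightarrow> (\<lambda>k. (B ^\<^sub>m k) $$ (i, j)) \<longlonglongrightarrow> 0"
  shows "schur_stable B"
proof -
  let ?C = "map_mat complex_of_real B"
  have C: "?C \<in> carrier_mat n n" using B by simp
  obtain \<mu> v where \<mu>: "spectral_radius ?C = norm \<mu>" and ev: "eigenvector ?C v \<mu>"
    using spectral_radius_mem_max(1)[OF C n] by (auto simp: spectrum_def eigenvalue_def)
  have v: "v \<in> carrier_vec n" "v \<noteq> 0\<^sub>v n"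
    using ev C by (auto simp: eigenvector_def)
  obtain i where i: "i < n" "vec_index v i \<noteq> 0"
    using v by (metis carrier_vecD eq_vecI index_zero_vec(1) index_zero_vec(2))
  have "\<mu> ^ k * vec_index v i = (\<Sum>j<n. complex_of_real ((B ^\<^sub>m k) $$ (i, j)) * vec_index v j)" for k
  proof -
    have "vec_index (?C ^\<^sub>m k *\<^sub>v v) i = \<mu> ^ k * vec_index v i"
      using eigenvector_pow[OF C ev, of k] i v by simp
    then show ?thesis
      unfolding of_real_hom.mat_hom_pow[OF B, symmetric]
      using i(1) v(1) pow_carrier_mat[OF B, of k]
      by (simp add: scalar_prod_def atLeast0LessThan del: pow_mat_dim)
  qed
  moreover have "(\<lambda>k. \<Sum>j<n. complex_of_real ((B ^\<^sub>m k) $$ (i, j)) * vec_index v j)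
      \<longlonglongrightarrow> (\<Sum>j<n. complex_of_real 0 * vec_index v j)"
    using lim i(1) by (intro tendsto_sum tendsto_mult tendsto_of_real tendsto_const) auto
  ultimately have "(\<lambda>k. \<mu> ^ k * vec_index v i) \<longlonglongrightarrow> 0" by simp
  then have "(\<lambda>k. norm (\<mu> ^ k * vec_index v i)) \<longlonglongrightarrow> 0" by (rule tendsto_norm_zero)
  then have "\<forall>\<^sub>F k in sequentially. norm (\<mu> ^ k * vec_index v i) < norm (vec_index v i)"
    by (rule order_tendstoD(2)) (use i(2) in simp)
  then obtain k where k: "norm (\<mu> ^ k * vec_index v i) < norm (vec_index v i)"
    using eventually_happens'[OF sequentially_bot] by blast
  have "norm \<mu> < 1"
  proof (rule ccontr)
    assume "\<not> norm \<mu> < 1"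
    then have "1 \<le> norm \<mu> ^ k" by (intro one_le_power) simp
    then have "1 * norm (vec_index v i) \<le> norm \<mu> ^ k * norm (vec_index v i)"
      by (rule mult_right_mono) simp
    with k show False unfolding norm_mult norm_power by simp
  qed
  then show ?thesis unfolding schur_stable_def \<mu> .
qed

section \<open>The switched system over its cycles\<close>

lemma bounded_linear_matrix_vector_mult_left:
  "bounded_linear (\<lambda>Y :: real^'n^'k. Y *v v)"
  by (intro linear_conv_bounded_linear[THEN iffD1] linearI)
    (simp_all add: matrix_vector_mult_add_rdistrib scaleR_matrix_vector_assoc)

lemma ode_solution_matrix_vector_mult:
  fixes B :: "real \<Rightarrow> real^'n^'n"
  assumes sol: "ode_solution (\<lambda>t Y. B t ** Y) t0 Y0 Y"
  shows "ode_solution (\<lambda>t v. B t *v v) t0 (Y0 *v v) (\<lambda>t. Y t *v v)"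
  unfolding ode_solution_def
proof (intro allI impI)
  fix t assume "t0 \<le> t"
  then have int: "integrable lborel (\<lambda>s. indicator {t0..t} s *\<^sub>R (B s ** Y s))"
    and Y: "Y t = Y0 + (LINT s|lborel. indicator {t0..t} s *\<^sub>R (B s ** Y s))"
    using sol unfolding ode_solution_def set_integrable_def set_lebesgue_integral_def by blast+
  have eq: "(indicator {t0..t} s *\<^sub>R (B s ** Y s)) *v v = indicator {t0..t} s *\<^sub>R (B s *v (Y s *v v))" for s
    by (simp add: scaleR_matrix_vector_assoc[symmetric] matrix_vector_mul_assoc)
  note lin = bounded_linear_matrix_vector_mult_left[where v=v]
  show "set_integrable lborel {t0..t} (\<lambda>s. B s *v (Y s *v v)) \<and>
      Y t *v v = Y0 *v v + (LINT s:{t0..t}|lborel. B s *v (Y s *v v))"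
    using integrable_bounded_linear[OF lin int] integral_bounded_linear[OF lin int]
    unfolding eq set_integrable_def set_lebesgue_integral_def Y
    by (simp add: matrix_vector_mult_add_rdistrib)
qed

text \<open>With \<open>z = 0\<close> this reads the killed coefficient off the state of a killed
  path.\<close>

lemma borel_measurable_killed_case:
  assumes f: "f \<in> borel_measurable N"
  shows "case_option z f \<in> borel_measurable (killed_space N)"
proof (rule measurableI)
  let ?\<Omega> = "insert None (Some ` space N)"
  let ?G = "insert {None} ((\<lambda>B. Some ` B) ` sets N)"
  have sub: "?G \<subseteq> Pow ?\<Omega>" using sets.sets_into_space by fastforce
  have sp: "space (killed_space N) = ?\<Omega>" and se: "sets (killed_space N) = sigma_sets ?\<Omega> ?G"
    unfolding killed_space_def using sub by (simp_all add: space_measure_of sets_measure_of)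
  fix S :: "'b set" assume S: "S \<in> sets borel"
  have "Some ` (f -` S \<inter> space N) \<in> sets (killed_space N)"
    unfolding se using measurable_sets[OF f S] by (intro sigma_sets.Basic) auto
  moreover have "{None} \<in> sets (killed_space N)"
    unfolding se by (intro sigma_sets.Basic) auto
  moreover have eq: "case_option z f -` S \<inter> space (killed_space N) =
      (if z \<in> S then {None} else {}) \<union> Some ` (f -` S \<inter> space N)"
    unfolding sp by auto
  ultimately show "case_option z f -` S \<inter> space (killed_space N) \<in> sets (killed_space N)"
    unfolding eq by (intro sets.Un) auto
qed simp

text \<open>The growth rate \<open>a\<close> and the cycle bound \<open>C\<close> are the
  quantitative forms of (A3) and (A2). \<open>C\<close> is positive because times are divided by
  it.\<close>

locale regenerative_system = prob_space M
  for M :: "'w measure" and N :: "'s measure" and \<sigma> :: "real \<Rightarrow> 'w \<Rightarrow> 's"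
    and R :: "nat \<Rightarrow> 'w \<Rightarrow> real" and A :: "'s \<Rightarrow> real^'n::{finite,linorder}^'n::{finite,linorder}"
    and x :: "real^'n::{finite,linorder} \<Rightarrow> real \<Rightarrow> 'w \<Rightarrow> real^'n::{finite,linorder}"
    and \<Phi> :: "'w \<Rightarrow> real \<Rightarrow> real \<Rightarrow> real^'n::{finite,linorder}^'n::{finite,linorder}" and a C :: real +
  assumes regenerative: "regenerative_process M N \<sigma> R"
    and A_measurable: "A \<in> borel_measurable N"
    and A_joint: "(\<lambda>(t, \<omega>). A (\<sigma> t \<omega>)) \<in> borel_measurable (restrict_space borel {0..} \<Otimes>\<^sub>M M)"
    and traj: "trajectories M \<sigma> A x"
    and trans: "transition_matrices M \<sigma> A \<Phi>"
    and a_nonneg: "0 \<le> a"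
    and A_rate: "\<And>s v. s \<in> space N \<Longrightarrow> norm (A s *v v) \<le> a * norm v"
    and C_pos: "0 < C"
    and R_1_le: "AE \<omega> in M. R 1 \<omega> \<le> C"
begin

section \<open>Cycles, their lengths and the renewal epochs\<close>

lemma nth_cycle_props:
  "indep_vars (\<lambda>k. cycle_space N) (nth_cycle \<sigma> R) UNIV"
  "nth_cycle \<sigma> R k \<in> measurable M (cycle_space N)"
  "distr M (cycle_space N) (nth_cycle \<sigma> R k) = distr M (cycle_space N) (nth_cycle \<sigma> R 0)"
  using regenerative unfolding regenerative_process_def indep_vars_def by blast+

sublocale identically_distributed M "cycle_space N" "nth_cycle \<sigma> R"
  by unfold_locales (rule nth_cycle_props)+

lemma R_measurable [measurable]: "R (Suc k) \<in> borel_measurable M"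
  and R_pos: "\<omega> \<in> space M \<Longrightarrow> 0 < R (Suc k) \<omega>"
  using regenerative unfolding regenerative_process_def by auto

lemma snd_nth_cycle: "snd (nth_cycle \<sigma> R k \<omega>) = R (Suc k) \<omega>"
  by (simp add: nth_cycle_def cycle_def)

lemma snd_cycle_measurable [measurable]: "snd \<in> borel_measurable (cycle_space N)"
  unfolding cycle_space_def by (rule measurable_snd)

text \<open>The length is the second component of a cycle, so the almost sure bound for the first
  cycle is a property of the common law.\<close>

lemma R_le: "AE \<omega> in M. R (Suc k) \<omega> \<le> C"
proof -
  have *: "(AE y in distr M (cycle_space N) (nth_cycle \<sigma> R k). snd y \<le> C) \<longleftrightarrow>
      (AE \<omega> in M. R (Suc k) \<omega> \<le> C)" for k
    by (subst AE_distr_iff) (simp_all add: snd_nth_cycle)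
  have "AE \<omega> in M. R (Suc 0) \<omega> \<le> C" using R_1_le by simp
  then show ?thesis using *[of k, unfolded c_distr[of k]] *[of 0] by simp
qed

lemma renewal_0 [simp]: "renewal R 0 \<omega> = 0"
  by (simp add: renewal_def)

lemma renewal_Suc: "renewal R (Suc k) \<omega> = renewal R k \<omega> + R (Suc k) \<omega>"
  by (simp add: renewal_def)

lemma renewal_measurable [measurable]: "renewal R k \<in> borel_measurable M"
proof (induction k)
  case (Suc k)
  then show ?case by (simp add: renewal_Suc[abs_def])
qed (simp add: renewal_def[abs_def])

lemma renewal_nonneg: "\<omega> \<in> space M \<Longrightarrow> 0 \<le> renewal R k \<omega>"
  by (induction k) (auto simp: renewal_Suc intro!: add_nonneg_nonneg less_imp_le[OF R_pos])

lemma renewal_less_Suc: "\<omega> \<in> space M \<Longrightarrow> renewal R k \<omega> < renewal R (Suc k) \<omega>"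
  by (simp add: renewal_Suc R_pos)

section \<open>Coefficients, trajectories and transition matrices along a path\<close>

lemma A_bound: "0 \<le> t \<Longrightarrow> \<omega> \<in> space M \<Longrightarrow> norm (A (\<sigma> t \<omega>) *v v) \<le> a * norm v"
  using regenerative unfolding regenerative_process_def stochastic_process_def
  by (blast intro: A_rate measurable_space)

lemma A_measurable_comp:
  assumes "g \<in> borel_measurable L" "\<And>y. y \<in> space L \<Longrightarrow> 0 \<le> g y" "h \<in> measurable L M"
  shows "(\<lambda>y. A (\<sigma> (g y) (h y))) \<in> borel_measurable L"
proof -
  have "(\<lambda>y. (g y, h y)) \<in> measurable L (restrict_space borel {0..} \<Otimes>\<^sub>M M)"
    using assms by (intro measurable_Pair measurable_restrict_space2) auto
  from measurable_compose[OF this A_joint] show ?thesis by simp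
qed

lemma x_solution:
  "\<omega> \<in> space M \<Longrightarrow> ode_solution (\<lambda>t v. A (\<sigma> t \<omega>) *v v) 0 x0 (\<lambda>t. x x0 t \<omega>)"
  using traj unfolding trajectories_def by blast

lemma \<Phi>_solution:
  assumes "\<omega> \<in> space M" "0 \<le> t0"
  shows "ode_solution (\<lambda>t v. A (\<sigma> t \<omega>) *v v) t0 v (\<lambda>t. \<Phi> \<omega> t0 t *v v)"
proof -
  have "ode_solution (\<lambda>t Y. A (\<sigma> t \<omega>) ** Y) t0 (Finite_Cartesian_Product.mat 1) (\<Phi> \<omega> t0)"
    using trans assms unfolding transition_matrices_def by blast
  from ode_solution_matrix_vector_mult[OF this, of v] show ?thesis
    unfolding matrix_vector_mul_lid .
qed

lemma x_restart:
  assumes \<omega>: "\<omega> \<in> space M" and s: "0 \<le> s" and t: "s \<le> t"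
  shows "x x0 t \<omega> = \<Phi> \<omega> s t *v x x0 s \<omega>"
  using ode_solution_restart[OF x_solution[OF \<omega>] s] \<Phi>_solution[OF \<omega> s] a_nonneg _ t
proof (rule ode_solution_unique)
  show "norm (A (\<sigma> u \<omega>) *v v) \<le> a * norm v" if "s \<le> u" for u v
    using A_bound[OF order_trans[OF s that] \<omega>] .
qed

lemma x_norm_le:
  assumes \<omega>: "\<omega> \<in> space M" and "0 \<le> s" "s \<le> t"
  shows "norm (x x0 t \<omega>) \<le> norm (x x0 s \<omega>) * exp (a * (t - s))"
    and "norm (x x0 s \<omega>) \<le> norm (x x0 t \<omega>) * exp (a * (t - s))"
proof -
  have bound: "norm (A (\<sigma> u \<omega>) *v v) \<le> a * norm v" if "0 \<le> u" for u v
    using that \<omega> by (rule A_bound)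
  note le = ode_solution_norm_le[OF x_solution[OF \<omega>] assms(2,3) a_nonneg bound]
  show "norm (x x0 t \<omega>) \<le> norm (x x0 s \<omega>) * exp (a * (t - s))" by (rule le(1))
  show "norm (x x0 s \<omega>) \<le> norm (x x0 t \<omega>) * exp (a * (t - s))" by (rule le(2))
qed

text \<open>
  Killing the coefficients at the end of the cycle turns the transition matrix of a cycle into the
  value of a solution at deterministic times, to which Picard iteration applies.
\<close>

definition killed_A :: "nat \<Rightarrow> real \<Rightarrow> 'w \<Rightarrow> real^'n::{finite,linorder}^'n::{finite,linorder}" where
  "killed_A k s \<omega> = (if 0 \<le> s \<and> s < R (Suc k) \<omega> then A (\<sigma> (s + renewal R k \<omega>) \<omega>) else 0)"

lemma killed_A_joint:
  "(\<lambda>(s, \<omega>). killed_A k s \<omega>) \<in> borel_measurable (borel \<Otimes>\<^sub>M M)"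
proof -
  \<comment> \<open>Joint measurability of the coefficients is given for nonnegative times only. The
    cut-off at 0 supplies such a time everywhere and changes nothing during the cycle.\<close>
  have [measurable]: "(\<lambda>p. A (\<sigma> (max 0 (fst p + renewal R k (snd p))) (snd p)))
      \<in> borel_measurable (borel \<Otimes>\<^sub>M M)"
    by (rule A_measurable_comp) auto
  have "(\<lambda>p. if 0 \<le> fst p \<and> fst p < R (Suc k) (snd p)
        then A (\<sigma> (max 0 (fst p + renewal R k (snd p))) (snd p)) else 0)
      \<in> borel_measurable (borel \<Otimes>\<^sub>M M)"
    by measurable
  also have "?this \<longleftrightarrow> (\<lambda>(s, \<omega>). killed_A k s \<omega>) \<in> borel_measurable (borel \<Otimes>\<^sub>M M)"
    by (intro measurable_cong)
      (auto simp: killed_A_def space_pair_measure max_def dest: renewal_nonneg[of _ k])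
  finally show ?thesis .
qed

lemma killed_A_measurable: "\<omega> \<in> space M \<Longrightarrow> (\<lambda>s. killed_A k s \<omega>) \<in> borel_measurable borel"
  using measurable_joint[OF killed_A_joint, of "\<lambda>s. s" borel "\<lambda>_. \<omega>" k] by simp

lemma killed_A_bound: "\<omega> \<in> space M \<Longrightarrow> norm (killed_A k s \<omega> *v v) \<le> a * norm v"
  using A_bound[of "s + renewal R k \<omega>" \<omega> v] renewal_nonneg[of \<omega> k] a_nonneg
  by (cases "0 \<le> s \<and> s < R (Suc k) \<omega>") (simp_all add: killed_A_def)

lemma killed_solution:
  assumes "\<omega> \<in> space M"
  shows "ode_solution (\<lambda>s v. killed_A k s \<omega> *v v) 0 v
    (\<lambda>s. \<Phi> \<omega> (renewal R k \<omega>) (renewal R k \<omega> + min s (R (Suc k) \<omega>)) *v v)"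
  unfolding killed_A_def
  by (rule ode_solution_shift_kill)
    (use \<Phi>_solution renewal_nonneg R_pos assms in \<open>auto intro: less_imp_le\<close>)

text \<open>Here the representation holds at every sample point: for a fixed elapsed time
  \<open>s\<close> the killed state is a coordinate of the cycle, and the cemetery is read as the
  zero matrix.\<close>

lemma factors_killed_A:
  assumes "0 \<le> s"
  shows "factors (\<lambda>k. killed_A k s)"
proof (rule factorsI)
  show "killed_A k s \<in> borel_measurable M" for k
    using measurable_joint[OF killed_A_joint, of "\<lambda>_. s" M "\<lambda>\<omega>. \<omega>" k] by simp
  have [measurable]: "(\<lambda>y. fst y s) \<in> measurable (cycle_space N) (killed_space N)"
    unfolding cycle_space_def path_space_def
    by (rule measurable_compose[OF measurable_fst measurable_component_singleton]) (use assms in simp)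
  show "(\<lambda>y. case_option 0 A (fst y s)) \<in> borel_measurable (cycle_space N)"
    by (rule measurable_compose[OF _ borel_measurable_killed_case[OF A_measurable]]) simp
  show "AE \<omega> in M. killed_A k s \<omega> = (\<lambda>y. case_option 0 A (fst y s)) (nth_cycle \<sigma> R k \<omega>)" for k
    using assms by (auto simp: killed_A_def nth_cycle_def cycle_def path_def shift_process_def)
qed

lemma factors_matrix_vector_mult:
  fixes X :: "nat \<Rightarrow> 'w \<Rightarrow> real^'k^'l"
  assumes "factors X" "factors Y"
  shows "factors (\<lambda>k \<omega>. X k \<omega> *v Y k \<omega>)"
  using factors_compose[OF factors_Pair[OF assms], where f="\<lambda>p. fst p *v snd p"]
  by (simp add: borel_prod[symmetric])

lemma factors_picard:
  assumes "0 \<le> s"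
  shows "factors (\<lambda>k \<omega>. picard (\<lambda>s. killed_A k s \<omega>) v j s)"
  using assms
proof (induction j arbitrary: s)
  case 0
  show ?case by (simp add: factors_const)
next
  case (Suc j)
  have "factors (\<lambda>k \<omega>. LINT u:{0..s}|lborel. killed_A k u \<omega> *v picard (\<lambda>s. killed_A k s \<omega>) v j u)"
  proof (rule factors_set_integral_vec)
    show "(\<lambda>(u, \<omega>). killed_A k u \<omega> *v picard (\<lambda>s. killed_A k s \<omega>) v j u)
        \<in> borel_measurable (borel \<Otimes>\<^sub>M M)" for k
      using borel_measurable_matrix_vector_mult[OF killed_A_joint picard_joint_measurable[OF killed_A_joint]]
      by (simp add: case_prod_beta')
    show "factors (\<lambda>k \<omega>. killed_A k u \<omega> *v picard (\<lambda>s. killed_A k s \<omega>) v j u)" if "u \<in> {0..s}" for u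
      using that by (intro factors_matrix_vector_mult factors_killed_A Suc.IH) auto
    show "set_integrable lborel {0..s} (\<lambda>u. killed_A k u \<omega> *v picard (\<lambda>s. killed_A k s \<omega>) v j u)"
      if "\<omega> \<in> space M" for k \<omega>
      using killed_A_measurable[OF that] a_nonneg killed_A_bound[OF that] Suc.prems
      by (rule picard_norm_le(2))
  qed
  from factors_compose[OF this, where f="\<lambda>u. v + u"] show ?case by simp
qed

text \<open>Two limits are taken: of the Picard iterates at the fixed time \<open>l\<close>, then as
  \<open>l\<close> tends to infinity. The second sequence is eventually constant because the killed
  solution stops at the cycle length; \<open>l\<close> is unbounded because the bound
  \<open>C\<close> on that length holds only almost surely.\<close>

lemma factors_cycle_matrix_mult: "factors (\<lambda>k \<omega>. cycle_matrix \<Phi> R k \<omega> *v v)"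
proof (rule factors_lim)
  show "factors (\<lambda>k \<omega>. \<Phi> \<omega> (renewal R k \<omega>) (renewal R k \<omega> + min (real l) (R (Suc k) \<omega>)) *v v)" for l
  proof (rule factors_lim[OF factors_picard[of "real l" v]])
    show "(\<lambda>j. picard (\<lambda>s. killed_A k s \<omega>) v j (real l)) \<longlonglongrightarrow>
        \<Phi> \<omega> (renewal R k \<omega>) (renewal R k \<omega> + min (real l) (R (Suc k) \<omega>)) *v v"
      if "\<omega> \<in> space M" for k \<omega>
      using killed_A_measurable[OF that] a_nonneg killed_A_bound[OF that] killed_solution[OF that]
      by (rule picard_tendsto) simp
  qed simp
  show "(\<lambda>l. \<Phi> \<omega> (renewal R k \<omega>) (renewal R k \<omega> + min (real l) (R (Suc k) \<omega>)) *v v) \<longlonglongrightarrow>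
      cycle_matrix \<Phi> R k \<omega> *v v" for k \<omega>
  proof (rule tendsto_eventually)
    have "\<forall>\<^sub>F l in sequentially. R (Suc k) \<omega> \<le> real l"
      using eventually_ge_at_top[of "nat \<lceil>R (Suc k) \<omega>\<rceil>"] by eventually_elim linarith
    then show "\<forall>\<^sub>F l in sequentially. \<Phi> \<omega> (renewal R k \<omega>)
        (renewal R k \<omega> + min (real l) (R (Suc k) \<omega>)) *v v = cycle_matrix \<Phi> R k \<omega> *v v"
      by eventually_elim (simp add: cycle_matrix_def renewal_Suc min_absorb2)
  qed
qed

lemma factors_cycle_matrix: "factors (cycle_matrix \<Phi> R)"
proof (intro factors_vecI)
  fix i j
  have "factors (\<lambda>k \<omega>. (cycle_matrix \<Phi> R k \<omega> *v axis j 1) $ i)"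
    by (rule factors_compose[OF factors_cycle_matrix_mult, where f="\<lambda>v. v $ i"]) simp
  then show "factors (\<lambda>k \<omega>. cycle_matrix \<Phi> R k \<omega> $ i $ j)"
    by (simp add: matrix_vector_mult_basis column_def)
qed

text \<open>Serves to exchange expectation and time integral. The indicator is there because
  \<open>trajectories\<close> says nothing about negative times.\<close>

lemma x_joint_measurable:
  "(\<lambda>(t, \<omega>). indicator {0..} t *\<^sub>R x x0 t \<omega>) \<in> borel_measurable (borel \<Otimes>\<^sub>M M)"
proof -
  define B where "B s \<omega> = (if 0 \<le> s then A (\<sigma> (max 0 s) \<omega>) else 0)" for s \<omega>
  have [measurable]: "(\<lambda>p. A (\<sigma> (max 0 (fst p)) (snd p))) \<in> borel_measurable (borel \<Otimes>\<^sub>M M)"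
    by (rule A_measurable_comp) auto
  have B: "(\<lambda>(s, \<omega>). B s \<omega>) \<in> borel_measurable (borel \<Otimes>\<^sub>M M)"
    unfolding B_def case_prod_beta' by measurable
  note [measurable] = picard_joint_measurable[OF B, of x0]
  show ?thesis
  proof (rule borel_measurable_LIMSEQ_metric)
    show "(\<lambda>(t, \<omega>). indicator {0..} t *\<^sub>R picard (\<lambda>s. B s \<omega>) x0 j t) \<in> borel_measurable (borel \<Otimes>\<^sub>M M)" for j
      using picard_joint_measurable[OF B, of x0 j] by (simp add: case_prod_beta')
    fix p assume "p \<in> space (borel \<Otimes>\<^sub>M M :: (real \<times> 'w) measure)"
    then obtain t \<omega> where p: "p = (t, \<omega>)" and \<omega>: "\<omega> \<in> space M" by (auto simp: space_pair_measure)
    have "ode_solution (\<lambda>s v. B s \<omega> *v v) 0 x0 (\<lambda>t. x x0 t \<omega>)"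
    proof -
      have "set_integrable lborel {0..t} (\<lambda>s. B s \<omega> *v x x0 s \<omega>) =
          set_integrable lborel {0..t} (\<lambda>s. A (\<sigma> s \<omega>) *v x x0 s \<omega>)" for t
        by (rule set_integrable_cong) (auto simp: B_def)
      moreover have "(LINT s:{0..t}|lborel. B s \<omega> *v x x0 s \<omega>) =
          (LINT s:{0..t}|lborel. A (\<sigma> s \<omega>) *v x x0 s \<omega>)" for t
        by (rule set_lebesgue_integral_cong) (auto simp: B_def)
      ultimately show ?thesis
        using x_solution[OF \<omega>, of x0] unfolding ode_solution_def by (simp only:)
    qed
    moreover have "(\<lambda>s. B s \<omega>) \<in> borel_measurable borel"
      using measurable_joint[OF B, of "\<lambda>s. s" borel "\<lambda>_. \<omega>"] \<omega> by simp
    moreover have "norm (B s \<omega> *v v) \<le> a * norm v" for s v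
      using A_bound[of s \<omega> v] \<omega> a_nonneg by (auto simp: B_def)
    ultimately have "(\<lambda>j. picard (\<lambda>s. B s \<omega>) x0 j t) \<longlonglongrightarrow> x x0 t \<omega>" if "0 \<le> t"
      using that a_nonneg by (intro picard_tendsto)
    then show "(\<lambda>j. (\<lambda>(t, \<omega>). indicator {0..} t *\<^sub>R picard (\<lambda>s. B s \<omega>) x0 j t) p) \<longlonglongrightarrow>
        (\<lambda>(t, \<omega>). indicator {0..} t *\<^sub>R x x0 t \<omega>) p"
      unfolding p by (cases "0 \<le> t") auto
  qed
qed

lemma x_measurable:
  assumes "0 \<le> t"
  shows "x x0 t \<in> borel_measurable M"
  using measurable_joint[OF x_joint_measurable, of "\<lambda>_. t" M "\<lambda>\<omega>. \<omega>" x0] assms by simp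

end

section \<open>Moments at the renewal epochs\<close>

text \<open>The state after \<open>k\<close> cycles as a function of the sequence \<open>y\<close>
  of cycles, where \<open>g\<close> yields the matrix of a cycle. In this form it visibly depends on
  the first \<open>k\<close> cycles only.\<close>

primrec history :: "('b \<Rightarrow> real^'n^'n) \<Rightarrow> real^'n \<Rightarrow> nat \<Rightarrow> (nat \<Rightarrow> 'b) \<Rightarrow> real^'n" where
  "history g x0 0 y = x0"
| "history g x0 (Suc k) y = g (y k) *v history g x0 k y"

lemma history_cong: "(\<And>i. i < k \<Longrightarrow> y i = z i) \<Longrightarrow> history g x0 k y = history g x0 k z"
  by (induction k) auto

lemma history_measurable:
  assumes g: "g \<in> borel_measurable K" and "{..<k} \<subseteq> J"
  shows "history g x0 k \<in> borel_measurable (PiM J (\<lambda>_. K))"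
  using assms(2)
proof (induction k)
  case (Suc k)
  have [measurable]: "(\<lambda>y. g (y k)) \<in> borel_measurable (PiM J (\<lambda>_. K))"
    by (rule measurable_compose[where N=K and f="\<lambda>y. y k", OF measurable_component_singleton g])
      (use Suc.prems in auto)
  have [measurable]: "history g x0 k \<in> borel_measurable (PiM J (\<lambda>_. K))"
    by (rule Suc.IH) (use Suc.prems in auto)
  show ?case by simp
qed (simp add: history.simps(1)[abs_def])

context regenerative_system
begin

section \<open>States at the renewal epochs: recursion, bounds and independence\<close>

definition state :: "real^'n::{finite,linorder} \<Rightarrow> nat \<Rightarrow> 'w \<Rightarrow> real^'n::{finite,linorder}" where
  "state x0 k \<omega> = x x0 (renewal R k \<omega>) \<omega>"

lemma state_0: "\<omega> \<in> space M \<Longrightarrow> state x0 0 \<omega> = x0"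
  unfolding state_def renewal_0 by (rule ode_solution_initial[OF x_solution])

lemma state_Suc:
  assumes "\<omega> \<in> space M"
  shows "state x0 (Suc k) \<omega> = cycle_matrix \<Phi> R k \<omega> *v state x0 k \<omega>"
  unfolding state_def cycle_matrix_def
  using x_restart[OF assms renewal_nonneg[OF assms] less_imp_le[OF renewal_less_Suc[OF assms]]] .

lemma cycle_matrix_measurable [measurable]: "cycle_matrix \<Phi> R k \<in> borel_measurable M"
  by (rule factors_measurable[OF factors_cycle_matrix])

lemma state_measurable [measurable]: "state x0 k \<in> borel_measurable M"
proof (induction k)
  case 0
  show ?case using state_0[of _ x0] by (simp cong: measurable_cong)
next
  case (Suc k)
  then have "(\<lambda>\<omega>. cycle_matrix \<Phi> R k \<omega> *v state x0 k \<omega>) \<in> borel_measurable M" by measurable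
  then show ?case using state_Suc[of _ x0 k] by (simp cong: measurable_cong)
qed

lemma state_norm_le:
  assumes \<omega>: "\<omega> \<in> space M" and "R (Suc k) \<omega> \<le> C"
    and "renewal R k \<omega> \<le> t" "t \<le> renewal R (Suc k) \<omega>"
  shows "norm (x x0 t \<omega>) \<le> norm (state x0 k \<omega>) * exp (a * C)"
    and "norm (state x0 k \<omega>) \<le> norm (x x0 t \<omega>) * exp (a * C)"
proof -
  note x = x_norm_le[OF \<omega> renewal_nonneg[OF \<omega>] assms(3), of x0, folded state_def]
  have "exp (a * (t - renewal R k \<omega>)) \<le> exp (a * C)"
    using assms(2,4) a_nonneg by (auto simp: renewal_Suc intro: mult_left_mono)
  from mult_left_mono[OF this] show
    "norm (x x0 t \<omega>) \<le> norm (state x0 k \<omega>) * exp (a * C)"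
    "norm (state x0 k \<omega>) \<le> norm (x x0 t \<omega>) * exp (a * C)"
    using x by (meson norm_ge_zero order_trans)+
qed

lemma cycle_matrix_norm_le: "AE \<omega> in M. \<forall>v. norm (cycle_matrix \<Phi> R k \<omega> *v v) \<le> exp (a * C) * norm v"
  using R_le[of k]
proof (rule AE_mp, intro AE_I2 impI allI)
  fix \<omega> v assume \<omega>: "\<omega> \<in> space M" and R: "R (Suc k) \<omega> \<le> C"
  note Z = renewal_nonneg[OF \<omega>, of k]
  note sol = \<Phi>_solution[OF \<omega> Z, of v]
  have bound: "norm (A (\<sigma> u \<omega>) *v v) \<le> a * norm v" if "renewal R k \<omega> \<le> u" for u v
    using order_trans[OF Z that] \<omega> by (rule A_bound)
  have "norm (cycle_matrix \<Phi> R k \<omega> *v v) \<le> norm v * exp (a * R (Suc k) \<omega>)"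
    using ode_solution_norm_le(1)[OF sol order.refl less_imp_le[OF renewal_less_Suc[OF \<omega>]] a_nonneg bound]
    unfolding ode_solution_initial[OF sol] cycle_matrix_def renewal_Suc by simp
  also have "\<dots> \<le> norm v * exp (a * C)"
    using R a_nonneg by (intro mult_left_mono) (auto intro: mult_left_mono)
  finally show "norm (cycle_matrix \<Phi> R k \<omega> *v v) \<le> exp (a * C) * norm v"
    by (simp add: mult.commute)
qed

lemma state_bounded: "AE \<omega> in M. norm (state x0 k \<omega>) \<le> exp (a * C) ^ k * norm x0"
proof (induction k)
  case (Suc k)
  from AE_space cycle_matrix_norm_le[of k] Suc show ?case
  proof eventually_elim
    case (elim \<omega>)
    have "norm (state x0 (Suc k) \<omega>) \<le> exp (a * C) * norm (state x0 k \<omega>)"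
      unfolding state_Suc[OF elim(1)] using elim(2) by blast
    also have "\<dots> \<le> exp (a * C) * (exp (a * C) ^ k * norm x0)"
      using elim(3) by (rule mult_left_mono) simp
    finally show ?case by simp
  qed
qed (auto simp: state_0 intro!: AE_I2)

lemma expectation_cycle:
  fixes h :: "_ \<Rightarrow> real"
  assumes [measurable]: "h \<in> borel_measurable (cycle_space N)"
  shows "expectation (\<lambda>\<omega>. h (nth_cycle \<sigma> R k \<omega>)) = expectation (\<lambda>\<omega>. h (nth_cycle \<sigma> R 0 \<omega>))"
  using arg_cong[OF c_distr[of k], of "\<lambda>L. integral\<^sup>L L h"] by (simp add: integral_distr)

text \<open>Applied both to the entries of the lifted cycle matrices and to the cycle lengths.
  Independence holds between the representatives, which are functions of cycle \<open>k\<close> and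
  of the cycles before it; the product rule is then carried back along almost sure equality.\<close>

lemma expectation_cycle_state:
  fixes f :: "real^'n::{finite,linorder} \<Rightarrow> real" and X :: "nat \<Rightarrow> 'w \<Rightarrow> real"
  assumes f [measurable]: "f \<in> borel_measurable borel" and X: "factors X"
    and int: "integrable M (X k)" "integrable M (\<lambda>\<omega>. f (state x0 k \<omega>))"
  shows "integrable M (\<lambda>\<omega>. X k \<omega> * f (state x0 k \<omega>))"
    and "expectation (\<lambda>\<omega>. X k \<omega> * f (state x0 k \<omega>)) =
      expectation (X 0) * expectation (\<lambda>\<omega>. f (state x0 k \<omega>))"
proof -
  obtain h where h [measurable]: "h \<in> borel_measurable (cycle_space N)"
    and Xh: "\<And>k. AE \<omega> in M. X k \<omega> = h (nth_cycle \<sigma> R k \<omega>)"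
    using X by (rule factorsE) blast
  obtain g where g [measurable]: "g \<in> borel_measurable (cycle_space N)"
    and Mg: "\<And>k. AE \<omega> in M. cycle_matrix \<Phi> R k \<omega> = g (nth_cycle \<sigma> R k \<omega>)"
    using factors_cycle_matrix by (rule factorsE) blast
  note [measurable] = factors_measurable[OF X]
  let ?H = "\<lambda>k \<omega>. history g x0 k (\<lambda>i. nth_cycle \<sigma> R i \<omega>)"
  have H: "AE \<omega> in M. state x0 k \<omega> = ?H k \<omega>" for k
  proof (induction k)
    case (Suc k)
    from AE_space Suc Mg[of k] show ?case
      by eventually_elim (simp add: state_Suc)
  qed (auto simp: state_0 intro!: AE_I2)
  have h1: "(\<lambda>y. h (y k)) \<in> borel_measurable (PiM {k} (\<lambda>_. cycle_space N))"
    by (rule measurable_compose[where f="\<lambda>y. y k", OF measurable_component_singleton h]) simp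
  have h2: "(\<lambda>y. f (history g x0 k y)) \<in> borel_measurable (PiM {..<k} (\<lambda>_. cycle_space N))"
    by (rule measurable_compose[OF history_measurable[OF g order.refl] f])
  have "indep_var borel ((\<lambda>y. h (y k)) \<circ> (\<lambda>\<omega>. restrict (\<lambda>i. nth_cycle \<sigma> R i \<omega>) {k}))
      borel ((\<lambda>y. f (history g x0 k y)) \<circ> (\<lambda>\<omega>. restrict (\<lambda>i. nth_cycle \<sigma> R i \<omega>) {..<k}))"
    by (rule indep_var_compose[OF indep_var_restrict[OF nth_cycle_props(1)] h1 h2]) auto
  moreover have "history g x0 k (restrict (\<lambda>i. nth_cycle \<sigma> R i \<omega>) {..<k}) = ?H k \<omega>" for \<omega>
    by (rule history_cong) simp
  ultimately have indep: "indep_var borel (\<lambda>\<omega>. h (nth_cycle \<sigma> R k \<omega>)) borel (\<lambda>\<omega>. f (?H k \<omega>))"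
    by (simp add: comp_def)
  have fH_meas [measurable]: "(\<lambda>\<omega>. f (?H k \<omega>)) \<in> borel_measurable M"
    using indep_var_rv2[OF indep] .
  have fH: "AE \<omega> in M. f (state x0 k \<omega>) = f (?H k \<omega>)"
    using H[of k] by eventually_elim simp
  have i1: "integrable M (\<lambda>\<omega>. h (nth_cycle \<sigma> R k \<omega>))"
    by (rule integrable_cong_AE_imp[OF int(1)]) (measurable, use Xh[of k] in eventually_elim, simp)
  have i2: "integrable M (\<lambda>\<omega>. f (?H k \<omega>))"
    by (rule integrable_cong_AE_imp[OF int(2) fH_meas fH])
  have ae: "AE \<omega> in M. X k \<omega> * f (state x0 k \<omega>) = h (nth_cycle \<sigma> R k \<omega>) * f (?H k \<omega>)"
    using Xh[of k] fH by eventually_elim simp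
  then have ae': "AE \<omega> in M. h (nth_cycle \<sigma> R k \<omega>) * f (?H k \<omega>) = X k \<omega> * f (state x0 k \<omega>)"
    by eventually_elim simp
  show "integrable M (\<lambda>\<omega>. X k \<omega> * f (state x0 k \<omega>))"
    by (rule integrable_cong_AE_imp[OF indep_var_integrable[OF indep i1 i2] _ ae']) measurable
  have "expectation (\<lambda>\<omega>. X k \<omega> * f (state x0 k \<omega>)) =
      expectation (\<lambda>\<omega>. h (nth_cycle \<sigma> R k \<omega>) * f (?H k \<omega>))"
    by (rule integral_cong_AE[OF _ _ ae]) measurable
  also have "\<dots> = expectation (\<lambda>\<omega>. h (nth_cycle \<sigma> R k \<omega>)) * expectation (\<lambda>\<omega>. f (?H k \<omega>))"
    by (rule indep_var_lebesgue_integral[OF indep i1 i2])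
  also have "expectation (\<lambda>\<omega>. f (?H k \<omega>)) = expectation (\<lambda>\<omega>. f (state x0 k \<omega>))"
    by (rule integral_cong_AE[symmetric, OF _ _ fH]) measurable
  also have "expectation (\<lambda>\<omega>. h (nth_cycle \<sigma> R k \<omega>)) = expectation (X 0)"
    unfolding expectation_cycle[OF h, of k] by (rule integral_cong_AE[symmetric, OF _ _ Xh]) measurable
  finally show "expectation (\<lambda>\<omega>. X k \<omega> * f (state x0 k \<omega>)) =
      expectation (X 0) * expectation (\<lambda>\<omega>. f (state x0 k \<omega>))" .
qed

lemma lift_entry_state_integrable:
  assumes i: "i < lift_dim CARD('n) m"
  shows "integrable M (\<lambda>\<omega>. lift_entry m i (state x0 k \<omega>))"
proof -
  obtain L where L: "0 < L" "\<And>i (y :: real^'n::{finite,linorder}).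
    i < lift_dim CARD('n) m \<Longrightarrow> \<bar>lift_entry m i y\<bar> \<le> L * norm y ^ m"
    by (rule lift_entry_bound[where 'n='n and m=m]) blast
  show ?thesis
  proof (rule integrable_const_bound)
    show "AE \<omega> in M. norm (lift_entry m i (state x0 k \<omega>)) \<le> L * (exp (a * C) ^ k * norm x0) ^ m"
      using state_bounded[of x0 k]
    proof eventually_elim
      case (elim \<omega>)
      then have "L * norm (state x0 k \<omega>) ^ m \<le> L * (exp (a * C) ^ k * norm x0) ^ m"
        using L(1) by (intro mult_left_mono power_mono) auto
      with L(2)[OF i, of "state x0 k \<omega>"] show ?case unfolding real_norm_def by (rule order_trans)
    qed
    show "(\<lambda>\<omega>. lift_entry m i (state x0 k \<omega>)) \<in> borel_measurable M"
      by (rule measurable_compose[OF state_measurable borel_measurable_lift_entry[OF i]])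
  qed
qed

lemma state_norm_integrable: "integrable M (\<lambda>\<omega>. norm (state x0 k \<omega>) ^ m)"
proof (rule integrable_const_bound)
  show "AE \<omega> in M. norm (norm (state x0 k \<omega>) ^ m) \<le> (exp (a * C) ^ k * norm x0) ^ m"
    using state_bounded[of x0 k] by eventually_elim (simp add: power_mono)
qed measurable

section \<open>The linear recursion for the mean of the lifted state\<close>

definition mean_lift :: "nat \<Rightarrow> real Matrix.mat" where
  "mean_lift m = expectation_mat M (lift_dim CARD('n) m) (lift_dim CARD('n) m)
     (\<lambda>\<omega>. lift_mat m (cycle_matrix \<Phi> R 0 \<omega>))"

lemma mean_lift_carrier: "mean_lift m \<in> carrier_mat (lift_dim CARD('n) m) (lift_dim CARD('n) m)"
  by (simp add: mean_lift_def expectation_mat_def)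

lemma expectation_lift_step:
  assumes i: "i < lift_dim CARD('n) m"
  shows "expectation (\<lambda>\<omega>. lift_entry m i (state x0 (Suc k) \<omega>)) =
    (\<Sum>j<lift_dim CARD('n) m. mean_lift m $$ (i, j) * expectation (\<lambda>\<omega>. lift_entry m j (state x0 k \<omega>)))"
proof -
  let ?L = "\<lambda>j k \<omega>. lift_mat m (cycle_matrix \<Phi> R k \<omega>) $$ (i, j)"
  have fac: "factors (?L j)" if "j < lift_dim CARD('n) m" for j
    using factors_compose[OF factors_cycle_matrix borel_measurable_lift_mat_entry[OF i that]] .
  have int: "integrable M (?L j k)" if j: "j < lift_dim CARD('n) m" for j
  proof -
    obtain L where L: "\<And>i j (A :: real^'n::{finite,linorder}^'n::{finite,linorder}) b.
      i < lift_dim CARD('n) m \<Longrightarrow> j < lift_dim CARD('n) m \<Longrightarrow> (\<And>v. norm (A *v v) \<le> b * norm v) \<Longrightarrow>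
      \<bar>lift_mat m A $$ (i, j)\<bar> \<le> L * b ^ m"
      by (rule lift_mat_entry_bound[where 'n='n and m=m]) blast
    show ?thesis
    proof (rule integrable_const_bound)
      show "AE \<omega> in M. norm (?L j k \<omega>) \<le> L * exp (a * C) ^ m"
        using cycle_matrix_norm_le[of k]
        by eventually_elim (unfold real_norm_def, rule L[OF i j], blast)
      show "?L j k \<in> borel_measurable M" by (rule factors_measurable[OF fac[OF j]])
    qed
  qed
  have prod: "integrable M (\<lambda>\<omega>. ?L j k \<omega> * lift_entry m j (state x0 k \<omega>))"
      "expectation (\<lambda>\<omega>. ?L j k \<omega> * lift_entry m j (state x0 k \<omega>)) =
        expectation (?L j 0) * expectation (\<lambda>\<omega>. lift_entry m j (state x0 k \<omega>))"
    if j: "j < lift_dim CARD('n) m" for j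
    by (rule expectation_cycle_state[OF borel_measurable_lift_entry[OF j] fac[OF j] int[OF j]
          lift_entry_state_integrable[OF j]])+
  have "expectation (\<lambda>\<omega>. lift_entry m i (state x0 (Suc k) \<omega>)) =
      expectation (\<lambda>\<omega>. \<Sum>j<lift_dim CARD('n) m. ?L j k \<omega> * lift_entry m j (state x0 k \<omega>))"
    by (intro Bochner_Integration.integral_cong refl) (simp add: state_Suc lift_entry_mult[OF i])
  also have "\<dots> = (\<Sum>j<lift_dim CARD('n) m. expectation (\<lambda>\<omega>. ?L j k \<omega> * lift_entry m j (state x0 k \<omega>)))"
    by (rule Bochner_Integration.integral_sum) (simp add: prod(1))
  also have "\<dots> = (\<Sum>j<lift_dim CARD('n) m. mean_lift m $$ (i, j) *
      expectation (\<lambda>\<omega>. lift_entry m j (state x0 k \<omega>)))"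
  proof (rule sum.cong[OF refl])
    fix j assume "j \<in> {..<lift_dim CARD('n) m}"
    then have j: "j < lift_dim CARD('n) m" by simp
    show "expectation (\<lambda>\<omega>. ?L j k \<omega> * lift_entry m j (state x0 k \<omega>)) =
        mean_lift m $$ (i, j) * expectation (\<lambda>\<omega>. lift_entry m j (state x0 k \<omega>))"
      unfolding prod(2)[OF j] using i j by (simp add: mean_lift_def expectation_mat_def)
  qed
  finally show ?thesis .
qed

lemma expectation_lift:
  assumes i: "i < lift_dim CARD('n) m"
  shows "expectation (\<lambda>\<omega>. lift_entry m i (state x0 k \<omega>)) =
    (\<Sum>j<lift_dim CARD('n) m. (mean_lift m ^\<^sub>m k) $$ (i, j) * lift_entry m j x0)"
proof -
  have "expectation (\<lambda>\<omega>. lift_entry m j (state x0 0 \<omega>)) = expectation (\<lambda>\<omega>. lift_entry m j x0)" for j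
    by (intro Bochner_Integration.integral_cong refl) (simp only: state_0)
  then have w0: "expectation (\<lambda>\<omega>. lift_entry m j (state x0 0 \<omega>)) = lift_entry m j x0" for j
    by (simp add: prob_space)
  show ?thesis
    using pow_mat_iterate[where w="\<lambda>k i. expectation (\<lambda>\<omega>. lift_entry m i (state x0 k \<omega>))",
        OF mean_lift_carrier expectation_lift_step i, where k=k]
    unfolding w0 .
qed

end

section \<open>Stability\<close>

lemma exponentially_imp_stochastically_mean_stable:
  assumes "exponentially_mean_stable M m x"
  shows "stochastically_mean_stable M m x"
  unfolding stochastically_mean_stable_def
proof
  fix x0
  let ?E = "\<lambda>t. prob_space.expectation M (\<lambda>\<omega>. norm (x x0 t \<omega>) ^ m)"
  obtain \<alpha> \<beta> where "0 < \<alpha>" and \<beta>: "0 < \<beta>"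
    and int: "\<And>t. 0 \<le> t \<Longrightarrow> integrable M (\<lambda>\<omega>. norm (x x0 t \<omega>) ^ m)"
    and le: "\<And>t. 0 \<le> t \<Longrightarrow> ?E t \<le> \<alpha> * exp (- \<beta> * t) * norm x0 ^ m"
    using assms unfolding exponentially_mean_stable_def by blast
  define D where "D = \<alpha> * norm x0 ^ m"
  have D: "0 \<le> D" using \<open>0 < \<alpha>\<close> by (simp add: D_def)
  have "(\<integral>\<^sup>+t\<in>{0..}. ennreal (?E t) \<partial>lborel) \<le> (\<integral>\<^sup>+t\<in>{0..}. ennreal (D * exp (- \<beta> * t)) \<partial>lborel)"
  proof (rule nn_integral_mono)
    fix t :: real
    show "ennreal (?E t) * indicator {0..} t \<le> ennreal (D * exp (- \<beta> * t)) * indicator {0..} t"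
      using le[of t] by (auto simp: D_def mult_ac indicator_def intro!: ennreal_leI split: if_splits)
  qed
  also have "\<dots> = ennreal (0 - (- (D / \<beta>) * exp (- \<beta> * 0)))"
  proof (rule nn_integral_FTC_atLeast)
    show "DERIV (\<lambda>t. - (D / \<beta>) * exp (- \<beta> * t)) t :> D * exp (- \<beta> * t)" for t
      using \<beta> by (auto intro!: derivative_eq_intros)
    show "((\<lambda>t. - (D / \<beta>) * exp (- \<beta> * t)) \<longlongrightarrow> 0) at_top"
      using \<beta> by real_asymp
  qed (use D in auto)
  also have "\<dots> < \<infinity>" by simp
  finally show "(\<forall>t\<ge>0. integrable M (\<lambda>\<omega>. norm (x x0 t \<omega>) ^ m)) \<and>
      (\<integral>\<^sup>+t\<in>{0..}. ennreal (?E t) \<partial>lborel) < \<infinity>"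
    using int by blast
qed

text \<open>Serves to treat a general initial state as the difference of two nonnegative
  ones.\<close>

lemma norm_diff_power_le:
  fixes u v :: "'a::real_normed_vector"
  shows "norm (u - v) ^ m \<le> 2 ^ m * (norm u ^ m + norm v ^ m)"
proof -
  have "norm (u - v) ^ m \<le> (2 * max (norm u) (norm v)) ^ m"
    using norm_triangle_ineq4[of u v] by (intro power_mono) auto
  also have "\<dots> \<le> 2 ^ m * (norm u ^ m + norm v ^ m)"
    unfolding power_mult_distrib by (intro mult_left_mono) (auto simp: max_def)
  finally show ?thesis .
qed

context regenerative_system
begin

section \<open>From stochastic stability to Schur stability\<close>

lemma AE_R_le: "AE \<omega> in M. \<forall>k. R (Suc k) \<omega> \<le> C"
  using R_le by (simp add: AE_all_countable)

lemma renewal_le: "(\<And>k. R (Suc k) \<omega> \<le> C) \<Longrightarrow> renewal R k \<omega> \<le> real k * C"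
proof (induction k)
  case (Suc k)
  then show ?case using add_mono[OF Suc.IH[OF Suc.prems] Suc.prems[of k]]
    by (simp add: renewal_Suc algebra_simps)
qed simp

lemma factors_R: "factors (\<lambda>k. R (Suc k))"
  by (rule factorsI[where g=snd]) (auto simp: snd_nth_cycle)

lemma R_integrable: "integrable M (R (Suc k))"
proof (rule integrable_const_bound)
  show "AE \<omega> in M. norm (R (Suc k) \<omega>) \<le> C"
    using AE_space R_le[of k] by eventually_elim (use R_pos in \<open>simp add: less_imp_le\<close>)
qed simp

text \<open>Strict positivity matters: this factor is divided out of the series that stochastic
  stability bounds.\<close>

lemma expectation_R_pos: "0 < expectation (R (Suc 0))"
proof -
  have "expectation (R (Suc 0)) \<noteq> 0"
  proof
    assume "expectation (R (Suc 0)) = 0"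
    moreover have "AE \<omega> in M. 0 \<le> R (Suc 0) \<omega>"
      by (intro AE_I2 less_imp_le R_pos)
    ultimately have "AE \<omega> in M. R (Suc 0) \<omega> = 0"
      using integral_nonneg_eq_0_iff_AE[OF R_integrable[of 0]] by simp
    with AE_space have "AE \<omega> in M. False"
      by eventually_elim (use R_pos[of _ 0] in force)
    then show False by simp
  qed
  moreover have "0 \<le> expectation (R (Suc 0))"
    by (intro integral_nonneg_AE AE_I2 less_imp_le R_pos)
  ultimately show ?thesis by simp
qed

lemma disjoint_cycles:
  assumes \<omega>: "\<omega> \<in> space M"
  shows "disjoint_family (\<lambda>k. {renewal R k \<omega>..<renewal R (Suc k) \<omega>})"
proof -
  have mono: "renewal R i \<omega> \<le> renewal R j \<omega>" if "i \<le> j" for i j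
    using that by (rule lift_Suc_mono_le[rotated]) (rule less_imp_le[OF renewal_less_Suc[OF \<omega>]])
  have "{renewal R i \<omega>..<renewal R (Suc i) \<omega>} \<inter> {renewal R j \<omega>..<renewal R (Suc j) \<omega>} = {}"
    if "i < j" for i j
    using mono[of "Suc i" j] that by auto
  then show ?thesis
    unfolding disjoint_family_on_def by (metis Int_commute nat_neq_iff)
qed

lemma state_moment_tendsto_0:
  assumes stable: "stochastically_mean_stable M m x"
  shows "(\<lambda>k. expectation (\<lambda>\<omega>. norm (state x0 k \<omega>) ^ m)) \<longlonglongrightarrow> 0"
proof -
  define F where "F t \<omega> = ennreal (norm (x x0 t \<omega>) ^ m) * indicator {0..} t" for t \<omega>
  \<comment> \<open>Within a cycle of length at most \<open>C\<close> the norm shrinks at most by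
    the factor \<open>exp (- (a * C))\<close>; \<open>c\<close> is the m-th power of that
    factor.\<close>
  define c where "c = exp (- (a * C)) ^ m"
  have c: "0 < c" by (simp add: c_def)
  have F_eq: "F t \<omega> = ennreal (norm (indicator {0..} t *\<^sub>R x x0 t \<omega>) ^ m) * indicator {0..} t" for t \<omega>
    by (auto simp: F_def indicator_def)
  note x_joint_measurable[of x0, measurable]
  have F [measurable]: "(\<lambda>(t, \<omega>). F t \<omega>) \<in> borel_measurable (lborel \<Otimes>\<^sub>M M)"
  proof -
    have [measurable]: "(\<lambda>p. indicator {0..} (fst p) *\<^sub>R x x0 (fst p) (snd p)) \<in> borel_measurable (lborel \<Otimes>\<^sub>M M)"
      by (rule measurable_joint[OF x_joint_measurable]) auto
    show ?thesis unfolding F_eq case_prod_beta' by measurable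
  qed
  interpret P: pair_sigma_finite lborel M
    by (intro pair_sigma_finite.intro sigma_finite_lborel sigma_finite_measure_axioms)
  have term_le: "ennreal (c * (R (Suc k) \<omega> * norm (state x0 k \<omega>) ^ m))
      \<le> (\<integral>\<^sup>+t. F t \<omega> * indicator {renewal R k \<omega>..<renewal R (Suc k) \<omega>} t \<partial>lborel)"
    if \<omega>: "\<omega> \<in> space M" and R: "\<And>k. R (Suc k) \<omega> \<le> C" for k \<omega>
  proof -
    have "ennreal (c * norm (state x0 k \<omega>) ^ m) * indicator {renewal R k \<omega>..<renewal R (Suc k) \<omega>} t
        \<le> F t \<omega> * indicator {renewal R k \<omega>..<renewal R (Suc k) \<omega>} t" for t
    proof (cases "t \<in> {renewal R k \<omega>..<renewal R (Suc k) \<omega>}")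
      case True
      have "exp (- (a * C)) * norm (state x0 k \<omega>) \<le> norm (x x0 t \<omega>)"
        using state_norm_le(2)[OF \<omega> R[of k], where t=t and ?x0.0=x0] True by (simp add: exp_minus field_simps)
      then have "(exp (- (a * C)) * norm (state x0 k \<omega>)) ^ m \<le> norm (x x0 t \<omega>) ^ m"
        by (intro power_mono) auto
      moreover have "0 \<le> t" using renewal_nonneg[OF \<omega>, of k] True by simp
      ultimately show ?thesis
        by (auto simp: F_def c_def power_mult_distrib indicator_def intro!: ennreal_leI)
    qed simp
    then have "(\<integral>\<^sup>+t. ennreal (c * norm (state x0 k \<omega>) ^ m) *
          indicator {renewal R k \<omega>..<renewal R (Suc k) \<omega>} t \<partial>lborel)
        \<le> (\<integral>\<^sup>+t. F t \<omega> * indicator {renewal R k \<omega>..<renewal R (Suc k) \<omega>} t \<partial>lborel)"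
      by (rule nn_integral_mono)
    moreover have "(\<integral>\<^sup>+t. ennreal (c * norm (state x0 k \<omega>) ^ m) *
          indicator {renewal R k \<omega>..<renewal R (Suc k) \<omega>} t \<partial>lborel)
        = ennreal (c * (R (Suc k) \<omega> * norm (state x0 k \<omega>) ^ m))"
      using R_pos[OF \<omega>, of k] c
      by (simp add: nn_integral_cmult_indicator renewal_Suc ennreal_mult[symmetric] mult_ac)
    ultimately show ?thesis by simp
  qed
  have sum_le: "(\<Sum>k. ennreal (c * (R (Suc k) \<omega> * norm (state x0 k \<omega>) ^ m))) \<le> (\<integral>\<^sup>+t. F t \<omega> \<partial>lborel)"
    if \<omega>: "\<omega> \<in> space M" and R: "\<And>k. R (Suc k) \<omega> \<le> C" for \<omega>
  proof -
    let ?I = "\<lambda>k. {renewal R k \<omega>..<renewal R (Suc k) \<omega>}"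
    have [measurable]: "(\<lambda>t. F t \<omega>) \<in> borel_measurable lborel"
      using measurable_Pair1[OF F \<omega>] by simp
    have "(\<Sum>k. ennreal (c * (R (Suc k) \<omega> * norm (state x0 k \<omega>) ^ m)))
        \<le> (\<Sum>k. \<integral>\<^sup>+t. F t \<omega> * indicator (?I k) t \<partial>lborel)"
      by (intro suminf_le term_le[OF that]) auto
    also have "\<dots> = (\<integral>\<^sup>+t. (\<Sum>k. F t \<omega> * indicator (?I k) t) \<partial>lborel)"
      by (rule nn_integral_suminf[symmetric]) measurable
    \<comment> \<open>The cycles are disjoint but might not fill the half-line, hence an
      inequality.\<close>
    also have "\<dots> \<le> (\<integral>\<^sup>+t. F t \<omega> \<partial>lborel)"
      using suminf_indicator[OF disjoint_cycles[OF \<omega>]]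
      by (intro nn_integral_mono) (auto simp: indicator_def split: if_splits)
    finally show ?thesis .
  qed
  have int: "integrable M (\<lambda>\<omega>. R (Suc k) \<omega> * norm (state x0 k \<omega>) ^ m)"
    and ind: "expectation (\<lambda>\<omega>. R (Suc k) \<omega> * norm (state x0 k \<omega>) ^ m) =
      expectation (R (Suc 0)) * expectation (\<lambda>\<omega>. norm (state x0 k \<omega>) ^ m)" for k
    by (rule expectation_cycle_state[OF _ factors_R R_integrable state_norm_integrable]; measurable)+
  \<comment> \<open>By independence \<open>e k\<close> is the expectation of the lower bound
    \<open>term_le\<close> for the k-th cycle. Its series is dominated by the time integral of the
    moments, so \<open>e\<close> tends to 0.\<close>
  define e where "e k = c * (expectation (R (Suc 0)) * expectation (\<lambda>\<omega>. norm (state x0 k \<omega>) ^ m))" for k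
  have "(\<Sum>k. ennreal (e k)) = (\<Sum>k. \<integral>\<^sup>+\<omega>. ennreal (c * (R (Suc k) \<omega> * norm (state x0 k \<omega>) ^ m)) \<partial>M)"
  proof (rule suminf_cong)
    fix k
    have "(\<integral>\<^sup>+\<omega>. ennreal (c * (R (Suc k) \<omega> * norm (state x0 k \<omega>) ^ m)) \<partial>M) =
        ennreal (expectation (\<lambda>\<omega>. c * (R (Suc k) \<omega> * norm (state x0 k \<omega>) ^ m)))"
    proof (rule nn_integral_eq_integral[OF integrable_mult_right[OF int]], rule AE_I2)
      show "0 \<le> c * (R (Suc k) \<omega> * norm (state x0 k \<omega>) ^ m)" if "\<omega> \<in> space M" for \<omega>
        using c R_pos[OF that, of k] by simp
    qed
    then show "ennreal (e k) = (\<integral>\<^sup>+\<omega>. ennreal (c * (R (Suc k) \<omega> * norm (state x0 k \<omega>) ^ m)) \<partial>M)"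
      by (simp add: e_def ind)
  qed
  also have "\<dots> = (\<integral>\<^sup>+\<omega>. (\<Sum>k. ennreal (c * (R (Suc k) \<omega> * norm (state x0 k \<omega>) ^ m))) \<partial>M)"
    by (rule nn_integral_suminf[symmetric]) measurable
  also have "\<dots> \<le> (\<integral>\<^sup>+\<omega>. \<integral>\<^sup>+t. F t \<omega> \<partial>lborel \<partial>M)"
    by (rule nn_integral_mono_AE) (use AE_space AE_R_le in \<open>eventually_elim, use sum_le in blast\<close>)
  also have "\<dots> = (\<integral>\<^sup>+t. \<integral>\<^sup>+\<omega>. F t \<omega> \<partial>M \<partial>lborel)"
    by (rule P.Fubini'[OF F])
  also have "\<dots> = (\<integral>\<^sup>+t\<in>{0..}. ennreal (expectation (\<lambda>\<omega>. norm (x x0 t \<omega>) ^ m)) \<partial>lborel)"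
  proof (rule nn_integral_cong)
    fix t :: real
    have "(\<integral>\<^sup>+\<omega>. ennreal (norm (x x0 t \<omega>) ^ m) \<partial>M) = ennreal (expectation (\<lambda>\<omega>. norm (x x0 t \<omega>) ^ m))"
      if "0 \<le> t"
      using stable that unfolding stochastically_mean_stable_def
      by (intro nn_integral_eq_integral) auto
    then show "(\<integral>\<^sup>+\<omega>. F t \<omega> \<partial>M) = ennreal (expectation (\<lambda>\<omega>. norm (x x0 t \<omega>) ^ m)) * indicator {0..} t"
      by (cases "0 \<le> t") (simp_all add: F_def)
  qed
  also have "\<dots> < \<infinity>"
    using stable unfolding stochastically_mean_stable_def by blast
  finally have "(\<Sum>k. ennreal (e k)) \<noteq> Orderings.top" by simp
  moreover have "0 \<le> e k" for k
  proof -
    have "0 \<le> expectation (\<lambda>\<omega>. norm (state x0 k \<omega>) ^ m)" by (rule integral_nonneg_AE) simp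
    then show ?thesis using c expectation_R_pos by (simp add: e_def)
  qed
  ultimately have "summable e" by (intro summable_suminf_not_top)
  then have "e \<longlonglongrightarrow> 0" by (rule summable_LIMSEQ_zero)
  from tendsto_mult_left[OF this, of "inverse (c * expectation (R (Suc 0)))"] show ?thesis
    using c expectation_R_pos by (simp add: e_def field_simps)
qed

lemma stochastically_stable_imp_schur:
  assumes stable: "stochastically_mean_stable M m x"
  shows "schur_stable (mean_lift m)"
proof (rule schur_stable_if_pow_tendsto_0[OF mean_lift_carrier])
  let ?N = "lift_dim CARD('n) m"
  show "0 < ?N" by (simp add: lift_dim_pos)
  obtain L where L: "0 < L" "\<And>i (y :: real^'n::{finite,linorder}).
      i < ?N \<Longrightarrow> \<bar>lift_entry m i y\<bar> \<le> L * norm y ^ m"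
    by (rule lift_entry_bound[where 'n='n and m=m]) blast
  \<comment> \<open>The sum is an entry of the mean lifted state, which is dominated by the moment
    of the norm.\<close>
  have lim: "(\<lambda>k. \<Sum>j<?N. (mean_lift m ^\<^sub>m k) $$ (i, j) * lift_entry m j x0) \<longlonglongrightarrow> 0"
    if i: "i < ?N" for i and x0 :: "real^'n::{finite,linorder}"
    unfolding expectation_lift[OF i, symmetric]
  proof (rule Lim_null_comparison)
    show "\<forall>\<^sub>F k in sequentially. norm (expectation (\<lambda>\<omega>. lift_entry m i (state x0 k \<omega>)))
        \<le> L * expectation (\<lambda>\<omega>. norm (state x0 k \<omega>) ^ m)"
    proof (intro always_eventually allI)
      fix k
      have "norm (expectation (\<lambda>\<omega>. lift_entry m i (state x0 k \<omega>)))
          \<le> expectation (\<lambda>\<omega>. L * norm (state x0 k \<omega>) ^ m)"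
        using L(2)[OF i] lift_entry_state_integrable[OF i] state_norm_integrable
        by (intro order_trans[OF integral_norm_bound] integral_mono) auto
      then show "norm (expectation (\<lambda>\<omega>. lift_entry m i (state x0 k \<omega>)))
          \<le> L * expectation (\<lambda>\<omega>. norm (state x0 k \<omega>) ^ m)" by simp
    qed
    show "(\<lambda>k. L * expectation (\<lambda>\<omega>. norm (state x0 k \<omega>) ^ m)) \<longlonglongrightarrow> 0"
      using tendsto_mult_left[OF state_moment_tendsto_0[OF stable, of x0], of L] by simp
  qed
  obtain I :: "(nat \<Rightarrow> nat) set" and p :: "(nat \<Rightarrow> nat) \<Rightarrow> real^'n::{finite,linorder}" and d where
    dual: "\<And>i j. i < ?N \<Longrightarrow> j < ?N \<Longrightarrow>
      (\<Sum>q\<in>I. d j q * lift_entry m i (p q)) = (if i = j then 1 else 0)"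
    by (rule lift_dual[where 'n='n and m=m]) blast
  fix i j assume i: "i < ?N" and j: "j < ?N"
  \<comment> \<open>The dual functional with index \<open>j\<close>, applied along the points
    \<open>p q\<close>, isolates the entry \<open>(i, j)\<close> of the matrix power.\<close>
  have "(\<lambda>k. \<Sum>q\<in>I. d j q * (\<Sum>l<?N. (mean_lift m ^\<^sub>m k) $$ (i, l) * lift_entry m l (p q)))
      \<longlonglongrightarrow> (\<Sum>q\<in>I. d j q * 0)"
    by (intro tendsto_sum tendsto_mult tendsto_const lim i)
  moreover have "(\<Sum>q\<in>I. d j q * (\<Sum>l<?N. B l * lift_entry m l (p q))) = B j" for B
  proof -
    have "(\<Sum>q\<in>I. d j q * (\<Sum>l<?N. B l * lift_entry m l (p q)))
        = (\<Sum>l<?N. B l * (\<Sum>q\<in>I. d j q * lift_entry m l (p q)))"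
      by (simp add: sum_distrib_left sum.swap[of _ I] mult_ac)
    also have "\<dots> = (\<Sum>l<?N. if l = j then B l else 0)"
      using dual j by (intro sum.cong) auto
    finally show ?thesis using j by simp
  qed
  ultimately show "(\<lambda>k. (mean_lift m ^\<^sub>m k) $$ (i, j)) \<longlonglongrightarrow> 0" by simp
qed

section \<open>From Schur stability to exponential stability\<close>

lemma state_diff:
  assumes "\<omega> \<in> space M"
  shows "state (y - z) k \<omega> = state y k \<omega> - state z k \<omega>"
  by (induction k)
    (simp_all add: state_0[OF assms] state_Suc[OF assms] matrix_vector_mult_diff_distrib)

text \<open>The decay of the matrix powers, expressed for polynomials and uniformly in the initial
  state. An upper bound suffices, since \<open>f\<close> will be equal to the m-th power of the norm
  or almost surely above it.\<close>

lemma homogeneous_moment_decay: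
  fixes f :: "real^'n::{finite,linorder} \<Rightarrow> real"
  assumes schur: "schur_stable (mean_lift m)" and f: "homogeneous m f"
  obtains \<rho> K where "0 < \<rho>" "\<rho> < 1" "0 \<le> K"
    "\<And>x0 k. expectation (\<lambda>\<omega>. f (state x0 k \<omega>)) \<le> K * \<rho> ^ k * norm x0 ^ m"
    "\<And>x0 k. integrable M (\<lambda>\<omega>. f (state x0 k \<omega>))"
proof -
  let ?N = "lift_dim CARD('n) m"
  have N: "0 < ?N" by (simp add: lift_dim_pos)
  obtain \<rho> K where \<rho>: "0 < \<rho>" "\<rho> < 1" and K: "0 \<le> K"
    and B: "\<And>k i j. i < ?N \<Longrightarrow> j < ?N \<Longrightarrow> \<bar>(mean_lift m ^\<^sub>m k) $$ (i, j)\<bar> \<le> K * \<rho> ^ k"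
    by (rule schur_stable_pow_bound[OF mean_lift_carrier N schur]) blast
  obtain L where L: "0 < L" "\<And>i (y :: real^'n::{finite,linorder}).
      i < ?N \<Longrightarrow> \<bar>lift_entry m i y\<bar> \<le> L * norm y ^ m"
    by (rule lift_entry_bound[where 'n='n and m=m]) blast
  obtain c where c: "\<And>y. f y = (\<Sum>i<?N. c i * lift_entry m i y)"
    using f unfolding homogeneous_def by blast
  define D where "D = (\<Sum>i<?N. \<bar>c i\<bar> * (\<Sum>j<?N. K * L))"
  show ?thesis
  proof (rule that[OF \<rho>])
    show "0 \<le> D" unfolding D_def using K L(1) by (intro sum_nonneg mult_nonneg_nonneg) auto
    show "integrable M (\<lambda>\<omega>. f (state x0 k \<omega>))" for x0 k
      unfolding c by (intro Bochner_Integration.integrable_sum integrable_mult_right lift_entry_state_integrable) simp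
    fix x0 k
    have "expectation (\<lambda>\<omega>. f (state x0 k \<omega>))
        = (\<Sum>i<?N. c i * expectation (\<lambda>\<omega>. lift_entry m i (state x0 k \<omega>)))"
      unfolding c
      by (simp add: Bochner_Integration.integral_sum integrable_mult_right lift_entry_state_integrable)
    also have "\<dots> \<le> (\<Sum>i<?N. \<bar>c i\<bar> * (\<Sum>j<?N. K * L) * (\<rho> ^ k * norm x0 ^ m))"
    proof (rule sum_mono)
      fix i assume "i \<in> {..<?N}"
      then have i: "i < ?N" by simp
      have "\<bar>expectation (\<lambda>\<omega>. lift_entry m i (state x0 k \<omega>))\<bar>
          \<le> (\<Sum>j<?N. \<bar>(mean_lift m ^\<^sub>m k) $$ (i, j)\<bar> * \<bar>lift_entry m j x0\<bar>)"
        unfolding expectation_lift[OF i] abs_mult[symmetric] by (rule sum_abs)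
      also have "\<dots> \<le> (\<Sum>j<?N. (K * \<rho> ^ k) * (L * norm x0 ^ m))"
        by (rule sum_mono, rule mult_mono[OF B[OF i] L(2)]) (use K \<rho>(1) in auto)
      also have "\<dots> = (\<Sum>j<?N. K * L) * (\<rho> ^ k * norm x0 ^ m)"
        by (simp add: mult_ac)
      finally have "\<bar>c i\<bar> * \<bar>expectation (\<lambda>\<omega>. lift_entry m i (state x0 k \<omega>))\<bar>
          \<le> \<bar>c i\<bar> * ((\<Sum>j<?N. K * L) * (\<rho> ^ k * norm x0 ^ m))"
        by (rule mult_left_mono) simp
      then show "c i * expectation (\<lambda>\<omega>. lift_entry m i (state x0 k \<omega>))
          \<le> \<bar>c i\<bar> * (\<Sum>j<?N. K * L) * (\<rho> ^ k * norm x0 ^ m)"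
        unfolding abs_mult[symmetric] mult.assoc by linarith
    qed
    also have "\<dots> = D * \<rho> ^ k * norm x0 ^ m"
      unfolding D_def sum_distrib_right[symmetric] mult.assoc ..
    finally show "expectation (\<lambda>\<omega>. f (state x0 k \<omega>)) \<le> D * \<rho> ^ k * norm x0 ^ m" .
  qed
qed

text \<open>Positivity is given at each fixed time, outside a null set depending on that time,
  whereas the epoch is random. The null sets of all rational times have a null union, and continuity
  of the path reaches every other time.\<close>

lemma positive_state:
  assumes pos: "positive_system M x" and x0: "\<And>i. 0 \<le> x0 $ i"
  shows "AE \<omega> in M. \<forall>i. 0 \<le> state x0 k \<omega> $ i"
proof -
  have "AE \<omega> in M. 0 \<le> q \<longrightarrow> (\<forall>i. 0 \<le> x x0 q \<omega> $ i)" for q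
    using pos x0 unfolding positive_system_def by (cases "0 \<le> q") auto
  then have "AE \<omega> in M. \<forall>q\<in>\<rat>. 0 \<le> q \<longrightarrow> (\<forall>i. 0 \<le> x x0 q \<omega> $ i)"
    by (subst AE_ball_countable[OF countable_rat]) blast
  with AE_space show ?thesis
  proof eventually_elim
    case (elim \<omega>)
    show ?case
    proof (intro allI)
      fix i
      define t where "t = renewal R k \<omega>"
      have t: "0 \<le> t" unfolding t_def by (rule renewal_nonneg[OF elim(1)])
      have cont: "continuous_on {0..t + 1} (\<lambda>s. x x0 s \<omega> $ i)"
        by (intro continuous_intros ode_solution_continuous[OF x_solution[OF elim(1)]])
      show "0 \<le> state x0 k \<omega> $ i"
      proof (rule ccontr)
        assume "\<not> 0 \<le> state x0 k \<omega> $ i"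
        then have neg: "x x0 t \<omega> $ i < 0" by (simp add: state_def t_def)
        obtain \<delta> where \<delta>: "0 < \<delta>" and near: "\<And>s. s \<in> {0..t + 1} \<Longrightarrow> dist s t < \<delta> \<Longrightarrow>
            dist (x x0 s \<omega> $ i) (x x0 t \<omega> $ i) < - (x x0 t \<omega> $ i)"
        proof -
          have "t \<in> {0..t + 1}" "0 < - (x x0 t \<omega> $ i)" using t neg by auto
          with cont show ?thesis using that unfolding continuous_on_iff by blast
        qed
        \<comment> \<open>To the right of \<open>t\<close>, so that \<open>q\<close> is nonnegative,
          and before \<open>t + 1\<close>, so that \<open>q\<close> stays in the interval on which
          continuity was stated.\<close>
        obtain q where q: "q \<in> \<rat>" "t < q" "q < t + min \<delta> 1"
          using Rats_dense_in_real[of t "t + min \<delta> 1"] \<delta> by auto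
        then have "dist (x x0 q \<omega> $ i) (x x0 t \<omega> $ i) < - (x x0 t \<omega> $ i)"
          using t by (intro near) (auto simp: dist_real_def)
        then have "x x0 q \<omega> $ i < 0" by (auto simp: dist_real_def)
        moreover have "0 \<le> x x0 q \<omega> $ i" using elim(2) q(1,2) t by simp
        ultimately show False by simp
      qed
    qed
  qed
qed

lemma norm_moment_decay:
  assumes schur: "schur_stable (mean_lift m)" and A1: "even m \<or> positive_system M x"
  obtains \<rho> K where "0 < \<rho>" "\<rho> < 1" "0 < K"
    "\<And>x0 k. expectation (\<lambda>\<omega>. norm (state x0 k \<omega>) ^ m) \<le> K * \<rho> ^ k * norm x0 ^ m"
proof (cases "even m")
  case True
  then obtain q where "m = 2 * q" by (elim evenE)
  then have "homogeneous m (\<lambda>y :: real^'n::{finite,linorder}. norm y ^ m)"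
    using homogeneous_norm_power[of q] by simp
  then obtain \<rho> K where *: "0 < \<rho>" "\<rho> < 1" "0 \<le> K"
    "\<And>x0 k. expectation (\<lambda>\<omega>. norm (state x0 k \<omega>) ^ m) \<le> K * \<rho> ^ k * norm x0 ^ m"
    by (rule homogeneous_moment_decay[OF schur]) blast
  \<comment> \<open>\<open>K + 1\<close> replaces \<open>K\<close> because a strictly positive
    constant is claimed.\<close>
  show ?thesis
  proof (rule that[of \<rho> "K + 1"])
    fix x0 :: "real^'n::{finite,linorder}" and k
    have "K * \<rho> ^ k * norm x0 ^ m \<le> (K + 1) * \<rho> ^ k * norm x0 ^ m"
      using *(1) by (intro mult_right_mono) auto
    with *(4)[of x0 k] show "expectation (\<lambda>\<omega>. norm (state x0 k \<omega>) ^ m) \<le> (K + 1) * \<rho> ^ k * norm x0 ^ m"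
      by (rule order_trans)
  qed (use *(1-3) in auto)
next
  case False
  with A1 have pos: "positive_system M x" by simp
  let ?f = "\<lambda>y :: real^'n::{finite,linorder}. inner (\<chi> i. 1) y ^ m"
  have "homogeneous m ?f"
    using homogeneous_mult_linear_power[OF homogeneous_one, of m "\<chi> i. 1"] by simp
  then obtain \<rho> K where \<rho>: "0 < \<rho>" "\<rho> < 1" and K: "0 \<le> K"
    and le: "\<And>x0 k. expectation (\<lambda>\<omega>. ?f (state x0 k \<omega>)) \<le> K * \<rho> ^ k * norm x0 ^ m"
    and int: "\<And>x0 k. integrable M (\<lambda>\<omega>. ?f (state x0 k \<omega>))"
    by (rule homogeneous_moment_decay[OF schur]) blast
  have nonneg: "expectation (\<lambda>\<omega>. norm (state x0 k \<omega>) ^ m) \<le> K * \<rho> ^ k * norm x0 ^ m"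
    if x0: "\<And>i. 0 \<le> x0 $ i" for x0 k
  proof -
    have "AE \<omega> in M. norm (state x0 k \<omega>) ^ m \<le> ?f (state x0 k \<omega>)"
      using positive_state[OF pos x0, of k]
    proof eventually_elim
      case (elim \<omega>)
      have "norm (state x0 k \<omega>) \<le> (\<Sum>i\<in>UNIV. \<bar>state x0 k \<omega> $ i\<bar>)" by (rule norm_le_l1_cart)
      also have "\<dots> = inner (\<chi> i. 1) (state x0 k \<omega>)"
        using elim by (simp add: inner_vec_def)
      finally show ?case by (intro power_mono) auto
    qed
    then have "expectation (\<lambda>\<omega>. norm (state x0 k \<omega>) ^ m) \<le> expectation (\<lambda>\<omega>. ?f (state x0 k \<omega>))"
      by (rule integral_mono_AE[OF state_norm_integrable int])
    with le[of x0 k] show ?thesis by (rule order_trans[rotated])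
  qed
  \<comment> \<open>Splitting the initial state costs the factor \<open>2 ^ m\<close> and two
    summands \<open>K\<close>; the added 1 ensures strict positivity.\<close>
  show ?thesis
  proof (rule that[OF \<rho>, of "2 ^ m * (2 * K) + 1"])
    show "0 < 2 ^ m * (2 * K) + 1" using K by (intro add_nonneg_pos) auto
    fix x0 :: "real^'n::{finite,linorder}" and k
    define y z :: "real^'n::{finite,linorder}" where "y = (\<chi> i. max 0 (x0 $ i))" and "z = (\<chi> i. max 0 (- x0 $ i))"
    have yz: "x0 = y - z"
      unfolding y_def z_def Finite_Cartesian_Product.vec_eq_iff by (auto simp: max_def)
    have "norm y \<le> norm x0" "norm z \<le> norm x0"
      by (rule norm_le_componentwise_cart, auto simp: y_def z_def max_def)+
    then have "norm y ^ m \<le> norm x0 ^ m" "norm z ^ m \<le> norm x0 ^ m"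
      by (auto intro: power_mono)
    then have b: "K * \<rho> ^ k * norm y ^ m \<le> K * \<rho> ^ k * norm x0 ^ m"
        "K * \<rho> ^ k * norm z ^ m \<le> K * \<rho> ^ k * norm x0 ^ m"
      using K \<rho>(1) by (auto intro: mult_left_mono)
    have "expectation (\<lambda>\<omega>. norm (state x0 k \<omega>) ^ m) \<le>
        expectation (\<lambda>\<omega>. 2 ^ m * (norm (state y k \<omega>) ^ m + norm (state z k \<omega>) ^ m))"
      by (intro integral_mono state_norm_integrable integrable_mult_right Bochner_Integration.integrable_add)
        (simp add: yz state_diff norm_diff_power_le)
    also have "\<dots> = 2 ^ m * (expectation (\<lambda>\<omega>. norm (state y k \<omega>) ^ m) + expectation (\<lambda>\<omega>. norm (state z k \<omega>) ^ m))"
      by (simp add: Bochner_Integration.integral_add state_norm_integrable)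
    also have "\<dots> \<le> 2 ^ m * (K * \<rho> ^ k * norm x0 ^ m + K * \<rho> ^ k * norm x0 ^ m)"
      using nonneg[of y k] nonneg[of z k] b by (intro mult_left_mono add_mono) (auto simp: y_def z_def)
    also have "\<dots> \<le> (2 ^ m * (2 * K) + 1) * \<rho> ^ k * norm x0 ^ m"
      using \<rho>(1) by (simp add: algebra_simps)
    finally show "expectation (\<lambda>\<omega>. norm (state x0 k \<omega>) ^ m) \<le> (2 ^ m * (2 * K) + 1) * \<rho> ^ k * norm x0 ^ m" .
  qed
qed

text \<open>The index of the cycle that contains \<open>t\<close> is random and may depend on the
  states. Summing over all indices that can occur replaces it by deterministic ones, and the
  geometric decay of the moments pays for the sum.\<close>

lemma x_norm_le_suminf:
  assumes \<omega>: "\<omega> \<in> space M" and R: "\<And>k. R (Suc k) \<omega> \<le> C" and m: "0 < m" and t: "0 \<le> t"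
  shows "ennreal (norm (x x0 t \<omega>) ^ m) \<le>
    (\<Sum>j. ennreal (exp (a * C) ^ m * norm (state x0 (j + nat \<lfloor>t / C\<rfloor>) \<omega>) ^ m))"
  (is "_ \<le> (\<Sum>j. ?g j)")
proof (cases "\<exists>k. renewal R k \<omega> \<le> t \<and> t < renewal R (Suc k) \<omega>")
  case True
  let ?p = "nat \<lfloor>t / C\<rfloor>"
  from True obtain k where k: "renewal R k \<omega> \<le> t" "t < renewal R (Suc k) \<omega>" by blast
  \<comment> \<open>Cycle \<open>k\<close> ends at epoch \<open>k + 1\<close>, hence the bound with
    \<open>Suc k\<close>; since the inequality is strict, rounding down \<open>t / C\<close> gives
    at most \<open>k\<close>.\<close>
  have "t < real (Suc k) * C"
    by (rule less_le_trans[OF k(2) renewal_le[OF R]])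
  then have "t / C < real (Suc k)" using C_pos by (simp add: divide_less_eq)
  then have "\<lfloor>t / C\<rfloor> < int (Suc k)" by linarith
  then have le: "nat \<lfloor>t / C\<rfloor> \<le> k" by linarith
  have "norm (x x0 t \<omega>) ^ m \<le> (norm (state x0 k \<omega>) * exp (a * C)) ^ m"
    by (rule power_mono[OF state_norm_le(1)[OF \<omega> R k(1) less_imp_le[OF k(2)]]]) simp
  also have "\<dots> = exp (a * C) ^ m * norm (state x0 (k - ?p + ?p) \<omega>) ^ m"
    unfolding le_add_diff_inverse2[OF le] power_mult_distrib by (rule mult.commute)
  finally have "ennreal (norm (x x0 t \<omega>) ^ m) \<le> ?g (k - ?p)"
    by (rule ennreal_leI)
  also have "\<dots> \<le> (\<Sum>j. ?g j)"
  proof -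
    have "sum ?g {k - ?p} \<le> suminf ?g" by (rule sum_le_suminf) (rule summableI, simp_all)
    then show ?thesis by (simp only: sum.insert finite.emptyI empty_iff not_False_eq_True sum.empty add_0_right)
  qed
  finally show ?thesis .
next
  case False
  \<comment> \<open>The renewal epochs accumulate before time \<open>t\<close>; then the right-hand side is infinite.\<close>
  have le: "renewal R k \<omega> \<le> t" for k
  proof (induction k)
    case (Suc k)
    moreover from this have "\<not> t < renewal R (Suc k) \<omega>" using False by blast
    ultimately show ?case by simp
  qed (simp add: t)
  \<comment> \<open>All epochs lie at or before \<open>t\<close>, so the states at them stay away
    from 0 unless \<open>x0 = 0\<close>, and the terms of the series cannot tend to 0.\<close>
  have low: "norm x0 * exp (- (a * t)) \<le> norm (state x0 k \<omega>)" for k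
  proof -
    have "norm x0 \<le> norm (state x0 k \<omega>) * exp (a * renewal R k \<omega>)"
      using x_norm_le(2)[OF \<omega> order.refl renewal_nonneg[OF \<omega>, of k], of x0]
        ode_solution_initial[OF x_solution[OF \<omega>, of x0]]
      by (simp add: state_def)
    also have "\<dots> \<le> norm (state x0 k \<omega>) * exp (a * t)"
      using le[of k] a_nonneg by (intro mult_left_mono) (auto intro: mult_left_mono)
    finally have "norm x0 * exp (- (a * t)) \<le> norm (state x0 k \<omega>) * exp (a * t) * exp (- (a * t))"
      by (rule mult_right_mono) simp
    then show ?thesis by (simp add: mult.assoc exp_add[symmetric])
  qed
  show ?thesis
  proof (cases "x0 = 0")
    case True
    have "norm (x x0 t \<omega>) \<le> norm x0 * exp (a * t)"
      using x_norm_le(1)[OF \<omega> order.refl t, of x0] ode_solution_initial[OF x_solution[OF \<omega>, of x0]]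
      by simp
    \<comment> \<open>Here \<open>0 < m\<close> matters: the left-hand side is
      \<open>0 ^ m\<close>.\<close>
    then show ?thesis using True m by (simp add: zero_power)
  next
    case False
    let ?f = "\<lambda>j. exp (a * C) ^ m * norm (state x0 (j + nat \<lfloor>t / C\<rfloor>) \<omega>) ^ m"
    define \<delta> where "\<delta> = exp (a * C) ^ m * (norm x0 * exp (- (a * t))) ^ m"
    have \<delta>: "0 < \<delta>" using False by (simp add: \<delta>_def)
    have \<delta>_le: "\<delta> \<le> ?f j" for j
      unfolding \<delta>_def by (intro mult_left_mono power_mono low) auto
    have "(\<Sum>j. ennreal (?f j)) = \<infinity>"
    proof (rule ccontr)
      assume "(\<Sum>j. ennreal (?f j)) \<noteq> \<infinity>"
      then have "summable ?f" by (intro summable_suminf_not_top) auto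
      then have "?f \<longlonglongrightarrow> 0" by (rule summable_LIMSEQ_zero)
      then have "\<delta> \<le> 0" by (rule LIMSEQ_le_const) (intro exI allI impI \<delta>_le)
      with \<delta> show False by simp
    qed
    then show ?thesis by simp
  qed
qed

lemma x_norm_integrable:
  assumes t: "0 \<le> t"
  shows "integrable M (\<lambda>\<omega>. norm (x x0 t \<omega>) ^ m)"
proof (rule integrable_const_bound)
  note [measurable] = x_measurable[OF t]
  show "(\<lambda>\<omega>. norm (x x0 t \<omega>) ^ m) \<in> borel_measurable M" by measurable
  show "AE \<omega> in M. norm (norm (x x0 t \<omega>) ^ m) \<le> (norm x0 * exp (a * t)) ^ m"
  proof (rule AE_I2)
    fix \<omega> assume \<omega>: "\<omega> \<in> space M"
    have "norm (x x0 t \<omega>) \<le> norm x0 * exp (a * t)"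
      using x_norm_le(1)[OF \<omega> order.refl t, of x0] ode_solution_initial[OF x_solution[OF \<omega>, of x0]]
      by simp
    then show "norm (norm (x x0 t \<omega>) ^ m) \<le> (norm x0 * exp (a * t)) ^ m"
      by (simp add: power_mono)
  qed
qed

lemma schur_imp_exponentially_stable:
  assumes schur: "schur_stable (mean_lift m)" and A1: "even m \<or> positive_system M x" and m: "0 < m"
  shows "exponentially_mean_stable M m x"
proof -
  obtain \<rho> K where \<rho>: "0 < \<rho>" "\<rho> < 1" and K: "0 < K"
    and decay: "\<And>x0 k. expectation (\<lambda>\<omega>. norm (state x0 k \<omega>) ^ m) \<le> K * \<rho> ^ k * norm x0 ^ m"
    by (rule norm_moment_decay[OF schur A1]) blast
  \<comment> \<open>Growth within one cycle, times the constant of the decay, times the sum of the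
    geometric series.\<close>
  define D where "D = exp (a * C) ^ m * K / (1 - \<rho>)"
  have D: "0 < D" using K \<rho> by (simp add: D_def)
  have bound: "expectation (\<lambda>\<omega>. norm (x x0 t \<omega>) ^ m) \<le> D * \<rho> ^ nat \<lfloor>t / C\<rfloor> * norm x0 ^ m"
    if t: "0 \<le> t" for x0 t
  proof -
    let ?p = "nat \<lfloor>t / C\<rfloor>" and ?c = "exp (a * C) ^ m"
    have "ennreal (expectation (\<lambda>\<omega>. norm (x x0 t \<omega>) ^ m)) = (\<integral>\<^sup>+\<omega>. ennreal (norm (x x0 t \<omega>) ^ m) \<partial>M)"
      by (rule nn_integral_eq_integral[symmetric, OF x_norm_integrable[OF t]]) simp
    also have "\<dots> \<le> (\<integral>\<^sup>+\<omega>. (\<Sum>j. ennreal (?c * norm (state x0 (j + ?p) \<omega>) ^ m)) \<partial>M)"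
    proof (rule nn_integral_mono_AE)
      show "AE \<omega> in M. ennreal (norm (x x0 t \<omega>) ^ m) \<le>
          (\<Sum>j. ennreal (?c * norm (state x0 (j + ?p) \<omega>) ^ m))"
        using AE_space AE_R_le
      proof eventually_elim
        case (elim \<omega>)
        show ?case by (rule x_norm_le_suminf[OF elim(1) spec[OF elim(2)] m t])
      qed
    qed
    also have "\<dots> = (\<Sum>j. \<integral>\<^sup>+\<omega>. ennreal (?c * norm (state x0 (j + ?p) \<omega>) ^ m) \<partial>M)"
      by (rule nn_integral_suminf) measurable
    also have "\<dots> \<le> (\<Sum>j. ennreal (?c * (K * \<rho> ^ (j + ?p) * norm x0 ^ m)))"
    proof (rule suminf_le)
      fix j
      have "(\<integral>\<^sup>+\<omega>. ennreal (?c * norm (state x0 (j + ?p) \<omega>) ^ m) \<partial>M) =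
          ennreal (expectation (\<lambda>\<omega>. ?c * norm (state x0 (j + ?p) \<omega>) ^ m))"
        by (rule nn_integral_eq_integral[OF integrable_mult_right[OF state_norm_integrable]]) simp
      also have "\<dots> = ennreal (?c * expectation (\<lambda>\<omega>. norm (state x0 (j + ?p) \<omega>) ^ m))" by simp
      also have "\<dots> \<le> ennreal (?c * (K * \<rho> ^ (j + ?p) * norm x0 ^ m))"
        by (intro ennreal_leI mult_left_mono decay) simp
      finally show "(\<integral>\<^sup>+\<omega>. ennreal (?c * norm (state x0 (j + ?p) \<omega>) ^ m) \<partial>M)
          \<le> ennreal (?c * (K * \<rho> ^ (j + ?p) * norm x0 ^ m))" .
    qed auto
    also have "\<dots> = ennreal (D * \<rho> ^ ?p * norm x0 ^ m)"
    proof (rule suminf_ennreal_eq)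
      have "(\<lambda>j. (?c * K * \<rho> ^ ?p * norm x0 ^ m) * \<rho> ^ j) sums
          ((?c * K * \<rho> ^ ?p * norm x0 ^ m) * (1 / (1 - \<rho>)))"
        by (intro sums_mult geometric_sums) (use \<rho> in simp)
      then show "(\<lambda>j. ?c * (K * \<rho> ^ (j + ?p) * norm x0 ^ m)) sums (D * \<rho> ^ ?p * norm x0 ^ m)"
        by (simp add: D_def power_add mult_ac)
    qed (use K \<rho> in simp)
    finally show ?thesis
      using D \<rho>(1) by (subst (asm) ennreal_le_iff) auto
  qed
  \<comment> \<open>Chosen so that \<open>exp (- \<beta> * C) = \<rho>\<close>: time
    \<open>C\<close>, the longest possible cycle, corresponds to one factor
    \<open>\<rho>\<close>.\<close>
  define \<beta> where "\<beta> = - ln \<rho> / C"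
  have \<beta>: "0 < \<beta>" using \<rho> C_pos by (simp add: \<beta>_def divide_neg_pos)
  \<comment> \<open>Rounding down loses less than one unit in the exponent, which costs at most the
    factor \<open>1 / \<rho>\<close>.\<close>
  have rate: "\<rho> ^ nat \<lfloor>t / C\<rfloor> \<le> exp (- \<beta> * t) / \<rho>" if t: "0 \<le> t" for t
  proof -
    have "t / C - 1 \<le> real (nat \<lfloor>t / C\<rfloor>)" by linarith
    then have "real (nat \<lfloor>t / C\<rfloor>) * ln \<rho> \<le> (t / C - 1) * ln \<rho>"
      using \<rho> by (intro mult_right_mono_neg) auto
    then have "exp (real (nat \<lfloor>t / C\<rfloor>) * ln \<rho>) \<le> exp ((t / C - 1) * ln \<rho>)" by simp
    also have "\<dots> = exp (- \<beta> * t) / exp (ln \<rho>)"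
    proof -
      have e: "(t / C - 1) * ln \<rho> = - \<beta> * t - ln \<rho>"
        by (simp add: \<beta>_def left_diff_distrib)
      show ?thesis unfolding e exp_diff ..
    qed
    finally show ?thesis unfolding exp_of_nat_mult exp_ln[OF \<rho>(1)] .
  qed
  show ?thesis
    unfolding exponentially_mean_stable_def
  proof (intro exI conjI allI impI)
    show "0 < D / \<rho>" "0 < \<beta>" using D \<rho> \<beta> by simp_all
    fix x0 and t :: real assume t: "0 \<le> t"
    show "integrable M (\<lambda>\<omega>. norm (x x0 t \<omega>) ^ m)" by (rule x_norm_integrable[OF t])
    have "D * \<rho> ^ nat \<lfloor>t / C\<rfloor> * norm x0 ^ m \<le> D * (exp (- \<beta> * t) / \<rho>) * norm x0 ^ m"
      using D rate[OF t] by (intro mult_right_mono mult_left_mono) auto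
    with bound[OF t, of x0]
    show "expectation (\<lambda>\<omega>. norm (x x0 t \<omega>) ^ m) \<le> D / \<rho> * exp (- \<beta> * t) * norm x0 ^ m"
      by simp
  qed
qed

end

theorem theorem7:
  fixes M :: "'w measure" and N :: "'s measure"
    and \<sigma> :: "real \<Rightarrow> 'w \<Rightarrow> 's"
    and R :: "nat \<Rightarrow> 'w \<Rightarrow> real"
    and A :: "'s \<Rightarrow> real^'n::{finite,linorder}^'n::{finite,linorder}"
    and x :: "real^'n::{finite,linorder} \<Rightarrow> real \<Rightarrow> 'w \<Rightarrow> real^'n::{finite,linorder}"
    and \<Phi> :: "'w \<Rightarrow> real \<Rightarrow> real \<Rightarrow> real^'n::{finite,linorder}^'n::{finite,linorder}"
    and m :: nat
  assumes "prob_space M"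
    and "0 < m"
    and "regenerative_process M N \<sigma> R"
    and "A \<in> borel_measurable N"
    and "(\<lambda>(t, \<omega>). A (\<sigma> t \<omega>)) \<in> borel_measurable (restrict_space borel {0..} \<Otimes>\<^sub>M M)"
    and "trajectories M \<sigma> A x"
    and "transition_matrices M \<sigma> A \<Phi>"
    and A1: "even m \<or> positive_system M x"
    and A2: "\<exists>C. AE \<omega> in M. \<bar>R 1 \<omega>\<bar> \<le> C"
    and A3: "bounded (A ` space N)"
  shows "(exponentially_mean_stable M m x \<longleftrightarrow> stochastically_mean_stable M m x) \<and>
         (stochastically_mean_stable M m x \<longleftrightarrow>
          schur_stable (expectation_mat M (lift_dim CARD('n) m) (lift_dim CARD('n) m)
            (\<lambda>\<omega>. lift_mat m (cycle_matrix \<Phi> R 0 \<omega>))))"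
proof -
  obtain C where C: "AE \<omega> in M. \<bar>R 1 \<omega>\<bar> \<le> C" using A2 by blast
  obtain b where b: "\<And>s. s \<in> space N \<Longrightarrow> norm (A s) \<le> b"
    using A3 unfolding bounded_iff by blast
  \<comment> \<open>The factor \<open>CARD('n)\<close> comes from the crude estimate of
    \<open>A s *v v\<close> by the norm of \<open>A s\<close>; the maximum keeps \<open>a\<close>
    nonnegative. In the same way \<open>max 1 C\<close> below is a positive bound on the cycle
    length.\<close>
  define a where "a = real CARD('n) * max 0 b"
  interpret regenerative_system M N \<sigma> R A x \<Phi> a "max 1 C"
  proof (intro regenerative_system.intro regenerative_system_axioms.intro)
    show "prob_space M" "regenerative_process M N \<sigma> R" "A \<in> borel_measurable N"
      "(\<lambda>(t, \<omega>). A (\<sigma> t \<omega>)) \<in> borel_measurable (restrict_space borel {0..} \<Otimes>\<^sub>M M)"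
      "trajectories M \<sigma> A x" "transition_matrices M \<sigma> A \<Phi>"
      by (rule assms)+
    show "(0::real) < max 1 C" by simp
    show "0 \<le> a" by (simp add: a_def)
    show "norm (A s *v v) \<le> a * norm v" if "s \<in> space N" for s v
    proof -
      have "norm (A s *v v) \<le> real CARD('n) * norm (A s) * norm v" by (rule norm_matrix_vector_mult_le)
      also have "\<dots> \<le> a * norm v"
        unfolding a_def using b[OF that] by (intro mult_right_mono mult_left_mono) auto
      finally show ?thesis .
    qed
    show "AE \<omega> in M. R 1 \<omega> \<le> max 1 C" using C by eventually_elim auto
  qed
  show ?thesis
    using exponentially_imp_stochastically_mean_stable[of M m x] stochastically_stable_imp_schur[of m]
      schur_imp_exponentially_stable[OF _ A1 assms(2)]
    unfolding mean_lift_def by blast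
qed

end
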